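(* Fix $\lambda\in\mathbb{R}$ and consider the diffusion $P_t$, $t\in(a,b]$, satisfying $$dP_t=\left(-2\lambda-P_t^2+\tfrac12P_t\right)dt+P_t\,dW_t,$$ started at $+\infty$ at $t=a$ (i.e. $P_{a+\epsilon}\to+\infty$ as $\epsilon\to0^+$), and restarted at $+\infty$ immediately after any passage to $-\infty$. Then (almost surely) the number of eigenvalues of $L$ less than $\lambda$ is equal to the number of explosions of $P_t$ (passages to $-\infty$) on $(a,b]$.
   Context: $a<b$ are fixed and $W$ is a two-sided Brownian motion; the same $W$ drives the stochastic differential equation (Itô sense) and defines the random operator $Lf(x)=\frac{e^{W(x)}}{2}\left(e^{-W(x)}f'(x)\right)'$ with domain the differentiable functions $f$ on $[a,b]$ such that $f(a)=f(b)=0$ and $f'=e^{W}g$ with $g\in C^1$. A number $\mu$ is an eigenvalue of $L$ if there is $\phi\neq0$ in the domain with $L\phi+\mu\phi=0$. The process $P$ is the Riccati transform $P_t=\psi'(t,\lambda)/\psi(t,\lambda)$ (valid whenever $\psi$ is nonzero), where $\psi(\cdot,\lambda)$ solves $\frac{e^{W(x)}}{2}\left(e^{-W(x)}\psi'(x,\lambda)\right)'+\lambda\psi(x,\lambda)=0$ with $\psi(a,\lambda)=0$, $\psi'(a,\lambda)=1$ ($'$ is the derivative in the first variable). *)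

theory Defs
  imports "HOL-Probability.Probability"
begin

section \<open>Brownian motion on the real line\<close>

definition two_sided_BM :: "'w measure \<Rightarrow> (real \<Rightarrow> 'w \<Rightarrow> real) \<Rightarrow> bool" where
  "two_sided_BM M W \<longleftrightarrow>
     prob_space M \<and>
     (\<forall>t. W t \<in> borel_measurable M) \<and>
     (AE \<omega> in M. W 0 \<omega> = 0) \<and>
     (\<forall>s t. s < t \<longrightarrow>
        distributed M lborel (\<lambda>\<omega>. W t \<omega> - W s \<omega>) (normal_density 0 (sqrt (t - s)))) \<and>
     (\<forall>n (\<tau> :: nat \<Rightarrow> real). mono \<tau> \<longrightarrow>
        prob_space.indep_vars M (\<lambda>_. borel) (\<lambda>i \<omega>. W (\<tau> (Suc i)) \<omega> - W (\<tau> i) \<omega>) {..<n}) \<and>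
     (AE \<omega> in M. continuous_on UNIV (\<lambda>t. W t \<omega>))"

text \<open>
  A filtration for which the increments of \<open>W\<close> after time \<open>a\<close> form a Brownian motion.
  Only \<open>W t - W a\<close> is required to be adapted, not \<open>W t\<close> itself: if \<open>a < 0\<close>, the normalisation
  \<open>W 0 = 0\<close> makes \<open>W a\<close> depend on the increments of \<open>W\<close> over \<open>[a, 0]\<close>.
\<close>

definition BM_filtration ::
  "'w measure \<Rightarrow> (real \<Rightarrow> 'w measure) \<Rightarrow> (real \<Rightarrow> 'w \<Rightarrow> real) \<Rightarrow> real \<Rightarrow> real \<Rightarrow> bool" where
  "BM_filtration M F W a b \<longleftrightarrow>
     filtration (space M) F \<and>
     (\<forall>t\<in>{a..b}. sets (F t) \<subseteq> sets M) \<and>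
     (\<forall>t\<in>{a..b}. (\<lambda>\<omega>. W t \<omega> - W a \<omega>) \<in> borel_measurable (F t)) \<and>
     (\<forall>s t. a \<le> s \<longrightarrow> s \<le> t \<longrightarrow> t \<le> b \<longrightarrow>
        prob_space.indep_set M (sets (F s))
          {(\<lambda>\<omega>. W t \<omega> - W s \<omega>) -` A \<inter> space M | A. A \<in> sets borel})"

section \<open>The Ito integral\<close>

definition simple_integrand ::
  "(real \<Rightarrow> 'w measure) \<Rightarrow> real \<Rightarrow> real \<Rightarrow> nat \<Rightarrow> (nat \<Rightarrow> real) \<Rightarrow> (nat \<Rightarrow> 'w \<Rightarrow> real) \<Rightarrow> bool" where
  "simple_integrand F s t n \<tau> \<xi> \<longleftrightarrow>
     \<tau> 0 = s \<and> \<tau> n = t \<and> (\<forall>i<n. \<tau> i \<le> \<tau> (Suc i)) \<and>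
     (\<forall>i<n. \<xi> i \<in> borel_measurable (F (\<tau> i)) \<and>
            (\<exists>C. \<forall>\<omega>\<in>space (F (\<tau> i)). \<bar>\<xi> i \<omega>\<bar> \<le> C))"

definition simple_process ::
  "nat \<Rightarrow> (nat \<Rightarrow> real) \<Rightarrow> (nat \<Rightarrow> 'w \<Rightarrow> real) \<Rightarrow> real \<Rightarrow> 'w \<Rightarrow> real" where
  "simple_process n \<tau> \<xi> u \<omega> = (\<Sum>i<n. \<xi> i \<omega> * indicator {\<tau> i<..\<tau> (Suc i)} u)"

definition simple_ito_integral ::
  "(real \<Rightarrow> 'w \<Rightarrow> real) \<Rightarrow> nat \<Rightarrow> (nat \<Rightarrow> real) \<Rightarrow> (nat \<Rightarrow> 'w \<Rightarrow> real) \<Rightarrow> 'w \<Rightarrow> real" where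
  "simple_ito_integral W n \<tau> \<xi> \<omega> = (\<Sum>i<n. \<xi> i \<omega> * (W (\<tau> (Suc i)) \<omega> - W (\<tau> i) \<omega>))"

text \<open>
  \<open>I\<close> is a version of \<open>\<integral>\<^sub>s\<^sup>t H dW\<close>, for a jointly measurable adapted integrand \<open>H\<close>: the \<open>L\<^sup>2\<close> limit
  of the integrals of simple processes that converge to \<open>H\<close> in \<open>L\<^sup>2\<close> of the product measure.
  Square integrability of \<open>H\<close> follows, simple processes being bounded.
\<close>

definition has_ito_integral ::
  "'w measure \<Rightarrow> (real \<Rightarrow> 'w measure) \<Rightarrow> (real \<Rightarrow> 'w \<Rightarrow> real) \<Rightarrow> real \<Rightarrow> real \<Rightarrow>
   (real \<Rightarrow> 'w \<Rightarrow> real) \<Rightarrow> ('w \<Rightarrow> real) \<Rightarrow> bool" where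
  "has_ito_integral M F W s t H I \<longleftrightarrow>
     (\<lambda>(u, \<omega>). H u \<omega>) \<in> borel_measurable (restrict_space borel {s..t} \<Otimes>\<^sub>M M) \<and>
     (\<forall>u\<in>{s..t}. H u \<in> borel_measurable (F u)) \<and>
     I \<in> borel_measurable M \<and>
     (\<exists>n \<tau> \<xi>.
        (\<forall>k. simple_integrand F s t (n k) (\<tau> k) (\<xi> k)) \<and>
        (\<lambda>k. \<integral>\<^sup>+\<omega>. (\<integral>\<^sup>+u\<in>{s..t}. ennreal ((simple_process (n k) (\<tau> k) (\<xi> k) u \<omega> - H u \<omega>)\<^sup>2)
              \<partial>lborel) \<partial>M) \<longlonglongrightarrow> 0 \<and>
        (\<lambda>k. \<integral>\<^sup>+\<omega>. ennreal ((simple_ito_integral W (n k) (\<tau> k) (\<xi> k) \<omega> - I \<omega>)\<^sup>2) \<partial>M)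
          \<longlonglongrightarrow> 0)"

section \<open>Diffusions restarted at infinity\<close>

text \<open>
  Paths on \<open>(a, b]\<close> that start at \<open>\<infinity>\<close>, are continuous and real-valued except at the times of passage
  to \<open>-\<infinity>\<close>, and are restarted at \<open>\<infinity>\<close> immediately after each such passage.  At the time of the
  passage itself the path is given the value \<open>-\<infinity>\<close>, its left limit.
\<close>

definition restarting_path :: "real \<Rightarrow> real \<Rightarrow> (real \<Rightarrow> ereal) \<Rightarrow> bool" where
  "restarting_path a b p \<longleftrightarrow>
     (p \<longlongrightarrow> \<infinity>) (at_right a) \<and>
     (\<forall>t\<in>{a<..b}. p t \<noteq> \<infinity> \<and> (p \<longlongrightarrow> p t) (at_left t)) \<and>
     (\<forall>t\<in>{a<..<b}. (p \<longlongrightarrow> (if p t = -\<infinity> then \<infinity> else p t)) (at_right t))"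

definition explosion_times :: "real \<Rightarrow> real \<Rightarrow> (real \<Rightarrow> ereal) \<Rightarrow> real set" where
  "explosion_times a b p = {t \<in> {a<..b}. p t = -\<infinity>}"

text \<open>
  The integrand \<open>\<sigma>(P)\<close>, switched off after \<open>P\<close> first leaves \<open>[-N, N]\<close> following time \<open>s\<close>.
\<close>

definition localized ::
  "(real \<Rightarrow> real) \<Rightarrow> (real \<Rightarrow> 'w \<Rightarrow> ereal) \<Rightarrow> real \<Rightarrow> real \<Rightarrow> real \<Rightarrow> 'w \<Rightarrow> real" where
  "localized \<sigma> P s N u \<omega> =
     (if \<forall>v\<in>{s..u}. \<bar>P v \<omega>\<bar> \<le> ereal N then \<sigma> (real_of_ereal (P u \<omega>)) else 0)"

text \<open>
  \<open>P\<close> is adapted, has restarting paths, and satisfies \<open>dP = \<beta>(P) dt + \<sigma>(P) dW\<close> in the Ito sense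
  between explosions.  The equation is localized as usual: over \<open>[s, t]\<close> it is imposed on the event
  that \<open>\<bar>P\<bar> \<le> N\<close> throughout \<open>[s, t]\<close>, where the localized integrand agrees with \<open>\<sigma>(P)\<close>.  Every interval
  \<open>[s, t]\<close> in \<open>(a, b]\<close> without explosions is covered, since \<open>P\<close> is bounded on it.
\<close>

definition restarted_ito_diffusion ::
  "'w measure \<Rightarrow> (real \<Rightarrow> 'w measure) \<Rightarrow> (real \<Rightarrow> 'w \<Rightarrow> real) \<Rightarrow> real \<Rightarrow> real \<Rightarrow>
   (real \<Rightarrow> real) \<Rightarrow> (real \<Rightarrow> real) \<Rightarrow> (real \<Rightarrow> 'w \<Rightarrow> ereal) \<Rightarrow> bool" where
  "restarted_ito_diffusion M F W a b \<beta> \<sigma> P \<longleftrightarrow>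
     (\<forall>t\<in>{a<..b}. P t \<in> borel_measurable (F t)) \<and>
     (AE \<omega> in M. restarting_path a b (\<lambda>t. P t \<omega>)) \<and>
     (\<forall>s t N. a < s \<longrightarrow> s \<le> t \<longrightarrow> t \<le> b \<longrightarrow>
        (\<exists>I. has_ito_integral M F W s t (localized \<sigma> P s N) I \<and>
             (AE \<omega> in M. (\<forall>v\<in>{s..t}. \<bar>P v \<omega>\<bar> \<le> ereal N) \<longrightarrow>
                real_of_ereal (P t \<omega>) - real_of_ereal (P s \<omega>) =
                (LBINT u:{s..t}. \<beta> (real_of_ereal (P u \<omega>))) + I \<omega>)))"

section \<open>The operator\<close>

text \<open>
  Functions on \<open>[a, b]\<close> are functions on the reals of which only the restriction matters; derivatives
  are taken within \<open>[a, b]\<close>, hence one-sided at the endpoints.  Here \<open>w\<close> is a path of \<open>W\<close>.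
\<close>

definition C1_within :: "real \<Rightarrow> real \<Rightarrow> (real \<Rightarrow> real) \<Rightarrow> bool" where
  "C1_within a b g \<longleftrightarrow>
     (\<exists>g'. (\<forall>x\<in>{a..b}. (g has_real_derivative g' x) (at x within {a..b})) \<and>
           continuous_on {a..b} g')"

definition L_domain :: "(real \<Rightarrow> real) \<Rightarrow> real \<Rightarrow> real \<Rightarrow> (real \<Rightarrow> real) set" where
  "L_domain w a b =
     {f. f a = 0 \<and> f b = 0 \<and>
         (\<exists>g. C1_within a b g \<and>
              (\<forall>x\<in>{a..b}. (f has_real_derivative exp (w x) * g x) (at x within {a..b})))}"

definition L_op :: "(real \<Rightarrow> real) \<Rightarrow> real \<Rightarrow> real \<Rightarrow> (real \<Rightarrow> real) \<Rightarrow> real \<Rightarrow> real" where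
  "L_op w a b f x =
     exp (w x) / 2 *
     vector_derivative (\<lambda>y. exp (- w y) * vector_derivative f (at y within {a..b}))
       (at x within {a..b})"

definition L_eigenvalue :: "(real \<Rightarrow> real) \<Rightarrow> real \<Rightarrow> real \<Rightarrow> real \<Rightarrow> bool" where
  "L_eigenvalue w a b \<mu> \<longleftrightarrow>
     (\<exists>\<phi>\<in>L_domain w a b. (\<exists>x\<in>{a..b}. \<phi> x \<noteq> 0) \<and>
        (\<forall>x\<in>{a..b}. L_op w a b \<phi> x + \<mu> * \<phi> x = 0))"

end

(*
  Ito's formula turns the equation for P into a pathwise one: Q = exp (- W) * P satisfies the Riccati
  equation Q' = - 2 lam exp (- W) - exp W * Q^2 between explosions.  Ito calculus is needed for this
  single identity only, and it is obtained directly from the L^2 definition of the integral: along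
  finer and finer partitions the errors of freezing the integrand are orthogonal martingale
  differences, so their weighted sums vanish in L^2, hence almost surely along a subsequence.

  On a fixed path the eigenvalue problem is governed by the Pruefer angle theta of the solution,
  theta' = exp W cos^2 theta + 2 mu exp (- W) sin^2 theta, theta(a) = 0.  It is continuous and strictly
  increasing in mu at x = b and can cross multiples of pi only upwards in x, so the eigenvalues below
  lam and the zeros of sin theta(., lam) on (a, b] are both counted by the multiples of pi below
  theta(b, lam), provided that lam itself is not an eigenvalue.  A Wronskian-type quantity shows that
  Q = cot theta up to and across the explosions, which are therefore the zeros of sin theta.

  That lam is almost surely not an eigenvalue, i.e. that there is no explosion exactly at b, follows
  by anti-concentration.  Just before such an explosion 1 / Q is determined up to a relative error
  O(e^2) by the increments of W after b - e, whereas the independent increment of W over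
  [b - e - e^3, b - e] fluctuates at the larger scale e^(3/2).
*)
theory Submission
  imports Defs
begin

section \<open>Scalar differential equations\<close>

text \<open>An explosion exactly at b would be counted on one side, while the eigenvalue lam it
  stands for is not strictly below lam. This single event is why the pathwise comparison has to be
  completed by a probabilistic argument. The Riccati variable starts at infinity and passes through
  it, so uniqueness for its own equation cannot be invoked. It is compared with the angle through
  the squared sine of a difference of two angles, which extends continuously over the starting point
  and the explosions and obeys a linear differential inequality. The exponent 3 at the endpoint: the
  increment of W over a window of length e^k has size e^(k/2), moving across the window costs a
  relative error e^(k-1), and the Riccati equation itself costs e^2. The fluctuation dominates if
  k/2 < k - 1 and k/2 < 2, that is for 2 < k < 4. Only W t - W a is adapted, so the stochastic part
  works with exp (- (W t - W a)) in place of exp (- W t); the constant factor exp (W a) cancels at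
  the end.\<close>

lemma picard_lindelof_scalar:
  fixes f :: "real \<Rightarrow> real \<Rightarrow> real"
  assumes ab: "a \<le> b" and L: "L > 0"
    and lip: "\<And>t x y. t \<in> {a..b} \<Longrightarrow> \<bar>f t x - f t y\<bar> \<le> L * \<bar>x - y\<bar>"
    and cont: "\<And>y. continuous_on {a..b} y \<Longrightarrow> continuous_on {a..b} (\<lambda>t. f t (y t))"
  shows "\<exists>y. y a = 0 \<and>
    (\<forall>x\<in>{a..b}. (y has_real_derivative f x (y x)) (at x within {a..b}))"
proof -
  \<comment> \<open>An exponential weight (Bielecki norm): in the unknown
    \<open>z t = exp (- K * t) * y t\<close> the integral operator contracts with factor L / K = 1/2
    on all of {a..b}, so no local solutions have to be glued.\<close>
  define K where "K = 2 * L"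
  have K: "K > 0" using L by (simp add: K_def)
  define g where "g z t = f t (exp (K * t) * z t)" for z t
  define J where "J z x = exp (- K * x) * integral {a..x} (g z)" for z x
  have gc: "continuous_on {a..b} (g (apply_bcontfun z))" for z
    unfolding g_def by (intro cont continuous_intros continuous_on_apply_bcontfun)
  have gi: "g (apply_bcontfun z) integrable_on {a..x}" if "x \<in> {a..b}" for z x
    by (rule integrable_continuous_interval, rule continuous_on_subset[OF gc]) (use that in auto)
  have Jc: "continuous_on (cbox a b) (J (apply_bcontfun z))" for z
    unfolding J_def cbox_interval
    by (intro continuous_intros indefinite_integral_continuous_1 gi) (use ab in auto)
  \<comment> \<open>The fixed point is taken in the complete space of bounded continuous functions
    on the line. Composition with \<open>clamp\<close> extends \<open>J z\<close> from {a..b} by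
    constants; values off {a..b} do not enter \<open>J\<close>.\<close>
  have "\<forall>z. \<exists>h :: real \<Rightarrow>\<^sub>C real. \<forall>x. h x = J (apply_bcontfun z) (clamp a b x)"
    using continuous_on_cbox_bcontfunE[OF Jc] by metis
  then obtain T :: "(real \<Rightarrow>\<^sub>C real) \<Rightarrow> (real \<Rightarrow>\<^sub>C real)"
    where T: "\<And>z x. T z x = J (apply_bcontfun z) (clamp a b x)" by metis
  have clamp_in: "clamp a b x \<in> {a..b}" for x :: real
    using clamp_in_interval[of a b x] ab by auto
  have contr: "dist (T z1) (T z2) \<le> 1 / 2 * dist z1 z2" for z1 z2
  proof (rule dist_bound)
    fix x0 :: real
    define x where "x = clamp a b x0"
    have x: "x \<in> {a..b}" using clamp_in by (simp add: x_def)
    define d where "d = dist z1 z2"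
    have pt: "norm (g z1 t - g z2 t) \<le> L * d * exp (K * t)" if "t \<in> {a..x}" for t
    proof -
      have "\<bar>g z1 t - g z2 t\<bar> \<le> L * \<bar>exp (K * t) * z1 t - exp (K * t) * z2 t\<bar>"
        unfolding g_def by (rule lip) (use that x in auto)
      also have "\<dots> = L * exp (K * t) * \<bar>z1 t - z2 t\<bar>"
        by (simp add: abs_mult right_diff_distrib[symmetric])
      also have "\<dots> \<le> L * exp (K * t) * d"
        using dist_bounded[of z1 t z2] L by (simp add: d_def dist_real_def)
      finally show ?thesis by (simp add: mult_ac)
    qed
    have E: "((\<lambda>t. L * d * exp (K * t)) has_integral
        (L * d * (exp (K * x) / K) - L * d * (exp (K * a) / K))) {a..x}"
      by (rule fundamental_theorem_of_calculus)
        (use x K in \<open>auto intro!: derivative_eq_intros simp: has_real_derivative_iff_has_vector_derivative[symmetric]\<close>)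
    have "norm (integral {a..x} (\<lambda>t. g z1 t - g z2 t)) \<le> integral {a..x} (\<lambda>t. L * d * exp (K * t))"
      by (intro integral_norm_bound_integral integrable_diff gi x pt)
        (use E in \<open>auto simp: integrable_on_def\<close>)
    also have "\<dots> = L * d * (exp (K * x) / K) - L * d * (exp (K * a) / K)"
      using E by (rule integral_unique)
    also have "\<dots> \<le> d / 2 * exp (K * x)"
    proof -
      have "L * d * (exp (K * x) / K) = d / 2 * exp (K * x)" using L by (simp add: K_def)
      moreover have "L * d * (exp (K * a) / K) \<ge> 0" using L K by (simp add: d_def)
      ultimately show ?thesis by linarith
    qed
    finally have I: "\<bar>integral {a..x} (\<lambda>t. g z1 t - g z2 t)\<bar> \<le> d / 2 * exp (K * x)" by simp
    have "T z1 x0 - T z2 x0 = exp (- K * x) * integral {a..x} (\<lambda>t. g z1 t - g z2 t)"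
      unfolding T J_def x_def[symmetric]
      by (subst integral_diff) (auto intro!: gi x simp: algebra_simps)
    then have "dist (T z1 x0) (T z2 x0) = exp (- K * x) * \<bar>integral {a..x} (\<lambda>t. g z1 t - g z2 t)\<bar>"
      by (simp add: dist_real_def abs_mult)
    also have "\<dots> \<le> exp (- K * x) * (d / 2 * exp (K * x))"
      using I by (intro mult_left_mono) auto
    also have "\<dots> = 1 / 2 * d" by (simp add: exp_minus)
    finally show "dist (T z1 x0) (T z2 x0) \<le> 1 / 2 * dist z1 z2" by (simp add: d_def)
  qed
  obtain z where z: "T z = z" using banach_fix_type[of "1/2" T] contr by auto
  define y where "y x = exp (K * x) * z x" for x
  have y: "y x = integral {a..x} (g z)" if "x \<in> {a..b}" for x
  proof -
    have "z x = J z (clamp a b x)" using T[of z x] z by simp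
    also have "clamp a b x = x" using that by (simp add: clamp_cancel_cbox)
    finally show ?thesis by (simp add: y_def J_def exp_minus)
  qed
  have gy: "g z t = f t (y t)" for t by (simp add: g_def y_def)
  have "(y has_real_derivative f x (y x)) (at x within {a..b})" if x: "x \<in> {a..b}" for x
  proof -
    have "((\<lambda>u. integral {a..u} (g z)) has_real_derivative g z x) (at x within {a..b})"
      by (rule integral_has_real_derivative[OF gc x])
    then show ?thesis
      unfolding has_field_derivative_def gy[of x] by (rule has_derivative_transform[OF x y, rotated])
  qed
  moreover have "y a = 0" using y[of a] ab by simp
  ultimately show ?thesis by blast
qed

text \<open>The exceptional set \<open>S\<close> is meant for explosion times, where a quantity
  stays continuous but its derivative is unknown; the fundamental theorem of calculus tolerates
  finitely many such points.\<close>

lemma decreasing_on_Icc_finite_exceptions: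
  fixes f :: "real \<Rightarrow> real"
  assumes "finite S" "a \<le> b" "continuous_on {a..b} f"
    and "\<And>x. x \<in> {a<..<b} - S \<Longrightarrow> (f has_real_derivative f' x) (at x)"
    and "\<And>x. x \<in> {a<..<b} - S \<Longrightarrow> f' x \<le> 0"
  shows "f b \<le> f a"
proof -
  define f'' where "f'' x = (if x \<in> {a<..<b} - S then f' x else 0)" for x
  have "(f'' has_integral (f b - f a)) {a..b}"
    using assms
    by (intro fundamental_theorem_of_calculus_interior_strong[of S])
      (auto simp: has_real_derivative_iff_has_vector_derivative[symmetric] f''_def)
  from has_integral_neg[OF this] have "0 \<le> - (f b - f a)"
    by (rule has_integral_nonneg) (use assms in \<open>auto simp: f''_def\<close>)
  then show ?thesis by simp
qed

lemma at_within_Icc_interior: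
  fixes a b x :: real
  assumes "a < x" "x < b"
  shows "at x within {a..b} = at x"
  by (rule at_within_interior) (use assms in simp)

text \<open>Multiplied by exp (- C x), \<open>y\<close> is nonincreasing; it starts at 0 and cannot
  become negative.\<close>

lemma gronwall_forward_zero:
  fixes y :: "real \<Rightarrow> real"
  assumes S: "finite S" and ab: "a \<le> b" and c: "continuous_on {a..b} y"
    and d: "\<And>x. x \<in> {a<..<b} - S \<Longrightarrow> (y has_real_derivative y' x) (at x)"
    and le: "\<And>x. x \<in> {a<..<b} - S \<Longrightarrow> y' x \<le> C * y x"
    and nonneg: "\<And>x. x \<in> {a..b} \<Longrightarrow> y x \<ge> 0" and y0: "y a = 0"
  shows "y b = 0"
proof -
  have "exp (- C * b) * y b \<le> exp (- C * a) * y a"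
    by (rule decreasing_on_Icc_finite_exceptions[OF S ab,
          where f' = "\<lambda>x. exp (- C * x) * (y' x - C * y x)"])
      (use le in \<open>auto intro!: continuous_intros c derivative_eq_intros d simp: algebra_simps\<close>)
  then show ?thesis using nonneg[of b] y0 ab by (auto simp: mult_le_0_iff)
qed

text \<open>Reduced to the nonnegative case through y^2, whose derivative 2 y y' is at most 2 C y^2
  in absolute value. Times before \<open>x0\<close> are reached by reflecting the axis.\<close>

lemma gronwall_zero:
  fixes y :: "real \<Rightarrow> real"
  assumes d: "\<And>x. x \<in> {a..b} \<Longrightarrow> (y has_real_derivative y' x) (at x within {a..b})"
    and le: "\<And>x. x \<in> {a..b} \<Longrightarrow> \<bar>y' x\<bar> \<le> C * \<bar>y x\<bar>"
    and x0: "x0 \<in> {a..b}" "y x0 = 0" and x: "x \<in> {a..b}"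
  shows "y x = 0"
proof -
  have c: "continuous_on {a..b} y"
    by (rule DERIV_continuous_on[OF d])
  have di: "(y has_real_derivative y' u) (at u)" if "u \<in> {a<..<b}" for u
    using d[of u] that by (simp add: at_within_Icc_interior)
  have b2: "\<bar>y u * y' u\<bar> \<le> C * (y u)\<^sup>2" if "u \<in> {a..b}" for u
  proof -
    have "\<bar>y u\<bar> * \<bar>y' u\<bar> \<le> \<bar>y u\<bar> * (C * \<bar>y u\<bar>)"
      by (rule mult_left_mono[OF le[OF that]]) simp
    also have "\<dots> = C * (\<bar>y u\<bar> * \<bar>y u\<bar>)" by (simp only: mult_ac)
    finally show ?thesis by (simp add: abs_mult power2_eq_square)
  qed
  consider "x0 \<le> x" | "x \<le> x0" by linarith
  then show ?thesis
  proof cases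
    case 1
    have "(y x)\<^sup>2 = 0"
    proof (rule gronwall_forward_zero[of "{}" x0 x "\<lambda>x. (y x)\<^sup>2" "\<lambda>x. 2 * (y x * y' x)" "2 * C"])
      show "continuous_on {x0..x} (\<lambda>x. (y x)\<^sup>2)"
        by (intro continuous_intros continuous_on_subset[OF c]) (use x0 x in auto)
      show "((\<lambda>x. (y x)\<^sup>2) has_real_derivative 2 * (y u * y' u)) (at u)"
        if "u \<in> {x0<..<x} - {}" for u
        by (rule derivative_eq_intros di refl)+ (use that x0 x in \<open>auto simp: mult_ac\<close>)
      show "2 * (y u * y' u) \<le> 2 * C * (y u)\<^sup>2" if "u \<in> {x0<..<x} - {}" for u
        using b2[of u] that x0 x by auto
    qed (use 1 x0 in auto)
    then show ?thesis by simp
  next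
    case 2
    have "(y (- (- x)))\<^sup>2 = 0"
    proof (rule gronwall_forward_zero[of "{}" "-x0" "-x" "\<lambda>x. (y (-x))\<^sup>2" "\<lambda>x. - 2 * (y (-x) * y' (-x))" "2 * C"])
      show "continuous_on {-x0..-x} (\<lambda>x. (y (-x))\<^sup>2)"
        by (intro continuous_intros continuous_on_compose2[OF c]) (use x0 x in auto)
      show "((\<lambda>x. (y (-x))\<^sup>2) has_real_derivative - 2 * (y (-u) * y' (-u))) (at u)"
        if "u \<in> {-x0<..<-x} - {}" for u
      proof -
        have "((\<lambda>x. y (- x)) has_real_derivative - y' (-u)) (at u)"
          using di[of "-u"] that x0 x by (intro DERIV_mirror[THEN iffD1]) auto
        from DERIV_power[OF this, of 2] show ?thesis by (simp add: mult_ac)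
      qed
      show "- 2 * (y (-u) * y' (-u)) \<le> 2 * C * (y (-u))\<^sup>2" if "u \<in> {-x0<..<-x} - {}" for u
        using b2[of "-u"] that x0 x by auto
    qed (use 2 x0 in auto)
    then show ?thesis by simp
  qed
qed

text \<open>The differential inequality is asked only where z \<le> y, so that a supersolution may
  be verified under that assumption. If z < y at \<open>x1\<close>, then after the last earlier
  point \<open>x0\<close> with z = y the difference d = z - y is negative, so exp (- L x) d is
  nondecreasing from its value 0 at \<open>x0\<close>, a contradiction.\<close>

lemma comparison_le:
  fixes y z :: "real \<Rightarrow> real"
  assumes dy: "\<And>x. x \<in> {a..b} \<Longrightarrow> (y has_real_derivative y' x) (at x within {a..b})"
    and dz: "\<And>x. x \<in> {a..b} \<Longrightarrow> (z has_real_derivative z' x) (at x within {a..b})"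
    and le: "\<And>x. x \<in> {a..b} \<Longrightarrow> z x \<le> y x \<Longrightarrow> z' x - y' x \<ge> - L * \<bar>z x - y x\<bar>"
    and init: "y a \<le> z a" and x1: "x1 \<in> {a..b}"
  shows "y x1 \<le> z x1"
proof (rule ccontr)
  assume "\<not> y x1 \<le> z x1"
  define d where "d x = z x - y x" for x
  have cd: "continuous_on {a..b} d"
    unfolding d_def by (intro continuous_intros DERIV_continuous_on[OF dy] DERIV_continuous_on[OF dz])
  have neg: "d x1 < 0" using \<open>\<not> y x1 \<le> z x1\<close> by (simp add: d_def)
  have "\<exists>x0. a \<le> x0 \<and> x0 \<le> x1 \<and> d x0 = 0 \<and> (\<forall>x. x0 < x \<and> x \<le> x1 \<longrightarrow> d x < 0)"
  proof -
    define A where "A = {x \<in> {a..x1}. d x \<in> {0..}}"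
    have "A = {a..x1} \<inter> d -` {0..}" by (auto simp: A_def)
    then have cA: "closed A"
      using continuous_closed_preimage[of "{a..x1}" d "{0..}"] continuous_on_subset[OF cd, of "{a..x1}"] x1
      by auto
    have aA: "a \<in> A" using init x1 by (auto simp: A_def d_def)
    have bA: "bdd_above A" by (rule bdd_aboveI[of _ x1]) (auto simp: A_def)
    define x0 where "x0 = Sup A"
    have x0A: "x0 \<in> A" unfolding x0_def by (rule closed_contains_Sup) (use aA bA cA in auto)
    have mx: "d x < 0" if "x0 < x" "x \<le> x1" for x
    proof (rule ccontr)
      assume "\<not> d x < 0"
      then have "x \<in> A" using that x0A by (auto simp: A_def)
      then have "x \<le> x0" unfolding x0_def by (rule cSup_upper[OF _ bA])
      then show False using that by simp
    qed
    have "d x0 = 0"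
    proof (rule ccontr)
      assume "d x0 \<noteq> 0"
      then have p: "d x0 > 0" using x0A by (auto simp: A_def)
      have x01: "x0 \<le> x1" using x0A by (auto simp: A_def)
      obtain x where "x0 \<le> x" "x \<le> x1" "d x = 0"
        using IVT2'[of d x1 0 x0] p neg x01 continuous_on_subset[OF cd, of "{x0..x1}"] x0A x1
        by (auto simp: A_def)
      then show False using mx[of x] p by (cases "x = x0") auto
    qed
    then show ?thesis using x0A mx by (intro exI[of _ x0]) (auto simp: A_def)
  qed
  then obtain x0 where x0: "a \<le> x0" "x0 \<le> x1" "d x0 = 0" and mx: "\<And>x. x0 < x \<Longrightarrow> x \<le> x1 \<Longrightarrow> d x < 0"
    by blast
  have "- (exp (- L * x1) * d x1) \<le> - (exp (- L * x0) * d x0)"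
  proof (rule decreasing_on_Icc_finite_exceptions[of "{}" x0 x1 "\<lambda>x. - (exp (- L * x) * d x)" "\<lambda>x. - (exp (- L * x) * (z' x - y' x - L * d x))"])
    show "continuous_on {x0..x1} (\<lambda>x. - (exp (- L * x) * d x))"
      by (intro continuous_intros continuous_on_subset[OF cd]) (use x0 x1 in auto)
    fix x assume "x \<in> {x0<..<x1} - {}"
    then have x: "x0 < x" "x < x1" by auto
    have "(d has_real_derivative (z' x - y' x)) (at x)"
      unfolding d_def using dy[of x] dz[of x] x x0 x1
      by (auto intro!: derivative_intros simp: at_within_Icc_interior)
    then show "((\<lambda>x. - (exp (- L * x) * d x)) has_real_derivative - (exp (- L * x) * (z' x - y' x - L * d x))) (at x)"
      by (auto intro!: derivative_eq_intros simp: algebra_simps)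
    have "z' x - y' x - L * d x \<ge> 0"
      using le[of x] mx[of x] x x0 x1 by (auto simp: d_def algebra_simps)
    then show "- (exp (- L * x) * (z' x - y' x - L * d x)) \<le> 0" by simp
  qed (use x0 in auto)
  then show False using neg x0 by (simp add: mult_le_0_iff zero_le_mult_iff)
qed

section \<open>The Pruefer angle\<close>

lemma abs_cos_sq_diff_le: "\<bar>(cos x)\<^sup>2 - (cos y)\<^sup>2\<bar> \<le> \<bar>x - y\<bar>" for x y :: real
proof -
  have "(cos x)\<^sup>2 - (cos y)\<^sup>2 = - (sin (x + y) * sin (x - y))"
  proof -
    have "sin (x + y) * sin (x - y) = (sin x)\<^sup>2 * (cos y)\<^sup>2 - (cos x)\<^sup>2 * (sin y)\<^sup>2"
      unfolding sin_add sin_diff by (simp add: algebra_simps power2_eq_square)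
    then show ?thesis by (simp add: sin_squared_eq algebra_simps)
  qed
  then have "\<bar>(cos x)\<^sup>2 - (cos y)\<^sup>2\<bar> = \<bar>sin (x + y)\<bar> * \<bar>sin (x - y)\<bar>"
    by (simp add: abs_mult)
  also have "\<dots> \<le> 1 * \<bar>x - y\<bar>"
    by (intro mult_mono abs_sin_x_le_abs_x) auto
  finally show ?thesis by simp
qed

locale continuous_potential =
  fixes w :: "real \<Rightarrow> real" and a b :: real
  assumes ab: "a < b" and cont_w: "continuous_on {a..b} w"
begin

text \<open>With psi = r sin theta and exp (- w) psi' = r cos theta, the eigenvalue equation reads
  (exp (- w) psi')' = - 2 \<mu> exp (- w) psi; eliminating the radius leaves this field for theta.
  Unlike psi'/psi, the angle has no singularity where psi vanishes.\<close>

definition angle_field :: "real \<Rightarrow> real \<Rightarrow> real \<Rightarrow> real" where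
  "angle_field \<mu> t y = exp (w t) * (cos y)\<^sup>2 + 2 * \<mu> * exp (- w t) * (sin y)\<^sup>2"

definition theta :: "real \<Rightarrow> real \<Rightarrow> real" where
  "theta \<mu> = (SOME y. y a = 0 \<and>
     (\<forall>x\<in>{a..b}. (y has_real_derivative angle_field \<mu> x (y x)) (at x within {a..b})))"

lemma exp_w_bound: "\<exists>B>0. \<forall>t\<in>{a..b}. exp (w t) \<le> B \<and> exp (- w t) \<le> B"
proof -
  have "compact (w ` {a..b})" by (intro compact_continuous_image cont_w) auto
  then have "bounded (w ` {a..b})" by (rule compact_imp_bounded)
  then obtain K where K: "\<And>t. t \<in> {a..b} \<Longrightarrow> \<bar>w t\<bar> \<le> K"
    unfolding bounded_iff by force
  have "w t \<le> K \<and> - w t \<le> K" if "t \<in> {a..b}" for t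
    using K[OF that] by linarith
  then show ?thesis by (intro exI[of _ "exp K"]) simp
qed

text \<open>The angle enters only through cos^2, with coefficient exp (w t) - 2 \<mu> exp (- w t).
  One constant serves all bounded \<mu>, which later makes \<open>theta \<mu> b\<close> locally
  Lipschitz in \<mu>.\<close>

lemma angle_field_Lipschitz:
  "\<exists>L>0. \<forall>\<mu> t x y. \<bar>\<mu>\<bar> \<le> M \<longrightarrow> t \<in> {a..b} \<longrightarrow>
    \<bar>angle_field \<mu> t x - angle_field \<mu> t y\<bar> \<le> L * \<bar>x - y\<bar>"
proof -
  obtain B where B: "B > 0" "\<And>t. t \<in> {a..b} \<Longrightarrow> exp (w t) \<le> B" "\<And>t. t \<in> {a..b} \<Longrightarrow> exp (- w t) \<le> B"
    using exp_w_bound by blast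
  have "\<bar>angle_field \<mu> t x - angle_field \<mu> t y\<bar> \<le> (B + 2 * \<bar>M\<bar> * B) * \<bar>x - y\<bar>"
    if \<mu>: "\<bar>\<mu>\<bar> \<le> M" and t: "t \<in> {a..b}" for \<mu> t x y
  proof -
    have "angle_field \<mu> t x - angle_field \<mu> t y = (exp (w t) - 2 * \<mu> * exp (- w t)) * ((cos x)\<^sup>2 - (cos y)\<^sup>2)"
      unfolding angle_field_def by (simp add: sin_squared_eq algebra_simps)
    then have "\<bar>angle_field \<mu> t x - angle_field \<mu> t y\<bar>
        = \<bar>exp (w t) - 2 * \<mu> * exp (- w t)\<bar> * \<bar>(cos x)\<^sup>2 - (cos y)\<^sup>2\<bar>" by (simp add: abs_mult)
    also have "\<dots> \<le> (B + 2 * \<bar>M\<bar> * B) * \<bar>x - y\<bar>"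
    proof (intro mult_mono abs_cos_sq_diff_le)
      have "\<bar>2 * \<mu> * exp (- w t)\<bar> \<le> 2 * \<bar>M\<bar> * B"
        unfolding abs_mult by (intro mult_mono) (use B \<mu> t in auto)
      moreover have "\<bar>exp (w t)\<bar> \<le> B" using B t by auto
      ultimately show "\<bar>exp (w t) - 2 * \<mu> * exp (- w t)\<bar> \<le> B + 2 * \<bar>M\<bar> * B" by linarith
    qed (use B in auto)
    finally show ?thesis .
  qed
  moreover have "B + 2 * \<bar>M\<bar> * B > 0" using B by (simp add: add_pos_nonneg)
  ultimately show ?thesis by blast
qed

lemma theta:
  shows theta_a: "theta \<mu> a = 0"
    and theta_deriv: "x \<in> {a..b} \<Longrightarrow>
      (theta \<mu> has_real_derivative angle_field \<mu> x (theta \<mu> x)) (at x within {a..b})"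
proof -
  obtain L where L: "L > 0"
    "\<And>\<mu>' t x y. \<bar>\<mu>'\<bar> \<le> \<bar>\<mu>\<bar> \<Longrightarrow> t \<in> {a..b} \<Longrightarrow> \<bar>angle_field \<mu>' t x - angle_field \<mu>' t y\<bar> \<le> L * \<bar>x - y\<bar>"
    using angle_field_Lipschitz[of "\<bar>\<mu>\<bar>"] by blast
  have "\<exists>y. y a = 0 \<and>
     (\<forall>x\<in>{a..b}. (y has_real_derivative angle_field \<mu> x (y x)) (at x within {a..b}))"
    by (rule picard_lindelof_scalar[OF _ L])
      (use ab in \<open>auto simp: angle_field_def intro!: continuous_intros cont_w\<close>)
  then have "theta \<mu> a = 0 \<and>
     (\<forall>x\<in>{a..b}. (theta \<mu> has_real_derivative angle_field \<mu> x (theta \<mu> x)) (at x within {a..b}))"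
    unfolding theta_def by (rule someI_ex)
  then show "theta \<mu> a = 0" "x \<in> {a..b} \<Longrightarrow>
      (theta \<mu> has_real_derivative angle_field \<mu> x (theta \<mu> x)) (at x within {a..b})" by auto
qed

lemma theta_cont: "continuous_on {a..b} (theta \<mu>)"
  by (rule DERIV_continuous_on[OF theta_deriv])

text \<open>The field increases with \<mu> because sin^2 \<ge> 0, so the solution for the larger
  parameter is a supersolution for the smaller one.\<close>

lemma theta_mono:
  assumes "\<mu> \<le> \<mu>'" "x \<in> {a..b}"
  shows "theta \<mu> x \<le> theta \<mu>' x"
proof -
  obtain L where L: "L > 0"
    "\<And>\<mu>'' t x y. \<bar>\<mu>''\<bar> \<le> \<bar>\<mu>'\<bar> \<Longrightarrow> t \<in> {a..b} \<Longrightarrow> \<bar>angle_field \<mu>'' t x - angle_field \<mu>'' t y\<bar> \<le> L * \<bar>x - y\<bar>"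
    using angle_field_Lipschitz[of "\<bar>\<mu>'\<bar>"] by blast
  show ?thesis
  proof (rule comparison_le[OF theta_deriv theta_deriv _ _ assms(2)])
    fix t assume t: "t \<in> {a..b}"
    have "angle_field \<mu> t (theta \<mu> t) \<le> angle_field \<mu>' t (theta \<mu> t)"
      unfolding angle_field_def using assms(1) by (auto intro!: mult_right_mono)
    then show "angle_field \<mu>' t (theta \<mu>' t) - angle_field \<mu> t (theta \<mu> t) \<ge> - L * \<bar>theta \<mu>' t - theta \<mu> t\<bar>"
      using L(2)[OF order_refl t, of "theta \<mu>' t" "theta \<mu> t"] by linarith
  qed (simp_all add: theta_a)
qed

text \<open>At a multiple of pi only the cosine term survives and the field is exp (w t) > 0,
  whatever the sign of \<mu>. Comparison with the constant k pi gives the weak inequality;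
  strictness comes from a weighted difference.\<close>

lemma theta_crosses_upward:
  assumes x0: "a \<le> x0" "x0 < x" "x \<le> b" and k: "theta \<mu> x0 \<ge> of_int k * pi"
  shows "theta \<mu> x > of_int k * pi"
proof -
  obtain L where L: "L > 0"
    "\<And>\<mu>'' t x y. \<bar>\<mu>''\<bar> \<le> \<bar>\<mu>\<bar> \<Longrightarrow> t \<in> {a..b} \<Longrightarrow> \<bar>angle_field \<mu>'' t x - angle_field \<mu>'' t y\<bar> \<le> L * \<bar>x - y\<bar>"
    using angle_field_Lipschitz[of "\<bar>\<mu>\<bar>"] by blast
  let ?c = "of_int k * pi"
  have fk: "angle_field \<mu> t ?c = exp (w t)" for t
  proof -
    have "sin ?c = 0" by (simp add: sin_zero_iff_int2)
    then show ?thesis unfolding angle_field_def by (simp add: cos_squared_eq)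
  qed
  have sub: "{x0..b} \<subseteq> {a..b}" using x0 by auto
  have ge: "?c \<le> theta \<mu> t" if t: "t \<in> {x0..b}" for t
  proof (rule comparison_le[where y' = "\<lambda>_. 0", OF _ _ _ _ t])
    fix u assume u: "u \<in> {x0..b}"
    then have u': "u \<in> {a..b}" using sub by auto
    show "(theta \<mu> has_real_derivative angle_field \<mu> u (theta \<mu> u)) (at u within {x0..b})"
      using theta_deriv[OF u'] sub by (rule DERIV_subset)
    show "- L * \<bar>theta \<mu> u - ?c\<bar> \<le> angle_field \<mu> u (theta \<mu> u) - 0"
      using L(2)[OF order_refl u', of "theta \<mu> u" ?c] fk[of u] exp_gt_zero[of "w u"] by linarith
  qed (use k in auto)
  \<comment> \<open>By the Lipschitz bound the field is at least exp (w t) - L (theta - k pi). The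
    factor exp (L t) absorbs the second term, so the weighted difference is strictly
    increasing.\<close>
  have "exp (L * x0) * (theta \<mu> x0 - ?c) < exp (L * x) * (theta \<mu> x - ?c)"
  proof (rule DERIV_pos_imp_increasing_open[OF x0(2)])
    fix t assume t: "x0 < t" "t < x"
    then have t': "t \<in> {a..b}" "a < t" "t < b" using x0 by auto
    have d: "(theta \<mu> has_real_derivative angle_field \<mu> t (theta \<mu> t)) (at t)"
      using theta_deriv[OF t'(1), of \<mu>] t' by (simp add: at_within_Icc_interior)
    have "angle_field \<mu> t (theta \<mu> t) + L * (theta \<mu> t - ?c) > 0"
    proof -
      have "\<bar>theta \<mu> t - ?c\<bar> = theta \<mu> t - ?c" using ge[of t] t x0 by simp
      then show ?thesis
        using L(2)[OF order_refl t'(1), of "theta \<mu> t" ?c] fk[of t] exp_gt_zero[of "w t"] by linarith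
    qed
    then have "exp (L * t) * (angle_field \<mu> t (theta \<mu> t) + L * (theta \<mu> t - ?c)) > 0" by simp
    moreover have "((\<lambda>t. exp (L * t) * (theta \<mu> t - ?c)) has_real_derivative
        exp (L * t) * (angle_field \<mu> t (theta \<mu> t) + L * (theta \<mu> t - ?c))) (at t)"
      by (auto intro!: derivative_eq_intros d simp: algebra_simps)
    ultimately show "\<exists>y. ((\<lambda>t. exp (L * t) * (theta \<mu> t - ?c)) has_real_derivative y) (at t) \<and> y > 0"
      by blast
  next
    show "continuous_on {x0..x} (\<lambda>t. exp (L * t) * (theta \<mu> t - ?c))"
      by (intro continuous_intros continuous_on_subset[OF theta_cont]) (use x0 in auto)
  qed
  moreover have "exp (L * x0) * (theta \<mu> x0 - ?c) \<ge> 0" using k by simp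
  ultimately have "exp (L * x) * (theta \<mu> x - ?c) > 0" by linarith
  then show ?thesis by (simp add: zero_less_mult_iff)
qed

lemma theta_pos:
  assumes "x \<in> {a<..b}"
  shows "theta \<mu> x > 0"
  using theta_crosses_upward[of a x 0 \<mu>] assms by (simp add: theta_a)

text \<open>For \<mu> = 0 the constant pi/2 solves the angle equation, so \<open>theta 0\<close>
  cannot pass it. This provides the lower end for the intermediate value argument in \<mu>: every k
  pi with k \<ge> 1 lies above \<open>theta 0 b\<close>.\<close>

lemma theta_0_less_pi: "theta 0 b < pi"
proof -
  obtain L where L: "L > 0"
    "\<And>\<mu>'' t x y. \<bar>\<mu>''\<bar> \<le> 0 \<Longrightarrow> t \<in> {a..b} \<Longrightarrow> \<bar>angle_field \<mu>'' t x - angle_field \<mu>'' t y\<bar> \<le> L * \<bar>x - y\<bar>"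
    using angle_field_Lipschitz[of "0"] by blast
  have "theta 0 b \<le> pi / 2"
  proof (rule comparison_le[where z' = "\<lambda>_. 0", OF theta_deriv])
    fix t assume t: "t \<in> {a..b}"
    have "angle_field 0 t (pi / 2) = 0" by (simp add: angle_field_def)
    then show "- L * \<bar>pi / 2 - theta 0 t\<bar> \<le> 0 - angle_field 0 t (theta 0 t)"
      using L(2)[OF _ t, of 0 "pi / 2" "theta 0 t"] by (simp add: abs_if split: if_splits)
  qed (use ab theta_a in auto)
  then show ?thesis using pi_gt_zero by linarith
qed

text \<open>If the angles agreed at b, the difference d \<ge> 0 would vanish on all of {a..b},
  because exp (L t) d is nondecreasing. Its derivative would vanish as well, which forces sin (theta
  \<mu>) = 0 on (a, b); but a continuous angle confined to multiples of pi would be constant,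
  whereas it crosses them strictly upwards.\<close>

lemma theta_strict_mono:
  assumes "\<mu> < \<mu>'"
  shows "theta \<mu> b < theta \<mu>' b"
proof (rule ccontr)
  assume "\<not> theta \<mu> b < theta \<mu>' b"
  then have eqb: "theta \<mu>' b = theta \<mu> b"
    using theta_mono[of \<mu> \<mu>' b] assms ab by auto
  obtain L where L: "L > 0"
    "\<And>\<mu>'' t x y. \<bar>\<mu>''\<bar> \<le> \<bar>\<mu>'\<bar> \<Longrightarrow> t \<in> {a..b} \<Longrightarrow> \<bar>angle_field \<mu>'' t x - angle_field \<mu>'' t y\<bar> \<le> L * \<bar>x - y\<bar>"
    using angle_field_Lipschitz[of "\<bar>\<mu>'\<bar>"] by blast
  define d where "d t = theta \<mu>' t - theta \<mu> t" for t
  define d' where "d' t = angle_field \<mu>' t (theta \<mu>' t) - angle_field \<mu> t (theta \<mu> t)" for t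
  have d_nonneg: "d t \<ge> 0" if "t \<in> {a..b}" for t
    using theta_mono[of \<mu> \<mu>' t] assms that by (simp add: d_def)
  have dd: "(d has_real_derivative d' t) (at t within {a..b})" if "t \<in> {a..b}" for t
    unfolding d_def d'_def by (intro derivative_intros theta_deriv that)
  have diff: "angle_field \<mu>' t (theta \<mu> t) - angle_field \<mu> t (theta \<mu> t)
      = 2 * (\<mu>' - \<mu>) * exp (- w t) * (sin (theta \<mu> t))\<^sup>2" for t
    unfolding angle_field_def by (simp add: algebra_simps)
  have src: "d' t + L * d t \<ge> 2 * (\<mu>' - \<mu>) * exp (- w t) * (sin (theta \<mu> t))\<^sup>2" if t: "t \<in> {a..b}" for t
    using L(2)[OF order_refl t, of "theta \<mu>' t" "theta \<mu> t"] d_nonneg[OF t] diff[of t]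
    unfolding d'_def by (auto simp: d_def)
  have d0: "d x = 0" if x: "x \<in> {a..b}" for x
  proof -
    have "- (exp (L * b) * d b) \<le> - (exp (L * x) * d x)"
    proof (rule decreasing_on_Icc_finite_exceptions[of "{}" x b "\<lambda>t. - (exp (L * t) * d t)" "\<lambda>t. - (exp (L * t) * (d' t + L * d t))"])
      show "continuous_on {x..b} (\<lambda>t. - (exp (L * t) * d t))"
        unfolding d_def by (intro continuous_intros continuous_on_subset[OF theta_cont]) (use x in auto)
      fix t assume t: "t \<in> {x<..<b} - {}"
      then have t': "t \<in> {a..b}" "a < t" "t < b" using x by auto
      have "(d has_real_derivative d' t) (at t)"
        using dd[OF t'(1)] t' by (simp add: at_within_Icc_interior)
      then show "((\<lambda>t. - (exp (L * t) * d t)) has_real_derivative - (exp (L * t) * (d' t + L * d t))) (at t)"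
        by (auto intro!: derivative_eq_intros simp: algebra_simps)
      have "0 \<le> 2 * (\<mu>' - \<mu>) * exp (- w t) * (sin (theta \<mu> t))\<^sup>2"
        using assms by simp
      then show "- (exp (L * t) * (d' t + L * d t)) \<le> 0"
        using src[OF t'(1)] by simp
    qed (use x in auto)
    moreover have "d b = 0" using eqb by (simp add: d_def)
    ultimately show ?thesis using d_nonneg[OF x] by (auto simp: mult_le_0_iff)
  qed
  define c where "c = (a + b) / 2"
  have c: "a < c" "c < b" using ab by (auto simp: c_def)
  have sin0: "sin (theta \<mu> t) = 0" if t: "a < t" "t < b" for t
  proof -
    have "(d has_real_derivative d' t) (at t within {a..b})" by (rule dd) (use t in auto)
    moreover have "(d has_real_derivative 0) (at t within {a..b})"
      unfolding has_field_derivative_def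
      by (rule has_derivative_transform[of t "{a..b}" d "\<lambda>_. 0"]) (use t d0 DERIV_const[of 0 "at t within {a..b}"] in \<open>auto simp: has_field_derivative_def\<close>)
    ultimately have "d' t = 0"
      using t by (auto simp: at_within_Icc_interior intro: DERIV_unique)
    then have "2 * (\<mu>' - \<mu>) * exp (- w t) * (sin (theta \<mu> t))\<^sup>2 \<le> 0"
      using src[of t] d0[of t] t by auto
    then show ?thesis using assms by (auto simp: mult_le_0_iff)
  qed
  obtain k :: int where k: "theta \<mu> c = of_int k * pi"
    using sin0[OF c] by (auto simp: sin_zero_iff_int2)
  have "theta \<mu> ((c + b) / 2) > of_int k * pi"
    by (rule theta_crosses_upward[of c]) (use c k in auto)
  have k2: "\<exists>k2 :: int. theta \<mu> t = of_int k2 * pi" if "a < t" "t < b" for t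
    using sin0[OF that] by (auto simp: sin_zero_iff_int2)
  \<comment> \<open>The minimum lies strictly between k pi and (k + 1) pi, so the angle takes a
    value there at which the sine is nonzero.\<close>
  obtain t where t: "c \<le> t" "t \<le> (c + b) / 2" "theta \<mu> t = min (of_int k * pi + pi / 2) (theta \<mu> ((c + b) / 2))"
    using IVT'[of "theta \<mu>" c "min (of_int k * pi + pi / 2) (theta \<mu> ((c + b) / 2))" "(c + b) / 2"]
      k \<open>theta \<mu> ((c + b) / 2) > of_int k * pi\<close> c continuous_on_subset[OF theta_cont, of "{c..(c + b) / 2}"]
    by auto
  obtain k2 :: int where k2': "theta \<mu> t = of_int k2 * pi" using k2[of t] t c by auto
  have "of_int k * pi < theta \<mu> t" "theta \<mu> t < of_int (k + 1) * pi"
    using t(3) \<open>theta \<mu> ((c + b) / 2) > of_int k * pi\<close> by (auto simp: min_def algebra_simps split: if_splits)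
  then have "k < k2" "k2 < k + 1"
    unfolding k2' by (simp_all only: mult_less_cancel_right_pos[OF pi_gt_zero] of_int_less_iff)
  then show False by simp
qed

text \<open>An explicit supersolution: \<eta> = 2 B (\<mu>' - \<mu>) bounds the change of the field,
  and the term \<eta> / L (exp (L (t - a)) - 1) added to \<open>theta \<mu>\<close> solves the
  linear equation with source \<eta> and rate L. Together with monotonicity this gives a local
  Lipschitz bound in \<mu>.\<close>

lemma theta_b_cont: "continuous_on UNIV (\<lambda>\<mu>. theta \<mu> b)"
proof -
  have one: "\<exists>C. \<forall>\<mu> \<mu>'. \<bar>\<mu>\<bar> \<le> M \<longrightarrow> \<bar>\<mu>'\<bar> \<le> M \<longrightarrow> \<mu> \<le> \<mu>' \<longrightarrow> theta \<mu>' b - theta \<mu> b \<le> C * (\<mu>' - \<mu>)" for M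
  proof -
    obtain L where L: "L > 0"
      "\<And>\<mu>'' t x y. \<bar>\<mu>''\<bar> \<le> M \<Longrightarrow> t \<in> {a..b} \<Longrightarrow> \<bar>angle_field \<mu>'' t x - angle_field \<mu>'' t y\<bar> \<le> L * \<bar>x - y\<bar>"
      using angle_field_Lipschitz[of "M"] by blast
    obtain B where B: "B > 0" "\<And>t. t \<in> {a..b} \<Longrightarrow> exp (w t) \<le> B" "\<And>t. t \<in> {a..b} \<Longrightarrow> exp (- w t) \<le> B"
      using exp_w_bound by blast
    have "theta \<mu>' b - theta \<mu> b \<le> (2 * B / L * (exp (L * (b - a)) - 1)) * (\<mu>' - \<mu>)"
      if \<mu>: "\<bar>\<mu>\<bar> \<le> M" "\<bar>\<mu>'\<bar> \<le> M" "\<mu> \<le> \<mu>'" for \<mu> \<mu>'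
    proof -
      define \<eta> where "\<eta> = 2 * B * (\<mu>' - \<mu>)"
      have \<eta>: "\<eta> \<ge> 0" using \<mu> B by (simp add: \<eta>_def)
      define z where "z t = theta \<mu> t + \<eta> / L * (exp (L * (t - a)) - 1)" for t
      have "theta \<mu>' b \<le> z b"
      proof (rule comparison_le[where z' = "\<lambda>t. angle_field \<mu> t (theta \<mu> t) + \<eta> * exp (L * (t - a))", OF theta_deriv])
        fix t assume t: "t \<in> {a..b}"
        show "(z has_real_derivative angle_field \<mu> t (theta \<mu> t) + \<eta> * exp (L * (t - a))) (at t within {a..b})"
          unfolding z_def using L(1) by (auto intro!: derivative_eq_intros theta_deriv t)
        assume le: "z t \<le> theta \<mu>' t"
        have zt: "L * (z t - theta \<mu> t) = \<eta> * (exp (L * (t - a)) - 1)"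
          using L(1) by (simp add: z_def)
        have zge: "z t \<ge> theta \<mu> t" using \<eta> L(1) t by (auto simp: z_def)
        have f1: "angle_field \<mu>' t (theta \<mu> t) - angle_field \<mu> t (theta \<mu> t) \<le> \<eta>"
        proof -
          have "angle_field \<mu>' t (theta \<mu> t) - angle_field \<mu> t (theta \<mu> t)
             = 2 * (\<mu>' - \<mu>) * (exp (- w t) * (sin (theta \<mu> t))\<^sup>2)"
            unfolding angle_field_def by (simp add: algebra_simps)
          also have "\<dots> \<le> 2 * (\<mu>' - \<mu>) * (B * 1)"
            by (intro mult_mono B t) (use \<mu> B in \<open>auto simp: abs_square_le_1\<close>)
          finally show ?thesis by (simp add: \<eta>_def mult_ac)
        qed
        have f2: "\<bar>angle_field \<mu>' t (theta \<mu>' t) - angle_field \<mu>' t (theta \<mu> t)\<bar> \<le> L * \<bar>theta \<mu>' t - theta \<mu> t\<bar>"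
          by (rule L(2)[OF \<mu>(2) t])
        have f3: "L * \<bar>theta \<mu>' t - theta \<mu> t\<bar> = L * \<bar>z t - theta \<mu>' t\<bar> + L * (z t - theta \<mu> t)"
          using le zge by (simp add: algebra_simps)
        show "- L * \<bar>z t - theta \<mu>' t\<bar> \<le> angle_field \<mu> t (theta \<mu> t) + \<eta> * exp (L * (t - a)) - angle_field \<mu>' t (theta \<mu>' t)"
        proof -
          have "angle_field \<mu>' t (theta \<mu>' t) - angle_field \<mu> t (theta \<mu> t)
              \<le> \<eta> + (L * \<bar>z t - theta \<mu>' t\<bar> + \<eta> * (exp (L * (t - a)) - 1))"
            using f1 f2 unfolding f3 zt by linarith
          then show ?thesis by (simp add: algebra_simps)
        qed
      qed (use ab in \<open>auto simp: theta_a z_def\<close>)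
      moreover have "z b - theta \<mu> b = (2 * B / L * (exp (L * (b - a)) - 1)) * (\<mu>' - \<mu>)"
        by (simp add: z_def \<eta>_def field_simps)
      ultimately show ?thesis by linarith
    qed
    then show ?thesis by blast
  qed
  show ?thesis
    unfolding continuous_on_eq_continuous_within
  proof (intro ballI)
    fix \<mu>0 :: real
    obtain C0 where C0: "\<And>\<mu> \<mu>'. \<bar>\<mu>\<bar> \<le> \<bar>\<mu>0\<bar> + 1 \<Longrightarrow> \<bar>\<mu>'\<bar> \<le> \<bar>\<mu>0\<bar> + 1 \<Longrightarrow> \<mu> \<le> \<mu>' \<Longrightarrow> theta \<mu>' b - theta \<mu> b \<le> C0 * (\<mu>' - \<mu>)"
      using one[of "\<bar>\<mu>0\<bar> + 1"] by auto
    have bd: "\<bar>theta \<mu> b - theta \<mu>0 b\<bar> \<le> C0 * \<bar>\<mu> - \<mu>0\<bar>" if "\<bar>\<mu> - \<mu>0\<bar> < 1" for \<mu>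
      using C0[of \<mu> \<mu>0] C0[of \<mu>0 \<mu>] theta_mono[of \<mu> \<mu>0 b] theta_mono[of \<mu>0 \<mu> b] that ab
      by (cases "\<mu> \<le> \<mu>0") auto
    have "((\<lambda>\<mu>. C0 * \<bar>\<mu> - \<mu>0\<bar>) \<longlongrightarrow> C0 * \<bar>\<mu>0 - \<mu>0\<bar>) (at \<mu>0)"
      by (intro tendsto_intros)
    then have lim: "((\<lambda>\<mu>. C0 * \<bar>\<mu> - \<mu>0\<bar>) \<longlongrightarrow> 0) (at \<mu>0)" by simp
    have "((\<lambda>\<mu>. theta \<mu> b - theta \<mu>0 b) \<longlongrightarrow> 0) (at \<mu>0)"
    proof (rule Lim_null_comparison[OF _ lim])
      show "\<forall>\<^sub>F \<mu> in at \<mu>0. norm (theta \<mu> b - theta \<mu>0 b) \<le> C0 * \<bar>\<mu> - \<mu>0\<bar>"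
        unfolding eventually_at using bd by (intro exI[of _ 1]) (auto simp: dist_real_def)
    qed
    then have "((\<lambda>\<mu>. theta \<mu> b) \<longlongrightarrow> theta \<mu>0 b) (at \<mu>0)" by (rule LIM_zero_cancel)
    then show "continuous (at \<mu>0 within UNIV) (\<lambda>\<mu>. theta \<mu> b)" by (simp add: continuous_within)
  qed
qed

end

section \<open>Eigenvalues and zeros\<close>

text \<open>The condition k \<ge> 1 drops the value 0 taken at a, which belongs to neither count.
  For y = \<open>theta lam b\<close> the bound z \<le> y is attained precisely when lam is an
  eigenvalue.\<close>

definition pi_multiples :: "real \<Rightarrow> real set" where
  "pi_multiples y = {z. \<exists>k::nat. k \<ge> 1 \<and> z = real k * pi \<and> z \<le> y}"

lemma finite_pi_multiples: "finite (pi_multiples y)"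
proof (rule finite_subset)
  show "pi_multiples y \<subseteq> (\<lambda>k. real k * pi) ` {..nat \<lfloor>y / pi\<rfloor>}"
  proof
    fix z assume "z \<in> pi_multiples y"
    then obtain k :: nat where k: "z = real k * pi" "z \<le> y" by (auto simp: pi_multiples_def)
    then have "real k \<le> y / pi" by (simp add: field_simps)
    then have "int k \<le> \<lfloor>y / pi\<rfloor>" by (simp add: le_floor_iff)
    then show "z \<in> (\<lambda>k. real k * pi) ` {..nat \<lfloor>y / pi\<rfloor>}" using k by auto
  qed
qed simp

lemma sin_zero_pos:
  assumes "sin y = 0" "y > 0"
  shows "\<exists>k::nat. k \<ge> 1 \<and> y = real k * pi"
proof -
  obtain k :: int where k: "y = of_int k * pi" using assms by (auto simp: sin_zero_iff_int2)
  then have "k > 0" using assms by (simp add: zero_less_mult_iff)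
  then show ?thesis using k by (intro exI[of _ "nat k"]) auto
qed

context continuous_potential
begin

text \<open>Injective because beyond a multiple of pi the angle stays above it; surjective by the
  intermediate value theorem from the value 0 at a.\<close>

lemma zeros_bij:
  "bij_betw (theta \<mu>) {x \<in> {a<..b}. sin (theta \<mu> x) = 0} (pi_multiples (theta \<mu> b))"
  unfolding bij_betw_def
proof
  have up: "theta \<mu> x < theta \<mu> y" if "x \<in> {a<..b}" "y \<in> {a<..b}" "x < y" "sin (theta \<mu> x) = 0" for x y
    using theta_crosses_upward[of x y _ \<mu>] that by (auto simp: sin_zero_iff_int2)
  show "inj_on (theta \<mu>) {x \<in> {a<..b}. sin (theta \<mu> x) = 0}"
  proof (rule inj_onI)
    fix x y assume "x \<in> {x \<in> {a<..b}. sin (theta \<mu> x) = 0}" "y \<in> {x \<in> {a<..b}. sin (theta \<mu> x) = 0}"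
      "theta \<mu> x = theta \<mu> y"
    then show "x = y" using up[of x y] up[of y x] by (cases x y rule: linorder_cases) auto
  qed
  show "theta \<mu> ` {x \<in> {a<..b}. sin (theta \<mu> x) = 0} = pi_multiples (theta \<mu> b)"
  proof safe
    fix x assume x: "x \<in> {a<..b}" "sin (theta \<mu> x) = 0"
    obtain k :: nat where k: "k \<ge> 1" "theta \<mu> x = real k * pi"
      using sin_zero_pos[OF x(2) theta_pos[OF x(1)]] by auto
    have "theta \<mu> x \<le> theta \<mu> b" using up[of x b] x by (cases "x = b") auto
    then show "theta \<mu> x \<in> pi_multiples (theta \<mu> b)" using k by (auto simp: pi_multiples_def)
  next
    fix z assume "z \<in> pi_multiples (theta \<mu> b)"
    then obtain k :: nat where k: "k \<ge> 1" "z = real k * pi" "z \<le> theta \<mu> b" by (auto simp: pi_multiples_def)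
    have z: "z > 0" "sin z = 0" using k by auto
    obtain x where x: "a \<le> x" "x \<le> b" "theta \<mu> x = z"
      using IVT'[of "theta \<mu>" a z b] theta_a[of \<mu>] z k theta_cont[of \<mu>] ab by auto
    then have "x \<noteq> a" using theta_a[of \<mu>] z by auto
    then show "z \<in> theta \<mu> ` {x \<in> {a<..b}. sin (theta \<mu> x) = 0}" using x z by force
  qed
qed

text \<open>The hypothesis \<open>nz\<close> is what makes the map onto: a multiple of pi equal to
  \<open>theta lam b\<close> would be attained at \<mu> = lam, which is not below lam. As soon as
  some multiple of pi lies below \<open>theta lam b\<close>, monotonicity makes lam positive, and
  the intermediate value theorem in \<mu> runs from 0 to lam.\<close>

lemma eigenvalues_bij:
  assumes nz: "sin (theta lam b) \<noteq> 0"
  shows "bij_betw (\<lambda>\<mu>. theta \<mu> b) {\<mu>. sin (theta \<mu> b) = 0 \<and> \<mu> < lam} (pi_multiples (theta lam b))"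
  unfolding bij_betw_def
proof
  show "inj_on (\<lambda>\<mu>. theta \<mu> b) {\<mu>. sin (theta \<mu> b) = 0 \<and> \<mu> < lam}"
  proof (rule inj_onI)
    fix x y assume "theta x b = theta y b"
    then show "x = y" using theta_strict_mono[of x y] theta_strict_mono[of y x]
      by (cases x y rule: linorder_cases) auto
  qed
  have b: "b \<in> {a<..b}" using ab by auto
  show "(\<lambda>\<mu>. theta \<mu> b) ` {\<mu>. sin (theta \<mu> b) = 0 \<and> \<mu> < lam} = pi_multiples (theta lam b)"
  proof safe
    fix \<mu> assume \<mu>: "sin (theta \<mu> b) = 0" "\<mu> < lam"
    obtain k :: nat where k: "k \<ge> 1" "theta \<mu> b = real k * pi"
      using sin_zero_pos[OF \<mu>(1) theta_pos[OF b]] by auto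
    then show "theta \<mu> b \<in> pi_multiples (theta lam b)"
      using theta_strict_mono[OF \<mu>(2)] by (auto simp: pi_multiples_def)
  next
    fix z assume "z \<in> pi_multiples (theta lam b)"
    then obtain k :: nat where k: "k \<ge> 1" "z = real k * pi" "z \<le> theta lam b" by (auto simp: pi_multiples_def)
    have sz: "sin z = 0" using k by auto
    then have zlt: "z < theta lam b" using k(3) nz by (cases "z = theta lam b") auto
    have "1 * pi \<le> z" unfolding k(2) using k(1) by (intro mult_right_mono) auto
    then have z0: "theta 0 b < z" using theta_0_less_pi by linarith
    have lam: "0 < lam"
      using theta_mono[of lam 0 b] z0 zlt ab by (cases "0 < lam") auto
    obtain \<mu> where \<mu>: "0 \<le> \<mu>" "\<mu> \<le> lam" "theta \<mu> b = z"
      using IVT'[of "\<lambda>\<mu>. theta \<mu> b" 0 z lam] z0 zlt lam continuous_on_subset[OF theta_b_cont, of "{0..lam}"]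
      by auto
    then have "\<mu> < lam" using zlt by (cases "\<mu> = lam") auto
    then show "z \<in> (\<lambda>\<mu>. theta \<mu> b) ` {\<mu>. sin (theta \<mu> b) = 0 \<and> \<mu> < lam}" using \<mu> sz by force
  qed
qed

section \<open>Eigenfunctions in polar coordinates\<close>

lemma L_op_eq:
  assumes f: "\<And>y. y \<in> {a..b} \<Longrightarrow> (f has_real_derivative exp (w y) * g y) (at y within {a..b})"
    and g: "(g has_real_derivative g') (at x within {a..b})" and x: "x \<in> {a..b}"
  shows "L_op w a b f x = exp (w x) / 2 * g'"
proof -
  \<comment> \<open>Although w is only continuous, exp (- w) f' is the differentiable function g, so
    the outer derivative in \<open>L_op\<close> is the derivative of g.\<close>
  have "vector_derivative f (at y within {a..b}) = exp (w y) * g y" if "y \<in> {a..b}" for y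
    by (rule vector_derivative_within_closed_interval[OF ab])
      (use that f[OF that] in \<open>simp_all add: has_real_derivative_iff_has_vector_derivative\<close>)
  then have eq: "exp (- w y) * vector_derivative f (at y within {a..b}) = g y" if "y \<in> {a..b}" for y
    using that by (simp add: exp_minus)
  have "((\<lambda>y. exp (- w y) * vector_derivative f (at y within {a..b})) has_vector_derivative g')
      (at x within {a..b})"
    using has_vector_derivative_transform[OF x eq] g
    by (simp add: has_real_derivative_iff_has_vector_derivative)
  then show ?thesis
    unfolding L_op_def by (subst vector_derivative_within_closed_interval[OF ab x]) auto
qed

text \<open>The radius belonging to the angle satisfies r' = (exp w - 2 \<mu> exp (- w)) sin theta
  cos theta r and is integrated explicitly; then f = r sin theta and g = r cos theta solve f' = exp
  w g, g' = - 2 \<mu> exp (- w) f.\<close>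

lemma theta_zero_imp_eigenvalue:
  assumes sb: "sin (theta \<mu> b) = 0"
  shows "L_eigenvalue w a b \<mu>"
proof -
  define s c where "s x = sin (theta \<mu> x)" and "c x = cos (theta \<mu> x)" for x
  define e m where "e x = exp (w x)" and "m x = 2 * \<mu> * exp (- w x)" for x
  define \<kappa> where "\<kappa> x = (e x - m x) * (s x * c x)" for x
  define r where "r x = exp (integral {a..x} \<kappa>)" for x
  have \<kappa>c: "continuous_on {a..b} \<kappa>"
    unfolding \<kappa>_def e_def m_def s_def c_def by (intro continuous_intros cont_w theta_cont)
  have dr: "(r has_real_derivative r x * \<kappa> x) (at x within {a..b})" if "x \<in> {a..b}" for x
    unfolding r_def
    by (rule derivative_eq_intros integral_has_real_derivative[OF \<kappa>c that] refl)+
  have field: "angle_field \<mu> x (theta \<mu> x) = e x * (c x)\<^sup>2 + m x * (s x)\<^sup>2" for x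
    by (simp add: angle_field_def e_def m_def s_def c_def)
  have c2: "(c x)\<^sup>2 = 1 - (s x)\<^sup>2" for x by (simp add: s_def c_def cos_squared_eq)
  define f g where "f x = r x * s x" and "g x = r x * c x" for x
  have df: "(f has_real_derivative exp (w x) * g x) (at x within {a..b})" if x: "x \<in> {a..b}" for x
  proof -
    have "(f has_real_derivative r x * \<kappa> x * s x + (c x * angle_field \<mu> x (theta \<mu> x)) * r x) (at x within {a..b})"
      unfolding f_def s_def c_def
      by (rule derivative_eq_intros dr theta_deriv x refl)+
    moreover have "r x * \<kappa> x * s x + (c x * angle_field \<mu> x (theta \<mu> x)) * r x
        = r x * c x * (e x * ((s x)\<^sup>2 + (c x)\<^sup>2))"
      unfolding field \<kappa>_def by (simp add: power2_eq_square algebra_simps)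
    ultimately show ?thesis by (simp add: g_def c2 e_def mult_ac)
  qed
  define g' where "g' x = - m x * f x" for x
  have dg: "(g has_real_derivative g' x) (at x within {a..b})" if x: "x \<in> {a..b}" for x
  proof -
    have "(g has_real_derivative r x * \<kappa> x * c x + (- s x * angle_field \<mu> x (theta \<mu> x)) * r x) (at x within {a..b})"
      unfolding g_def s_def c_def
      by (rule derivative_eq_intros dr theta_deriv x refl)+
    moreover have "r x * \<kappa> x * c x + (- s x * angle_field \<mu> x (theta \<mu> x)) * r x
        = - (r x * s x) * (m x * ((s x)\<^sup>2 + (c x)\<^sup>2))"
      unfolding field \<kappa>_def by (simp add: power2_eq_square algebra_simps)
    ultimately show ?thesis by (simp add: g'_def f_def c2 mult_ac)
  qed
  have "continuous_on {a..b} g'"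
    unfolding g'_def m_def by (intro continuous_intros cont_w DERIV_continuous_on[OF df])
  then have "C1_within a b g" unfolding C1_within_def using dg by blast
  moreover have "f a = 0" "f b = 0" using sb theta_a by (auto simp: f_def s_def)
  ultimately have dom: "f \<in> L_domain w a b" unfolding L_domain_def using df by blast
  have "\<exists>x\<in>{a..b}. f x \<noteq> 0"
  proof (rule ccontr)
    assume "\<not> ?thesis"
    then have f0: "\<And>x. x \<in> {a..b} \<Longrightarrow> f x = 0" by blast
    \<comment> \<open>A vanishing f would have derivative 0 at a, but there g = r cos 0 with r =
      1.\<close>
    have "((\<lambda>_. 0) has_real_derivative exp (w a) * g a) (at a within {a..b})"
      using df[of a] ab f0 unfolding has_field_derivative_def
      by (intro has_derivative_transform[of a "{a..b}" "\<lambda>_. 0" f]) auto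
    moreover have "((\<lambda>_. 0) has_real_derivative 0) (at a within {a..b})" by simp
    ultimately have "exp (w a) * g a = 0"
      using vector_derivative_within_closed_interval[OF ab, of a "\<lambda>_. 0"] ab
      by (metis atLeastAtMost_iff has_real_derivative_iff_has_vector_derivative less_eq_real_def)
    then show False by (simp add: g_def r_def c_def theta_a)
  qed
  moreover have "L_op w a b f x + \<mu> * f x = 0" if x: "x \<in> {a..b}" for x
  proof -
    have "L_op w a b f x = exp (w x) / 2 * g' x" by (rule L_op_eq[OF _ dg[OF x] x]) (rule df)
    then show ?thesis by (simp add: g'_def m_def exp_minus)
  qed
  ultimately show ?thesis unfolding L_eigenvalue_def using dom by blast
qed

text \<open>The pair (\<phi>, g) of an eigenfunction and the direction (sin theta, cos theta) are
  parallel at a and remain so. If sin theta were nonzero at b, then \<phi> b = 0 would give g b = 0,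
  and zero data at b force \<phi> = 0 everywhere.\<close>

lemma eigenvalue_imp_theta_zero:
  assumes "L_eigenvalue w a b \<mu>"
  shows "sin (theta \<mu> b) = 0"
proof (rule ccontr)
  assume nz: "sin (theta \<mu> b) \<noteq> 0"
  obtain \<phi> where "\<phi> \<in> L_domain w a b" and nonzero: "\<exists>x\<in>{a..b}. \<phi> x \<noteq> 0"
    and ev: "\<And>x. x \<in> {a..b} \<Longrightarrow> L_op w a b \<phi> x + \<mu> * \<phi> x = 0"
    using assms unfolding L_eigenvalue_def by blast
  then obtain g where bc: "\<phi> a = 0" "\<phi> b = 0" and g: "C1_within a b g"
    and d\<phi>: "\<And>x. x \<in> {a..b} \<Longrightarrow> (\<phi> has_real_derivative exp (w x) * g x) (at x within {a..b})"
    unfolding L_domain_def by blast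
  obtain g' where dg0: "\<And>x. x \<in> {a..b} \<Longrightarrow> (g has_real_derivative g' x) (at x within {a..b})"
    using g unfolding C1_within_def by blast
  define s c where "s x = sin (theta \<mu> x)" and "c x = cos (theta \<mu> x)" for x
  define e m where "e x = exp (w x)" and "m x = 2 * \<mu> * exp (- w x)" for x
  have dg: "(g has_real_derivative - m x * \<phi> x) (at x within {a..b})" if x: "x \<in> {a..b}" for x
  proof -
    have "exp (w x) / 2 * g' x = - \<mu> * \<phi> x"
    proof -
      have "L_op w a b \<phi> x = exp (w x) / 2 * g' x" by (rule L_op_eq[OF _ dg0[OF x] x]) (rule d\<phi>)
      then show ?thesis using ev[OF x] by linarith
    qed
    then have "exp (w x) * g' x = - 2 * \<mu> * \<phi> x" by simp
    then have "exp (- w x) * (exp (w x) * g' x) = exp (- w x) * (- 2 * \<mu> * \<phi> x)" by simp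
    then have "g' x = - m x * \<phi> x"
      unfolding mult.assoc[symmetric] exp_add[symmetric] by (simp add: m_def mult_ac)
    then show ?thesis using dg0[OF x] by simp
  qed
  have field: "angle_field \<mu> x (theta \<mu> x) = e x * (c x)\<^sup>2 + m x * (s x)\<^sup>2" for x
    by (simp add: angle_field_def e_def m_def s_def c_def)
  have c2: "(c x)\<^sup>2 = 1 - (s x)\<^sup>2" for x by (simp add: s_def c_def cos_squared_eq)
  obtain B where B: "B > 0" "\<And>t. t \<in> {a..b} \<Longrightarrow> exp (w t) \<le> B" "\<And>t. t \<in> {a..b} \<Longrightarrow> exp (- w t) \<le> B"
    using exp_w_bound by blast
  have em: "\<bar>e x\<bar> + \<bar>m x\<bar> \<le> B + 2 * \<bar>\<mu>\<bar> * B" if "x \<in> {a..b}" for x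
  proof -
    have "\<bar>m x\<bar> \<le> 2 * \<bar>\<mu>\<bar> * B" unfolding m_def abs_mult by (intro mult_mono) (use B that in auto)
    then show ?thesis using B(2)[OF that] by (simp add: e_def)
  qed
  \<comment> \<open>The determinant of the two vectors. It obeys a homogeneous linear equation even
    though the direction is normalized, so it vanishes along with its value at a.\<close>
  define \<zeta> where "\<zeta> x = \<phi> x * c x - g x * s x" for x
  define k where "k x = (e x - m x) * (s x * c x)" for x
  have d\<zeta>: "(\<zeta> has_real_derivative - k x * \<zeta> x) (at x within {a..b})" if x: "x \<in> {a..b}" for x
  proof -
    have "(\<zeta> has_real_derivative
        (e x * g x * c x + (- s x * angle_field \<mu> x (theta \<mu> x)) * \<phi> x) -
        ((- m x * \<phi> x) * s x + (c x * angle_field \<mu> x (theta \<mu> x)) * g x)) (at x within {a..b})"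
      unfolding \<zeta>_def s_def c_def
      by (rule derivative_eq_intros d\<phi> dg theta_deriv x refl)+ (simp add: e_def)
    moreover have "(e x * g x * c x + (- s x * angle_field \<mu> x (theta \<mu> x)) * \<phi> x) -
        ((- m x * \<phi> x) * s x + (c x * angle_field \<mu> x (theta \<mu> x)) * g x) = - k x * \<zeta> x"
    proof -
      have "angle_field \<mu> x (theta \<mu> x) - e x = - (e x - m x) * (s x)\<^sup>2"
        "angle_field \<mu> x (theta \<mu> x) - m x = (e x - m x) * (c x)\<^sup>2"
        unfolding field c2 by (simp_all add: algebra_simps)
      then have f1: "angle_field \<mu> x (theta \<mu> x) = e x - (e x - m x) * (s x)\<^sup>2"
        and f2: "angle_field \<mu> x (theta \<mu> x) = m x + (e x - m x) * (c x)\<^sup>2" by (simp_all add: algebra_simps)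
      have "g x * c x * (e x - angle_field \<mu> x (theta \<mu> x)) - \<phi> x * s x * (angle_field \<mu> x (theta \<mu> x) - m x)
         = g x * c x * ((e x - m x) * (s x)\<^sup>2) - \<phi> x * s x * ((e x - m x) * (c x)\<^sup>2)"
        using f1 f2 by simp
      then show ?thesis unfolding k_def \<zeta>_def by (simp add: algebra_simps power2_eq_square)
    qed
    ultimately show ?thesis by simp
  qed
  have sc: "\<bar>s x * c x\<bar> \<le> 1" for x
    unfolding s_def c_def abs_mult using mult_mono[of "\<bar>sin (theta \<mu> x)\<bar>" 1 "\<bar>cos (theta \<mu> x)\<bar>" 1] by simp
  have kb: "\<bar>k x\<bar> \<le> B + 2 * \<bar>\<mu>\<bar> * B" if "x \<in> {a..b}" for x
  proof -
    have "\<bar>k x\<bar> \<le> \<bar>e x - m x\<bar> * 1" unfolding k_def abs_mult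
      by (intro mult_left_mono) (use sc[of x] in \<open>auto simp: abs_mult\<close>)
    also have "\<dots> \<le> \<bar>e x\<bar> + \<bar>m x\<bar>" using abs_triangle_ineq4[of "e x" "m x"] by simp
    finally show ?thesis using em[OF that] by linarith
  qed
  have \<zeta>0: "\<zeta> x = 0" if "x \<in> {a..b}" for x
  proof (rule gronwall_zero[OF d\<zeta>, where C = "B + 2 * \<bar>\<mu>\<bar> * B" and ?x0.0 = a])
    show "\<bar>- k x * \<zeta> x\<bar> \<le> (B + 2 * \<bar>\<mu>\<bar> * B) * \<bar>\<zeta> x\<bar>" if "x \<in> {a..b}" for x
      unfolding abs_mult using kb[OF that] by (auto intro!: mult_right_mono)
    show "\<zeta> a = 0" by (simp add: \<zeta>_def s_def theta_a bc)
  qed (use ab that in auto)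
  have "\<zeta> b = 0" using \<zeta>0 ab by auto
  then have gb: "g b = 0" using nz bc by (simp add: \<zeta>_def s_def)
  \<comment> \<open>Uniqueness from zero data at b, as a Gronwall bound for the squared norm of
    (\<phi>, g).\<close>
  define \<rho> where "\<rho> x = (\<phi> x)\<^sup>2 + (g x)\<^sup>2" for x
  have "\<rho> x = 0" if "x \<in> {a..b}" for x
  proof (rule gronwall_zero[where C = "B + 2 * \<bar>\<mu>\<bar> * B" and ?x0.0 = b and y = \<rho> and x = x
        and y' = "\<lambda>x. 2 * \<phi> x * (exp (w x) * g x) + 2 * g x * (- m x * \<phi> x)"])
    fix x assume x: "x \<in> {a..b}"
    show "(\<rho> has_real_derivative 2 * \<phi> x * (exp (w x) * g x) + 2 * g x * (- m x * \<phi> x)) (at x within {a..b})"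
      unfolding \<rho>_def by (rule derivative_eq_intros d\<phi> dg x refl)+ (simp add: e_def)
    have "2 * \<phi> x * (exp (w x) * g x) + 2 * g x * (- m x * \<phi> x) = (e x - m x) * (2 * \<phi> x * g x)"
      by (simp add: e_def algebra_simps)
    then have "\<bar>2 * \<phi> x * (exp (w x) * g x) + 2 * g x * (- m x * \<phi> x)\<bar> = \<bar>e x - m x\<bar> * \<bar>2 * \<phi> x * g x\<bar>"
      by (simp add: abs_mult)
    also have "\<dots> \<le> (B + 2 * \<bar>\<mu>\<bar> * B) * \<rho> x"
    proof (rule mult_mono)
      show "\<bar>e x - m x\<bar> \<le> B + 2 * \<bar>\<mu>\<bar> * B" using em[OF x] by linarith
      have "0 \<le> (\<phi> x + g x)\<^sup>2" "0 \<le> (\<phi> x - g x)\<^sup>2" by simp_all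
      then show "\<bar>2 * \<phi> x * g x\<bar> \<le> \<rho> x" unfolding \<rho>_def power2_sum power2_diff by linarith
    qed (use B in auto)
    finally show "\<bar>2 * \<phi> x * (exp (w x) * g x) + 2 * g x * (- m x * \<phi> x)\<bar> \<le> (B + 2 * \<bar>\<mu>\<bar> * B) * \<bar>\<rho> x\<bar>"
      by (simp add: \<rho>_def)
  qed (use ab that bc gb in \<open>auto simp: \<rho>_def\<close>)
  then have "\<phi> x = 0" if "x \<in> {a..b}" for x
    using that by (simp add: \<rho>_def sum_power2_eq_zero_iff)
  then show False using nonzero by blast
qed

lemma eigenvalue_iff: "L_eigenvalue w a b \<mu> \<longleftrightarrow> sin (theta \<mu> b) = 0"
  using theta_zero_imp_eigenvalue eigenvalue_imp_theta_zero by blast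

end

section \<open>Paths of the Riccati transform\<close>

text \<open>
  The left-hand side is the derivative of \<open>(c - q s)\<^sup>2 / (1 + q\<^sup>2) = sin\<^sup>2 (\<alpha> - \<theta>)\<close> for \<open>q = cot \<alpha>\<close>,
  \<open>s = sin \<theta>\<close>, \<open>c = cos \<theta>\<close> along the Riccati equation and the equation of the Pruefer angle.
\<close>

lemma riccati_quotient_identity:
  fixes s c q e m :: real
  assumes "c\<^sup>2 + s\<^sup>2 = 1"
  defines "f \<equiv> e * c\<^sup>2 + m * s\<^sup>2" and "q' \<equiv> - m - e * q\<^sup>2"
  shows "(2 * (c - q * s) * (- s * f - (q' * s + c * f * q)) * (1 + q\<^sup>2) - (c - q * s)\<^sup>2 * (2 * q * q'))
            / ((1 + q\<^sup>2) * (1 + q\<^sup>2))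
       = 2 * (m - e) * (s * c + q / (1 + q\<^sup>2)) * ((c - q * s)\<^sup>2 / (1 + q\<^sup>2))"
proof -
  have c2: "c\<^sup>2 = 1 - s\<^sup>2" using assms(1) by simp
  have f: "f = e + (m - e) * s\<^sup>2" unfolding f_def c2 by (simp add: algebra_simps)
  have D: "- s * f - (q' * s + c * f * q) = (c - q * s) * (m * s * c - e * (s * c + q))"
  proof -
    have "(c - q * s) * (m * s * c - e * (s * c + q))
      = (m - e) * s * c\<^sup>2 - e * q * c - (m - e) * q * c * s\<^sup>2 + e * q\<^sup>2 * s"
      by (simp add: algebra_simps power2_eq_square)
    also have "\<dots> = - s * f - (q' * s + c * f * q)"
      unfolding f q'_def c2 by (simp add: algebra_simps power2_eq_square)
    finally show ?thesis ..
  qed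
  have p: "1 + q\<^sup>2 \<noteq> 0" using zero_le_power2[of q] by linarith
  have "2 * (c - q * s) * ((c - q * s) * (m * s * c - e * (s * c + q))) * (1 + q\<^sup>2) - (c - q * s)\<^sup>2 * (2 * q * q')
     = 2 * (c - q * s)\<^sup>2 * ((m - e) * (s * c * (1 + q\<^sup>2) + q))"
    unfolding q'_def by (simp add: algebra_simps power2_eq_square)
  moreover have "2 * (m - e) * (s * c + q / (1 + q\<^sup>2)) * ((c - q * s)\<^sup>2 / (1 + q\<^sup>2))
     = 2 * (c - q * s)\<^sup>2 * ((m - e) * (s * c * (1 + q\<^sup>2) + q)) / ((1 + q\<^sup>2) * (1 + q\<^sup>2))"
    using p by (simp add: field_simps)
  ultimately show ?thesis unfolding D by simp
qed

text \<open>With q = cot \<alpha>, infinite q means that \<alpha> is a multiple of pi, and both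
  signs of infinity give the same limit. This lets the quotient pass continuously through a restart
  from -infinity to +infinity.\<close>

lemma tendsto_angle_quotient:
  fixes th q :: "'x::t2_space \<Rightarrow> real"
  assumes th: "(th \<longlongrightarrow> t0) F" and q: "filterlim q at_infinity F"
  shows "((\<lambda>x. (cos (th x) - q x * sin (th x))\<^sup>2 / (1 + (q x)\<^sup>2)) \<longlongrightarrow> (sin t0)\<^sup>2) F"
proof -
  have i0: "((\<lambda>x. inverse (q x)) \<longlongrightarrow> 0) F"
    using filterlim_compose[OF tendsto_inverse_0 q] .
  have "((\<lambda>x. (cos (th x) * inverse (q x) - sin (th x))\<^sup>2 / ((inverse (q x))\<^sup>2 + 1)) \<longlongrightarrow>
      (cos t0 * 0 - sin t0)\<^sup>2 / (0\<^sup>2 + 1)) F"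
    by (intro tendsto_intros th i0) simp_all
  moreover have "\<forall>\<^sub>F x in F. (cos (th x) * inverse (q x) - sin (th x))\<^sup>2 / ((inverse (q x))\<^sup>2 + 1)
      = (cos (th x) - q x * sin (th x))\<^sup>2 / (1 + (q x)\<^sup>2)"
  proof -
    have "\<forall>\<^sub>F x in F. q x \<noteq> 0" using filterlim_at_infinity_imp_eventually_ne[OF q, of 0] .
    then show ?thesis
    proof eventually_elim
      case (elim x)
      have "cos (th x) * inverse (q x) - sin (th x) = (cos (th x) - q x * sin (th x)) / q x"
        using elim by (simp add: field_simps)
      moreover have "(inverse (q x))\<^sup>2 + 1 = (1 + (q x)\<^sup>2) / (q x)\<^sup>2"
        using elim by (simp add: field_simps power2_eq_square)
      ultimately show ?case using elim by (simp add: power_divide)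
    qed
  qed
  ultimately show ?thesis by (auto intro: Lim_transform_eventually)
qed

text \<open>The hypothesis \<open>fin\<close> is essential, since \<open>real_of_ereal\<close> sends
  infinite values to 0.\<close>

lemma filterlim_real_of_ereal_at_infinity:
  fixes p :: "'x \<Rightarrow> ereal"
  assumes p: "(p \<longlongrightarrow> l) F" and l: "\<bar>l\<bar> = \<infinity>"
    and fin: "\<forall>\<^sub>F x in F. \<bar>p x\<bar> \<noteq> \<infinity>"
  shows "filterlim (\<lambda>x. real_of_ereal (p x)) at_infinity F"
proof -
  consider "l = \<infinity>" | "l = -\<infinity>" using l by (cases l) auto
  then show ?thesis
  proof cases
    case 1
    have ev: "\<forall>\<^sub>F x in F. ereal r < p x" for r using p unfolding 1 tendsto_PInfty by blast
    have "\<forall>\<^sub>F x in F. r < real_of_ereal (p x)" for r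
      using ev[of r] fin
    proof eventually_elim
      case (elim x)
      then show ?case by (cases "p x") auto
    qed
    then have "filterlim (\<lambda>x. real_of_ereal (p x)) at_top F"
      by (simp add: filterlim_at_top_dense)
    then show ?thesis by (rule filterlim_at_top_imp_at_infinity)
  next
    case 2
    have ev: "\<forall>\<^sub>F x in F. p x < ereal r" for r using p unfolding 2 tendsto_MInfty by blast
    have "\<forall>\<^sub>F x in F. real_of_ereal (p x) < r" for r
      using ev[of r] fin
    proof eventually_elim
      case (elim x)
      then show ?case by (cases "p x") auto
    qed
    then have "filterlim (\<lambda>x. real_of_ereal (p x)) at_bot F"
      by (simp add: filterlim_at_bot_dense)
    then show ?thesis using at_bot_le_at_infinity filterlim_mono by blast
  qed
qed

section \<open>Restarting paths: one-sided limits and isolated explosions\<close>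

lemma restarting_path_limits:
  assumes "restarting_path a b p" "a < b"
  shows restarting_path_right: "t \<in> {a..<b} \<Longrightarrow>
      (p \<longlongrightarrow> (if t = a \<or> p t = -\<infinity> then \<infinity> else p t)) (at_right t)"
    and restarting_path_left: "t \<in> {a<..b} \<Longrightarrow> (p \<longlongrightarrow> p t) (at_left t)"
    and restarting_path_not_top: "t \<in> {a<..b} \<Longrightarrow> p t \<noteq> \<infinity>"
proof -
  show "(p \<longlongrightarrow> (if t = a \<or> p t = -\<infinity> then \<infinity> else p t)) (at_right t)" if "t \<in> {a..<b}"
    using assms that unfolding restarting_path_def by (cases "t = a") auto
qed (use assms in \<open>auto simp: restarting_path_def\<close>)

lemma eventually_at_within_IccI:
  fixes a b t :: real
  assumes "a < b" "t \<in> {a..b}"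
    and l: "t > a \<Longrightarrow> eventually P (at_left t)" and r: "t < b \<Longrightarrow> eventually P (at_right t)"
  shows "eventually P (at t within {a..b})"
proof -
  consider "t = a" | "t = b" | "a < t" "t < b" using assms(2) by fastforce
  then show ?thesis
  proof cases
    case 1 then show ?thesis using r assms(1) by (simp add: at_within_Icc_at_right)
  next
    case 2 then show ?thesis using l assms(1) by (simp add: at_within_Icc_at_left)
  next
    case 3 then show ?thesis using l r by (simp add: at_within_Icc_interior eventually_at_split)
  qed
qed

text \<open>To the right of any point the path has a limit other than -infinity. To the left of an
  explosion t the path is eventually negative, whereas an explosion s < t close by would be followed
  by positive values just after s.\<close>

lemma explosions_isolated:
  assumes rp: "restarting_path a b p" and ab: "a < b" and t: "t \<in> {a..b}"
  shows "\<forall>\<^sub>F s in at t within {a..b}. p s \<noteq> -\<infinity>"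
proof (rule eventually_at_within_IccI[OF ab t])
  assume "t < b"
  then have lim: "(p \<longlongrightarrow> (if t = a \<or> p t = -\<infinity> then \<infinity> else p t)) (at_right t)"
    using restarting_path_right[OF rp ab] t by auto
  have "\<forall>\<^sub>F s in at_right t. -\<infinity> < p s"
    by (rule order_tendstoD(1)[OF lim]) auto
  then show "\<forall>\<^sub>F s in at_right t. p s \<noteq> -\<infinity>" by eventually_elim auto
next
  assume ta: "t > a"
  then have lim: "(p \<longlongrightarrow> p t) (at_left t)"
    using restarting_path_left[OF rp ab] t by auto
  show "\<forall>\<^sub>F s in at_left t. p s \<noteq> -\<infinity>"
  proof (cases "p t = -\<infinity>")
    case False
    then have "\<forall>\<^sub>F s in at_left t. -\<infinity> < p s"
      by (intro order_tendstoD(1)[OF lim]) auto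
    then show ?thesis by eventually_elim auto
  next
    case True
    have "\<forall>\<^sub>F s in at_left t. p s < 0"
      by (rule order_tendstoD(2)[OF lim]) (simp add: True)
    then obtain d where d: "d < t" "\<And>s. d < s \<Longrightarrow> s < t \<Longrightarrow> p s < 0"
      by (auto simp: eventually_at_left_field)
    have "p s \<noteq> -\<infinity>" if s: "max a d < s" "s < t" for s
    proof
      assume "p s = -\<infinity>"
      then have "(p \<longlongrightarrow> \<infinity>) (at_right s)"
        using restarting_path_right[OF rp ab, of s] s t by auto
      then have "\<forall>\<^sub>F u in at_right s. 0 < p u" by (rule order_tendstoD(1)) simp
      moreover have "\<forall>\<^sub>F u in at_right s. u < t" using s by (intro eventually_at_right_real[THEN eventually_mono]) auto
      moreover have "\<forall>\<^sub>F u in at_right s. s < u" by (simp add: eventually_at_right_less)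
      ultimately have "\<forall>\<^sub>F u in at_right s. False"
        by eventually_elim (use d(2) s in \<open>meson less_trans max.strict_boundedE not_less_iff_gr_or_eq\<close>)
      then show False by simp
    qed
    then show ?thesis using d ta unfolding eventually_at_left_field by (intro exI[of _ "max a d"]) auto
  qed
qed

lemma finite_explosion_times:
  assumes rp: "restarting_path a b p" and ab: "a < b"
  shows "finite (explosion_times a b p)"
proof (rule ccontr)
  assume inf: "infinite (explosion_times a b p)"
  have sub: "explosion_times a b p \<subseteq> {a..b}" by (auto simp: explosion_times_def)
  obtain t where t: "t \<in> {a..b}" "t islimpt explosion_times a b p"
    using Heine_Borel_imp_Bolzano_Weierstrass[OF compact_Icc inf sub] by blast
  have "\<forall>\<^sub>F s in at t within {a..b}. p s \<noteq> -\<infinity>"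
    by (rule explosions_isolated[OF rp ab t(1)])
  then obtain T where T: "open T" "t \<in> T" "\<And>s. s \<in> T \<Longrightarrow> s \<noteq> t \<Longrightarrow> s \<in> {a..b} \<Longrightarrow> p s \<noteq> -\<infinity>"
    unfolding eventually_at_topological by blast
  obtain s where "s \<in> explosion_times a b p" "s \<in> T" "s \<noteq> t"
    using t(2) T unfolding islimpt_def by blast
  then show False using T(3)[of s] by (auto simp: explosion_times_def)
qed

section \<open>Explosions as zeros of the Pruefer angle\<close>

context continuous_potential
begin

text \<open>\<open>G\<close> is the squared sine of the difference between the angle of q and theta,
  and \<open>Z\<close> is its continuous extension, equal to sin^2 theta where the path is infinite.
  As Z vanishes at a and Z' \<le> C Z off the finitely many explosions, Z = 0 throughout. At an
  explosion this says sin theta = 0; elsewhere sin theta = 0 would turn the numerator of G into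
  cos^2 theta = 1.\<close>

lemma explosion_iff_theta:
  assumes rp: "restarting_path a b p"
    and riccati: "\<And>t. t \<in> {a<..<b} \<Longrightarrow> p t \<noteq> -\<infinity> \<Longrightarrow>
      ((\<lambda>t. exp (- w t) * real_of_ereal (p t)) has_real_derivative
        - (2 * lam * exp (- w t)) - exp (w t) * (exp (- w t) * real_of_ereal (p t))\<^sup>2) (at t)"
    and t: "t \<in> {a<..b}"
  shows "p t = -\<infinity> \<longleftrightarrow> sin (theta lam t) = 0"
proof -
  define q where "q t = exp (- w t) * real_of_ereal (p t)" for t
  define G where "G t = (cos (theta lam t) - q t * sin (theta lam t))\<^sup>2 / (1 + (q t)\<^sup>2)" for t
  define Z where "Z t = (if t = a \<or> p t = -\<infinity> then (sin (theta lam t))\<^sup>2 else G t)" for t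
  let ?S = "explosion_times a b p"
  note notop = restarting_path_not_top[OF rp ab]
  \<comment> \<open>Stated for a general filter, so that left limits, restarts and the entrance from
    infinity at a are treated at once. Explosions are isolated, hence Z = G eventually along
    F.\<close>
  have lims: "(Z \<longlongrightarrow> (if \<bar>l\<bar> = \<infinity> then (sin (theta lam u))\<^sup>2 else
      (cos (theta lam u) - (exp (- w u) * real_of_ereal l) * sin (theta lam u))\<^sup>2 / (1 + (exp (- w u) * real_of_ereal l)\<^sup>2))) F"
    if F: "F \<le> at u within {a..b}" and u: "u \<in> {a..b}" and pl: "(p \<longlongrightarrow> l) F"
      and ev: "\<forall>\<^sub>F s in F. s \<in> {a<..b}" for F u l
  proof -
    have th: "(theta lam \<longlongrightarrow> theta lam u) F"
      using theta_cont[of lam] u by (intro tendsto_mono[OF F]) (auto simp: continuous_on)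
    have ww: "(w \<longlongrightarrow> w u) F"
      using cont_w u by (intro tendsto_mono[OF F]) (auto simp: continuous_on)
    have evf: "\<forall>\<^sub>F s in F. p s \<noteq> -\<infinity>"
      using explosions_isolated[OF rp ab u] F by (auto simp: le_filter_def)
    have evn: "\<forall>\<^sub>F s in F. \<bar>p s\<bar> \<noteq> \<infinity>"
      using ev evf
    proof eventually_elim
      case (elim s)
      then show ?case using notop[of s] by (cases "p s") auto
    qed
    have ZG: "\<forall>\<^sub>F s in F. G s = Z s"
      using ev evf by eventually_elim (auto simp: Z_def)
    show ?thesis
    proof (cases "\<bar>l\<bar> = \<infinity>")
      case True
      have inf: "filterlim (\<lambda>s. real_of_ereal (p s)) at_infinity F"
        by (rule filterlim_real_of_ereal_at_infinity[OF pl True evn])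
      have "filterlim q at_infinity F"
        unfolding q_def by (rule tendsto_mult_filterlim_at_infinity[OF _ _ inf]) (auto intro!: tendsto_intros ww)
      from tendsto_angle_quotient[OF th this]
      have "(G \<longlongrightarrow> (sin (theta lam u))\<^sup>2) F" unfolding G_def .
      then show ?thesis using True ZG by (auto intro: Lim_transform_eventually)
    next
      case False
      have pr: "((\<lambda>s. real_of_ereal (p s)) \<longlongrightarrow> real_of_ereal l) F"
        by (rule lim_real_of_ereal) (use pl False in \<open>auto simp: ereal_real'\<close>)
      have "(G \<longlongrightarrow> (cos (theta lam u) - (exp (- w u) * real_of_ereal l) * sin (theta lam u))\<^sup>2 / (1 + (exp (- w u) * real_of_ereal l)\<^sup>2)) F"
        unfolding G_def q_def
        by (intro tendsto_intros th ww pr) (metis add_pos_nonneg less_numeral_extra(1) less_numeral_extra(3) zero_le_power2)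
      then show ?thesis using False ZG by (auto intro: Lim_transform_eventually)
    qed
  qed
  have Zc: "continuous_on {a..b} Z"
    unfolding continuous_on_eq_continuous_within continuous_within
  proof
    fix u assume u: "u \<in> {a..b}"
    have left: "(Z \<longlongrightarrow> Z u) (at_left u)" if "a < u"
    proof -
      have F: "at_left u \<le> at u within {a..b}"
        using at_within_Icc_at_left[OF that] at_le[of "{a..u}" "{a..b}" u] u by auto
      have pl: "(p \<longlongrightarrow> p u) (at_left u)" using restarting_path_left[OF rp ab] u that by auto
      have ev: "\<forall>\<^sub>F s in at_left u. s \<in> {a<..b}"
        using eventually_at_left_real[OF that] by eventually_elim (use u in auto)
      have "(Z \<longlongrightarrow> (if \<bar>p u\<bar> = \<infinity> then (sin (theta lam u))\<^sup>2 else G u)) (at_left u)"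
        using lims[OF F u pl ev] unfolding G_def q_def .
      moreover have "(if \<bar>p u\<bar> = \<infinity> then (sin (theta lam u))\<^sup>2 else G u) = Z u"
        using notop[of u] u that by (cases "p u") (auto simp: Z_def)
      ultimately show ?thesis by simp
    qed
    have right: "(Z \<longlongrightarrow> Z u) (at_right u)" if "u < b"
    proof -
      have F: "at_right u \<le> at u within {a..b}"
        using at_within_Icc_at_right[OF that] at_le[of "{u..b}" "{a..b}" u] u by auto
      have pl: "(p \<longlongrightarrow> (if u = a \<or> p u = -\<infinity> then \<infinity> else p u)) (at_right u)"
        using restarting_path_right[OF rp ab] u that by auto
      have ev: "\<forall>\<^sub>F s in at_right u. s \<in> {a<..b}"
        using eventually_at_right_real[OF that] by eventually_elim (use u in auto)
      have "(Z \<longlongrightarrow> (if u = a \<or> \<bar>p u\<bar> = \<infinity> then (sin (theta lam u))\<^sup>2 else G u)) (at_right u)"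
        using lims[OF F u pl ev] notop[of u] u
        by (cases "p u"; cases "u = a") (auto simp: G_def q_def)
      moreover have "(if u = a \<or> \<bar>p u\<bar> = \<infinity> then (sin (theta lam u))\<^sup>2 else G u) = Z u"
        using notop[of u] u by (cases "p u"; cases "u = a") (auto simp: Z_def)
      ultimately show ?thesis by simp
    qed
    show "(Z \<longlongrightarrow> Z u) (at u within {a..b})"
      using left right unfolding tendsto_def by (auto intro!: eventually_at_within_IccI[OF ab u])
  qed
  obtain B where B: "B > 0" "\<And>t. t \<in> {a..b} \<Longrightarrow> exp (w t) \<le> B" "\<And>t. t \<in> {a..b} \<Longrightarrow> exp (- w t) \<le> B"
    using exp_w_bound by blast
  define Z' where "Z' u = 2 * (2 * lam * exp (- w u) - exp (w u)) *
      (sin (theta lam u) * cos (theta lam u) + q u / (1 + (q u)\<^sup>2)) * Z u" for u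
  have dZ: "(Z has_real_derivative Z' u) (at u)" if u: "u \<in> {a<..<b} - ?S" for u
  proof -
    have ui: "u \<in> {a..b}" "a < u" "u < b" and pu: "p u \<noteq> -\<infinity>"
      using u by (auto simp: explosion_times_def)
    have dth: "(theta lam has_real_derivative angle_field lam u (theta lam u)) (at u)"
      using theta_deriv[OF ui(1), of lam] ui by (simp add: at_within_Icc_interior)
    have dq: "(q has_real_derivative - (2 * lam * exp (- w u)) - exp (w u) * (q u)\<^sup>2) (at u)"
      using riccati[of u] ui pu unfolding q_def by auto
    have pos: "1 + (q u)\<^sup>2 \<noteq> 0" using zero_le_power2[of "q u"] by linarith
    define s c where "s = sin (theta lam u)" and "c = cos (theta lam u)"
    have dG0: "(G has_real_derivative
      (2 * (c - q u * s) * (- s * angle_field lam u (theta lam u) - ((- (2 * lam * exp (- w u)) - exp (w u) * (q u)\<^sup>2) * s + c * angle_field lam u (theta lam u) * q u)) * (1 + (q u)\<^sup>2) - (c - q u * s)\<^sup>2 * (2 * q u * (- (2 * lam * exp (- w u)) - exp (w u) * (q u)\<^sup>2)))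
            / ((1 + (q u)\<^sup>2) * (1 + (q u)\<^sup>2))) (at u)"
      unfolding G_def s_def c_def
      by (rule derivative_eq_intros dth dq refl pos)+ (simp add: mult_ac)
    have fld: "angle_field lam u (theta lam u) = exp (w u) * c\<^sup>2 + (2 * lam * exp (- w u)) * s\<^sup>2"
      by (simp add: angle_field_def s_def c_def)
    have cs: "c\<^sup>2 + s\<^sup>2 = 1" by (simp add: s_def c_def)
    have "(G has_real_derivative 2 * (2 * lam * exp (- w u) - exp (w u)) * (s * c + q u / (1 + (q u)\<^sup>2)) * ((c - q u * s)\<^sup>2 / (1 + (q u)\<^sup>2))) (at u)"
      using dG0 unfolding fld riccati_quotient_identity[OF cs] .
    moreover have "Z u = (c - q u * s)\<^sup>2 / (1 + (q u)\<^sup>2)"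
      using pu ui by (simp add: Z_def G_def s_def c_def)
    ultimately have dG: "(G has_real_derivative Z' u) (at u)" by (simp add: Z'_def s_def c_def)
    have "\<forall>\<^sub>F s in at u. p s \<noteq> -\<infinity>"
      using explosions_isolated[OF rp ab ui(1)] ui by (simp add: at_within_Icc_interior)
    then have ev1: "\<forall>\<^sub>F s in nhds u. p s \<noteq> -\<infinity>" using pu by (simp add: eventually_nhds_conv_at)
    have ev2: "\<forall>\<^sub>F s in nhds u. s \<in> {a<..<b}"
      by (rule eventually_nhds_in_open) (use ui in auto)
    have "\<forall>\<^sub>F s in nhds u. G s = Z s"
      using ev1 ev2 by eventually_elim (auto simp: Z_def)
    then show ?thesis using dG DERIV_cong_ev[OF refl _ refl, of G Z u] by blast
  qed
  \<comment> \<open>The last factor 2 bounds |sin cos| + |q / (1 + q^2)|, each term being at most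
    1.\<close>
  define C where "C = 2 * (2 * \<bar>lam\<bar> * B + B) * 2"
  have Zn: "Z u \<ge> 0" for u by (simp add: Z_def G_def)
  have leZ: "Z' u \<le> C * Z u" if u: "u \<in> {a..b}" for u
  proof -
    have "\<bar>2 * lam * exp (- w u)\<bar> \<le> 2 * \<bar>lam\<bar> * B"
      unfolding abs_mult by (intro mult_mono) (use B u in auto)
    moreover have "\<bar>exp (w u)\<bar> \<le> B" using B u by auto
    ultimately have 1: "\<bar>2 * lam * exp (- w u) - exp (w u)\<bar> \<le> 2 * \<bar>lam\<bar> * B + B" by linarith
    have "\<bar>sin (theta lam u) * cos (theta lam u)\<bar> \<le> 1"
      unfolding abs_mult using mult_mono[of "\<bar>sin (theta lam u)\<bar>" 1 "\<bar>cos (theta lam u)\<bar>" 1] by simp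
    moreover have "\<bar>q u / (1 + (q u)\<^sup>2)\<bar> \<le> 1"
    proof -
      have "0 \<le> (\<bar>q u\<bar> - 1)\<^sup>2" by simp
      then have "2 * \<bar>q u\<bar> \<le> 1 + (q u)\<^sup>2" by (simp add: power2_diff)
      then have "\<bar>q u\<bar> \<le> 1 + (q u)\<^sup>2" by linarith
      moreover have "1 + (q u)\<^sup>2 > 0" using zero_le_power2[of "q u"] by linarith
      ultimately show ?thesis by (simp add: abs_divide divide_le_eq)
    qed
    ultimately have 2: "\<bar>sin (theta lam u) * cos (theta lam u) + q u / (1 + (q u)\<^sup>2)\<bar> \<le> 2" by linarith
    have "\<bar>2 * (2 * lam * exp (- w u) - exp (w u)) *
      (sin (theta lam u) * cos (theta lam u) + q u / (1 + (q u)\<^sup>2))\<bar> \<le> C"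
      unfolding C_def abs_mult using B by (intro mult_mono 1 2) auto
    then have "2 * (2 * lam * exp (- w u) - exp (w u)) *
      (sin (theta lam u) * cos (theta lam u) + q u / (1 + (q u)\<^sup>2)) \<le> C" by linarith
    then show ?thesis unfolding Z'_def by (intro mult_right_mono Zn)
  qed
  have "Z t = 0"
    by (rule gronwall_forward_zero[of ?S a t Z Z' C])
      (use t leZ Zn dZ finite_explosion_times[OF rp ab] in
        \<open>auto intro: continuous_on_subset[OF Zc] simp: Z_def[of a] theta_a\<close>)
  show ?thesis
  proof
    assume "p t = -\<infinity>"
    then show "sin (theta lam t) = 0" using \<open>Z t = 0\<close> by (simp add: Z_def)
  next
    assume s: "sin (theta lam t) = 0"
    show "p t = -\<infinity>"
    proof (rule ccontr)
      assume "p t \<noteq> -\<infinity>"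
      then have "G t = 0" using \<open>Z t = 0\<close> t by (simp add: Z_def)
      moreover have "1 + (q t)\<^sup>2 \<noteq> 0" using zero_le_power2[of "q t"] by linarith
      ultimately have "cos (theta lam t) = 0" using s by (simp add: G_def)
      then show False using s sin_cos_squared_add[of "theta lam t"] by simp
    qed
  qed
qed

lemma eigenvalue_count:
  assumes rp: "restarting_path a b p"
    and riccati: "\<And>t. t \<in> {a<..<b} \<Longrightarrow> p t \<noteq> -\<infinity> \<Longrightarrow>
      ((\<lambda>t. exp (- w t) * real_of_ereal (p t)) has_real_derivative
        - (2 * lam * exp (- w t)) - exp (w t) * (exp (- w t) * real_of_ereal (p t))\<^sup>2) (at t)"
    and nb: "p b \<noteq> -\<infinity>"
  shows "finite {\<mu>. L_eigenvalue w a b \<mu> \<and> \<mu> < lam}"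
    and "card {\<mu>. L_eigenvalue w a b \<mu> \<and> \<mu> < lam} = card (explosion_times a b p)"
proof -
  note iff = explosion_iff_theta[OF rp riccati]
  have nz: "sin (theta lam b) \<noteq> 0" using iff[of b] nb ab by auto
  have ex: "explosion_times a b p = {x \<in> {a<..b}. sin (theta lam x) = 0}"
    unfolding explosion_times_def using iff by blast
  have b1: "bij_betw (\<lambda>\<mu>. theta \<mu> b) {\<mu>. L_eigenvalue w a b \<mu> \<and> \<mu> < lam} (pi_multiples (theta lam b))"
    unfolding eigenvalue_iff by (rule eigenvalues_bij[OF nz])
  have b2: "bij_betw (theta lam) (explosion_times a b p) (pi_multiples (theta lam b))"
    unfolding ex by (rule zeros_bij)
  show "finite {\<mu>. L_eigenvalue w a b \<mu> \<and> \<mu> < lam}"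
    using bij_betw_finite[OF b1] finite_pi_multiples by blast
  show "card {\<mu>. L_eigenvalue w a b \<mu> \<and> \<mu> < lam} = card (explosion_times a b p)"
    using bij_betw_same_card[OF b1] bij_betw_same_card[OF b2] by simp
qed

end

section \<open>Brownian increments\<close>

locale brownian = prob_space M for M :: "'w measure" +
  fixes F :: "real \<Rightarrow> 'w measure" and W :: "real \<Rightarrow> 'w \<Rightarrow> real" and a b :: real
  assumes ab: "a < b" and BM: "two_sided_BM M W" and BMF: "BM_filtration M F W a b"
begin

lemma space_F [simp]: "space (F t) = space M"
  using BMF unfolding BM_filtration_def by (auto simp: filtration.space_F)

lemma sets_F_mono: "s \<le> t \<Longrightarrow> sets (F s) \<subseteq> sets (F t)"
  using BMF unfolding BM_filtration_def by (auto dest: filtration.sets_F_mono)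

lemma sets_F_M: "t \<in> {a..b} \<Longrightarrow> sets (F t) \<subseteq> sets M"
  using BMF unfolding BM_filtration_def by auto

lemma measurable_F_mono: "f \<in> measurable (F s) N \<Longrightarrow> s \<le> t \<Longrightarrow> f \<in> measurable (F t) N"
  using sets_F_mono[of s t] by (auto simp: measurable_def)

lemma measurable_F_M: "f \<in> measurable (F s) N \<Longrightarrow> s \<in> {a..b} \<Longrightarrow> f \<in> measurable M N"
  using sets_F_M[of s] by (auto simp: measurable_def)

lemma W_measurable [measurable]: "W t \<in> borel_measurable M"
  using BM unfolding two_sided_BM_def by auto

lemma W_adapted: "t \<in> {a..b} \<Longrightarrow> (\<lambda>\<omega>. W t \<omega> - W a \<omega>) \<in> borel_measurable (F t)"
  using BMF unfolding BM_filtration_def by auto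

lemma increment_measurable_F:
  assumes "a \<le> s" "s \<le> t" "t \<le> b"
  shows "(\<lambda>\<omega>. W t \<omega> - W s \<omega>) \<in> borel_measurable (F t)"
proof -
  have [measurable]: "(\<lambda>\<omega>. W t \<omega> - W a \<omega>) \<in> borel_measurable (F t)"
    "(\<lambda>\<omega>. W s \<omega> - W a \<omega>) \<in> borel_measurable (F t)"
    using W_adapted[of t] measurable_F_mono[OF W_adapted[of s], of t] assms by auto
  have "(\<lambda>\<omega>. (W t \<omega> - W a \<omega>) - (W s \<omega> - W a \<omega>)) \<in> borel_measurable (F t)"
    by measurable
  then show ?thesis by simp
qed

lemma increment_distributed:
  "s < t \<Longrightarrow> distributed M lborel (\<lambda>\<omega>. W t \<omega> - W s \<omega>) (normal_density 0 (sqrt (t - s)))"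
  using BM unfolding two_sided_BM_def by auto

lemma increment_indep_set:
  assumes "a \<le> s" "s \<le> t" "t \<le> b"
  shows "indep_set (sets (F s)) {(\<lambda>\<omega>. W t \<omega> - W s \<omega>) -` A \<inter> space M | A. A \<in> sets borel}"
  using BMF assms unfolding BM_filtration_def by auto

lemma indep_increment:
  assumes "a \<le> s" "s \<le> t" "t \<le> b" and Y: "Y \<in> measurable (F s) N"
  shows "indep_var N Y borel (\<lambda>\<omega>. W t \<omega> - W s \<omega>)"
proof -
  have YM: "Y \<in> measurable M N" by (rule measurable_F_M[OF Y]) (use assms in auto)
  have sub: "{Y -` A \<inter> space M |A. A \<in> sets N} \<subseteq> sets (F s)"
    using measurable_sets[OF Y] by auto
  have "indep_set {Y -` A \<inter> space M |A. A \<in> sets N} {(\<lambda>\<omega>. W t \<omega> - W s \<omega>) -` A \<inter> space M |A. A \<in> sets borel}"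
    unfolding indep_set_def
    by (rule indep_sets_mono_sets[OF increment_indep_set[OF assms(1-3), unfolded indep_set_def]])
      (use sub in \<open>auto split: bool.split\<close>)
  then have "indep_set (sigma_sets (space M) {Y -` A \<inter> space M |A. A \<in> sets N})
      (sigma_sets (space M) {(\<lambda>\<omega>. W t \<omega> - W s \<omega>) -` A \<inter> space M |A. A \<in> sets borel})"
  proof (rule indep_set_sigma_sets)
    show "Int_stable {Y -` A \<inter> space M |A. A \<in> sets N}"
    proof (rule Int_stableI, safe)
      fix A B assume "A \<in> sets N" "B \<in> sets N"
      then show "\<exists>C. Y -` A \<inter> space M \<inter> (Y -` B \<inter> space M) = Y -` C \<inter> space M \<and> C \<in> sets N"
        by (intro exI[of _ "A \<inter> B"]) auto
    qed
    show "Int_stable {(\<lambda>\<omega>. W t \<omega> - W s \<omega>) -` A \<inter> space M |A. A \<in> sets borel}"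
    proof (rule Int_stableI, safe)
      fix A B :: "real set" assume "A \<in> sets borel" "B \<in> sets borel"
      then show "\<exists>C. (\<lambda>\<omega>. W t \<omega> - W s \<omega>) -` A \<inter> space M \<inter> ((\<lambda>\<omega>. W t \<omega> - W s \<omega>) -` B \<inter> space M)
          = (\<lambda>\<omega>. W t \<omega> - W s \<omega>) -` C \<inter> space M \<and> C \<in> sets borel"
        by (intro exI[of _ "A \<inter> B"]) auto
    qed
  qed
  then show ?thesis unfolding indep_var_eq using YM by simp
qed

lemma increment_moments:
  assumes st: "s \<le> t"
  defines "X \<equiv> \<lambda>\<omega>. W t \<omega> - W s \<omega>"
  shows "integrable M (\<lambda>\<omega>. X \<omega> ^ k)" and "expectation X = 0"
    and "expectation (\<lambda>\<omega>. X \<omega> ^ 2) = t - s"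
    and "expectation (\<lambda>\<omega>. X \<omega> ^ 4) = 3 * (t - s)^2"
proof -
  have *: "integrable M (\<lambda>\<omega>. X \<omega> ^ k) \<and> expectation X = 0 \<and> expectation (\<lambda>\<omega>. X \<omega> ^ 2) = t - s
    \<and> expectation (\<lambda>\<omega>. X \<omega> ^ 4) = 3 * (t - s)^2"
  \<comment> \<open>Equal times are treated apart: the increment is then 0 and has no
    density.\<close>
  proof (cases "s = t")
    case True
    then show ?thesis by (cases k) (auto simp: X_def)
  next
    case False
    then have st: "s < t" using st by simp
    define \<sigma> where "\<sigma> = sqrt (t - s)"
    have \<sigma>: "\<sigma> > 0" "\<sigma>\<^sup>2 = t - s" using st by (auto simp: \<sigma>_def)
    have D: "distributed M lborel X (normal_density 0 \<sigma>)"
      using increment_distributed[OF st] by (simp add: X_def \<sigma>_def)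
    have nn: "0 \<le> normal_density 0 \<sigma> x" for x by simp
    have "integrable M (\<lambda>\<omega>. X \<omega> ^ k)"
      using distributed_integrable[OF D, of "\<lambda>x. x ^ k"] integrable_normal_moment[OF \<sigma>(1), of 0 k] by simp
    moreover have "expectation X = 0"
      using distributed_integral[OF D, of "\<lambda>x. x"] integral_normal_moment_nz_1[OF \<sigma>(1), of 0] by simp
    moreover have "expectation (\<lambda>\<omega>. X \<omega> ^ 2) = t - s"
      using distributed_integral[OF D, of "\<lambda>x. x ^ 2"] integral_normal_moment_even[OF \<sigma>(1), of 0 1] \<sigma> by simp
    moreover have "expectation (\<lambda>\<omega>. X \<omega> ^ 4) = 3 * (t - s)^2"
      using distributed_integral[OF D, of "\<lambda>x. x ^ 4"] integral_normal_moment_even[OF \<sigma>(1), of 0 2] \<sigma>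
      by (simp add: fact_numeral power_divide field_simps)
    ultimately show ?thesis by simp
  qed
  then show "integrable M (\<lambda>\<omega>. X \<omega> ^ k)" "expectation X = 0"
    "expectation (\<lambda>\<omega>. X \<omega> ^ 2) = t - s" "expectation (\<lambda>\<omega>. X \<omega> ^ 4) = 3 * (t - s)^2" by auto
qed

section \<open>Orthogonal martingale differences\<close>

text \<open>Conditional mean zero is encoded as orthogonality to all square integrable
  \<open>F s\<close>-measurable variables. This is exactly what the Pythagorean identity for sums
  uses, and it avoids conditional expectations.\<close>

definition mdiff :: "real \<Rightarrow> real \<Rightarrow> ('w \<Rightarrow> real) \<Rightarrow> bool" where
  "mdiff s t D \<longleftrightarrow> D \<in> borel_measurable (F t) \<and> integrable M (\<lambda>\<omega>. (D \<omega>)\<^sup>2) \<and>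
     (\<forall>Y\<in>borel_measurable (F s). integrable M (\<lambda>\<omega>. (Y \<omega>)\<^sup>2) \<longrightarrow> expectation (\<lambda>\<omega>. Y \<omega> * D \<omega>) = 0)"

lemma square_integrable_mult:
  fixes X Y :: "'w \<Rightarrow> real"
  assumes [measurable]: "X \<in> borel_measurable M" "Y \<in> borel_measurable M"
    and "integrable M (\<lambda>\<omega>. (X \<omega>)\<^sup>2)" "integrable M (\<lambda>\<omega>. (Y \<omega>)\<^sup>2)"
  shows "integrable M (\<lambda>\<omega>. X \<omega> * Y \<omega>)"
proof (rule Bochner_Integration.integrable_bound)
  show "integrable M (\<lambda>\<omega>. (X \<omega>)\<^sup>2 + (Y \<omega>)\<^sup>2)" using assms by auto
  show "AE \<omega> in M. norm (X \<omega> * Y \<omega>) \<le> norm ((X \<omega>)\<^sup>2 + (Y \<omega>)\<^sup>2)"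
  proof (rule AE_I2)
    fix \<omega>
    have "0 \<le> (\<bar>X \<omega>\<bar> - \<bar>Y \<omega>\<bar>)\<^sup>2" by simp
    then have "2 * (\<bar>X \<omega>\<bar> * \<bar>Y \<omega>\<bar>) \<le> (X \<omega>)\<^sup>2 + (Y \<omega>)\<^sup>2" by (simp add: power2_diff)
    moreover have "0 \<le> \<bar>X \<omega>\<bar> * \<bar>Y \<omega>\<bar>" by simp
    ultimately have "\<bar>X \<omega>\<bar> * \<bar>Y \<omega>\<bar> \<le> (X \<omega>)\<^sup>2 + (Y \<omega>)\<^sup>2" by linarith
    then show "norm (X \<omega> * Y \<omega>) \<le> norm ((X \<omega>)\<^sup>2 + (Y \<omega>)\<^sup>2)" by (simp add: abs_mult)
  qed
qed simp

lemma square_integrable_add: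
  fixes X Y :: "'w \<Rightarrow> real"
  assumes "X \<in> borel_measurable M" "Y \<in> borel_measurable M"
    and "integrable M (\<lambda>\<omega>. (X \<omega>)\<^sup>2)" "integrable M (\<lambda>\<omega>. (Y \<omega>)\<^sup>2)"
  shows "integrable M (\<lambda>\<omega>. (X \<omega> + Y \<omega>)\<^sup>2)"
proof -
  have "integrable M (\<lambda>\<omega>. (X \<omega>)\<^sup>2 + (Y \<omega>)\<^sup>2 + 2 * (X \<omega> * Y \<omega>))"
    using square_integrable_mult[OF assms] assms(3,4) by (intro Bochner_Integration.integrable_add) auto
  then show ?thesis by (simp add: power2_sum mult_ac)
qed

lemma square_integrable_bounded_mult:
  fixes X Y :: "'w \<Rightarrow> real"
  assumes [measurable]: "X \<in> borel_measurable M" "Y \<in> borel_measurable M"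
    and bd: "\<And>\<omega>. \<omega> \<in> space M \<Longrightarrow> \<bar>X \<omega>\<bar> \<le> C" and Y: "integrable M (\<lambda>\<omega>. (Y \<omega>)\<^sup>2)"
  shows "integrable M (\<lambda>\<omega>. (X \<omega> * Y \<omega>)\<^sup>2)"
proof (rule Bochner_Integration.integrable_bound)
  show "integrable M (\<lambda>\<omega>. C\<^sup>2 * (Y \<omega>)\<^sup>2)" using Y by auto
  show "AE \<omega> in M. norm ((X \<omega> * Y \<omega>)\<^sup>2) \<le> norm (C\<^sup>2 * (Y \<omega>)\<^sup>2)"
  proof (rule AE_I2)
    fix \<omega> assume "\<omega> \<in> space M"
    then have "(X \<omega>)\<^sup>2 \<le> C\<^sup>2" using bd[of \<omega>] by (meson abs_le_square_iff abs_ge_self order_trans)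
    then show "norm ((X \<omega> * Y \<omega>)\<^sup>2) \<le> norm (C\<^sup>2 * (Y \<omega>)\<^sup>2)"
      by (simp add: power_mult_distrib mult_right_mono)
  qed
qed simp

text \<open>A bounded \<open>F s\<close>-measurable factor is moved into the test variable
  \<open>Y\<close>.\<close>

lemma mdiff_scale:
  assumes st: "a \<le> s" "s \<le> t" "t \<le> b" and D: "mdiff s t D" and g: "g \<in> borel_measurable (F s)"
    and bd: "\<And>\<omega>. \<omega> \<in> space M \<Longrightarrow> \<bar>g \<omega>\<bar> \<le> C"
  shows "mdiff s t (\<lambda>\<omega>. g \<omega> * D \<omega>)"
proof -
  have gM: "g \<in> borel_measurable M" by (rule measurable_F_M[OF g]) (use st in auto)
  have DM: "D \<in> borel_measurable M"
    using D st unfolding mdiff_def by (auto intro: measurable_F_M[of D t])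
  have [measurable]: "g \<in> borel_measurable (F t)" "D \<in> borel_measurable (F t)"
    using D measurable_F_mono[OF g st(2)] by (auto simp: mdiff_def)
  have 1: "(\<lambda>\<omega>. g \<omega> * D \<omega>) \<in> borel_measurable (F t)" by measurable
  have 2: "integrable M (\<lambda>\<omega>. (g \<omega> * D \<omega>)\<^sup>2)"
    using square_integrable_bounded_mult[OF gM DM bd] D by (auto simp: mdiff_def)
  have 3: "expectation (\<lambda>\<omega>. Y \<omega> * (g \<omega> * D \<omega>)) = 0"
    if Y: "Y \<in> borel_measurable (F s)" "integrable M (\<lambda>\<omega>. (Y \<omega>)\<^sup>2)" for Y
  proof -
    have YM: "Y \<in> borel_measurable M" by (rule measurable_F_M[OF Y(1)]) (use st in auto)
    have "integrable M (\<lambda>\<omega>. (g \<omega> * Y \<omega>)\<^sup>2)"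
      by (rule square_integrable_bounded_mult[OF gM YM bd Y(2)])
    moreover have "(\<lambda>\<omega>. g \<omega> * Y \<omega>) \<in> borel_measurable (F s)" using g Y(1) by measurable
    ultimately have "expectation (\<lambda>\<omega>. (g \<omega> * Y \<omega>) * D \<omega>) = 0" using D by (auto simp: mdiff_def)
    then show ?thesis by (simp add: mult_ac)
  qed
  show ?thesis unfolding mdiff_def using 1 2 3 by blast
qed

lemma mdiff_of_increment:
  assumes st: "a \<le> s" "s \<le> t" "t \<le> b" and f[measurable]: "f \<in> borel_measurable borel"
    and i1: "integrable M (\<lambda>\<omega>. f (W t \<omega> - W s \<omega>))" and i2: "integrable M (\<lambda>\<omega>. (f (W t \<omega> - W s \<omega>))\<^sup>2)"
    and z: "expectation (\<lambda>\<omega>. f (W t \<omega> - W s \<omega>)) = 0"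
  shows "mdiff s t (\<lambda>\<omega>. f (W t \<omega> - W s \<omega>))"
proof -
  have [measurable]: "(\<lambda>\<omega>. W t \<omega> - W s \<omega>) \<in> borel_measurable (F t)"
    by (rule increment_measurable_F[OF st])
  have 3: "expectation (\<lambda>\<omega>. Y \<omega> * f (W t \<omega> - W s \<omega>)) = 0"
    if Y: "Y \<in> borel_measurable (F s)" "integrable M (\<lambda>\<omega>. (Y \<omega>)\<^sup>2)" for Y
  proof -
    have YM: "Y \<in> borel_measurable M" by (rule measurable_F_M[OF Y(1)]) (use st in auto)
    have Yi: "integrable M Y" by (rule square_integrable_imp_integrable[OF YM Y(2)])
    have "indep_var borel Y borel (f \<circ> (\<lambda>\<omega>. W t \<omega> - W s \<omega>))"
      using indep_var_compose[OF indep_increment[OF st Y(1)], of id borel f borel] by (simp add: comp_def)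
    then have iv: "indep_var borel Y borel (\<lambda>\<omega>. f (W t \<omega> - W s \<omega>))" by (simp add: comp_def)
    show ?thesis using indep_var_lebesgue_integral[OF iv Yi i1] z by simp
  qed
  have "(\<lambda>\<omega>. f (W t \<omega> - W s \<omega>)) \<in> borel_measurable (F t)" by measurable
  then show ?thesis unfolding mdiff_def using 3 i2 by blast
qed

lemma mdiff_increment:
  assumes st: "a \<le> s" "s \<le> t" "t \<le> b"
  shows "mdiff s t (\<lambda>\<omega>. W t \<omega> - W s \<omega>)"
  by (rule mdiff_of_increment[OF st, of "\<lambda>x. x"])
    (use increment_moments(1)[OF st(2), of 1] increment_moments(1)[OF st(2), of 2] increment_moments(2)[OF st(2)] in auto)

text \<open>With h = t - s, the second moment of the compensated square is 3 h^2 - 2 h^2 + h^2, by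
  the fourth Gaussian moment.\<close>

lemma mdiff_quadratic:
  assumes st: "a \<le> s" "s \<le> t" "t \<le> b"
  shows "mdiff s t (\<lambda>\<omega>. (W t \<omega> - W s \<omega>)\<^sup>2 - (t - s))"
    and "expectation (\<lambda>\<omega>. ((W t \<omega> - W s \<omega>)\<^sup>2 - (t - s))\<^sup>2) = 2 * (t - s)\<^sup>2"
proof -
  note m = increment_moments[OF st(2)]
  have eq: "(x\<^sup>2 - (t - s))\<^sup>2 = x ^ 4 - 2 * (t - s) * x ^ 2 + (t - s)\<^sup>2" for x :: real
    by (simp add: power2_diff power4_eq_xxxx power2_eq_square algebra_simps)
  have i: "integrable M (\<lambda>\<omega>. ((W t \<omega> - W s \<omega>)\<^sup>2 - (t - s))\<^sup>2)"
    unfolding eq using m(1)[of 4] m(1)[of 2] by auto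
  show "mdiff s t (\<lambda>\<omega>. (W t \<omega> - W s \<omega>)\<^sup>2 - (t - s))"
    by (rule mdiff_of_increment[OF st, of "\<lambda>x. x\<^sup>2 - (t - s)"])
      (use i m(1)[of 2] m(3) in \<open>auto simp: prob_space\<close>)
  show "expectation (\<lambda>\<omega>. ((W t \<omega> - W s \<omega>)\<^sup>2 - (t - s))\<^sup>2) = 2 * (t - s)\<^sup>2"
  proof -
    have "expectation (\<lambda>\<omega>. ((W t \<omega> - W s \<omega>)\<^sup>2 - (t - s))\<^sup>2)
        = expectation (\<lambda>\<omega>. (W t \<omega> - W s \<omega>) ^ 4) - 2 * (t - s) * expectation (\<lambda>\<omega>. (W t \<omega> - W s \<omega>) ^ 2) + (t - s)\<^sup>2"
      unfolding eq using m(1)[of 4] m(1)[of 2] by (simp add: prob_space)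
    then show ?thesis unfolding m(3,4) by (simp add: power2_eq_square)
  qed
qed

text \<open>The partial sum is itself an admissible test variable for the next difference, so cross
  terms vanish and second moments add.\<close>

lemma mdiff_sum:
  assumes T: "\<And>i. i < n \<Longrightarrow> T i \<le> T (Suc i)" "a \<le> T 0" "T n \<le> b"
    and D: "\<And>i. i < n \<Longrightarrow> mdiff (T i) (T (Suc i)) (D i)"
  shows "mdiff (T 0) (T n) (\<lambda>\<omega>. \<Sum>i<n. D i \<omega>) \<and>
    expectation (\<lambda>\<omega>. (\<Sum>i<n. D i \<omega>)\<^sup>2) = (\<Sum>i<n. expectation (\<lambda>\<omega>. (D i \<omega>)\<^sup>2))"
  using assms
proof (induction n)
  case 0
  then show ?case by (auto simp: mdiff_def)
next
  case (Suc n)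
  have mono: "T 0 \<le> T n"
    using Suc.prems(1) by (induction n) (auto, metis less_SucI order_trans lessI)
  have Tn: "T n \<le> T (Suc n)" using Suc.prems(1)[of n] by simp
  have bnds: "a \<le> T n" "T n \<le> b" "a \<le> T (Suc n)" "T 0 \<le> b" "a \<le> T 0" "T (Suc n) \<le> b"
    using mono Tn Suc.prems(2,3) by linarith+
  have IH: "mdiff (T 0) (T n) (\<lambda>\<omega>. \<Sum>i<n. D i \<omega>)"
    "expectation (\<lambda>\<omega>. (\<Sum>i<n. D i \<omega>)\<^sup>2) = (\<Sum>i<n. expectation (\<lambda>\<omega>. (D i \<omega>)\<^sup>2))"
    using Suc.IH Suc.prems bnds by auto
  let ?S = "\<lambda>\<omega>. \<Sum>i<n. D i \<omega>"
  have Dn: "mdiff (T n) (T (Suc n)) (D n)" using Suc.prems by auto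
  have S_F: "?S \<in> borel_measurable (F (T n))" using IH(1) by (auto simp: mdiff_def)
  have S_M: "?S \<in> borel_measurable M" by (rule measurable_F_M[OF S_F]) (use bnds in auto)
  have D_F: "D n \<in> borel_measurable (F (T (Suc n)))" using Dn by (auto simp: mdiff_def)
  have D_M: "D n \<in> borel_measurable M" by (rule measurable_F_M[OF D_F]) (use bnds in auto)
  have S2: "integrable M (\<lambda>\<omega>. (?S \<omega>)\<^sup>2)" using IH(1) by (auto simp: mdiff_def)
  have D2: "integrable M (\<lambda>\<omega>. (D n \<omega>)\<^sup>2)" using Dn by (auto simp: mdiff_def)
  have SD: "expectation (\<lambda>\<omega>. ?S \<omega> * D n \<omega>) = 0" using Dn S_F S2 by (auto simp: mdiff_def)
  have SDi: "integrable M (\<lambda>\<omega>. ?S \<omega> * D n \<omega>)" by (rule square_integrable_mult[OF S_M D_M S2 D2])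
  have 1: "mdiff (T 0) (T (Suc n)) (\<lambda>\<omega>. \<Sum>i<Suc n. D i \<omega>)"
    unfolding mdiff_def
  proof (intro conjI ballI impI)
    show "(\<lambda>\<omega>. \<Sum>i<Suc n. D i \<omega>) \<in> borel_measurable (F (T (Suc n)))"
      using measurable_F_mono[OF S_F Tn] D_F by simp
    show "integrable M (\<lambda>\<omega>. (\<Sum>i<Suc n. D i \<omega>)\<^sup>2)"
      using square_integrable_add[OF S_M D_M S2 D2] by simp
    fix Y :: "'w \<Rightarrow> real" assume Y: "Y \<in> borel_measurable (F (T 0))" "integrable M (\<lambda>\<omega>. (Y \<omega>)\<^sup>2)"
    have YM: "Y \<in> borel_measurable M" by (rule measurable_F_M[OF Y(1)]) (use bnds in auto)
    have "expectation (\<lambda>\<omega>. Y \<omega> * ?S \<omega>) = 0" using IH(1) Y by (auto simp: mdiff_def)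
    moreover have "expectation (\<lambda>\<omega>. Y \<omega> * D n \<omega>) = 0"
      using Dn Y measurable_F_mono[OF Y(1) mono] by (auto simp: mdiff_def)
    moreover have "integrable M (\<lambda>\<omega>. Y \<omega> * ?S \<omega>)" by (rule square_integrable_mult[OF YM S_M Y(2) S2])
    moreover have "integrable M (\<lambda>\<omega>. Y \<omega> * D n \<omega>)" by (rule square_integrable_mult[OF YM D_M Y(2) D2])
    ultimately show "expectation (\<lambda>\<omega>. Y \<omega> * (\<Sum>i<Suc n. D i \<omega>)) = 0"
      by (simp add: distrib_left)
  qed
  have "expectation (\<lambda>\<omega>. (?S \<omega> + D n \<omega>)\<^sup>2) = expectation (\<lambda>\<omega>. (?S \<omega>)\<^sup>2 + (D n \<omega>)\<^sup>2 + 2 * (?S \<omega> * D n \<omega>))"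
    by (simp add: power2_sum mult_ac)
  also have "\<dots> = expectation (\<lambda>\<omega>. (?S \<omega>)\<^sup>2) + expectation (\<lambda>\<omega>. (D n \<omega>)\<^sup>2)"
    using S2 D2 SDi SD by simp
  finally show ?case using 1 IH(2) by simp
qed

lemma mdiff_sum_nn:
  assumes T: "\<And>i. i < n \<Longrightarrow> T i \<le> T (Suc i)" "a \<le> T 0" "T n \<le> b"
    and D: "\<And>i. i < n \<Longrightarrow> mdiff (T i) (T (Suc i)) (D i)"
  shows "(\<integral>\<^sup>+\<omega>. ennreal ((\<Sum>i<n. D i \<omega>)\<^sup>2) \<partial>M) = (\<Sum>i<n. \<integral>\<^sup>+\<omega>. ennreal ((D i \<omega>)\<^sup>2) \<partial>M)"
proof -
  note m = mdiff_sum[where D = D, OF assms]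
  have "(\<integral>\<^sup>+\<omega>. ennreal ((\<Sum>i<n. D i \<omega>)\<^sup>2) \<partial>M) = ennreal (expectation (\<lambda>\<omega>. (\<Sum>i<n. D i \<omega>)\<^sup>2))"
    by (rule nn_integral_eq_integral) (use m in \<open>auto simp: mdiff_def\<close>)
  also have "\<dots> = (\<Sum>i<n. ennreal (expectation (\<lambda>\<omega>. (D i \<omega>)\<^sup>2)))"
    using m by (simp add: sum_ennreal)
  also have "\<dots> = (\<Sum>i<n. \<integral>\<^sup>+\<omega>. ennreal ((D i \<omega>)\<^sup>2) \<partial>M)"
    by (intro sum.cong refl nn_integral_eq_integral[symmetric]) (use D in \<open>auto simp: mdiff_def\<close>)
  finally show ?thesis .
qed

end

section \<open>Error of freezing an Ito integrand\<close>

text \<open>\<open>has_ito_integral\<close> provides joint measurability only for times in the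
  interval of integration; extension by 0 makes the integrand measurable on the full
  product.\<close>

lemma measurable_pair_restrict_extend:
  fixes H :: "'u \<Rightarrow> 'w \<Rightarrow> real"
  assumes S: "S \<in> sets N"
    and H: "(\<lambda>(u, \<omega>). H u \<omega>) \<in> borel_measurable (restrict_space N S \<Otimes>\<^sub>M M)"
  shows "(\<lambda>(u, \<omega>). if u \<in> S then H u \<omega> else 0) \<in> borel_measurable (N \<Otimes>\<^sub>M M)"
proof -
  let ?R = "restrict_space (N \<Otimes>\<^sub>M M) {x. fst x \<in> S}"
  have 1: "fst \<in> measurable ?R (restrict_space N S)"
    by (rule measurable_restrict_space2) (auto simp: space_restrict_space intro: measurable_restrict_space1)
  have 2: "snd \<in> measurable ?R M"
    by (rule measurable_restrict_space1) simp
  have "(\<lambda>x. (fst x, snd x)) \<in> measurable ?R (restrict_space N S \<Otimes>\<^sub>M M)"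
    by (rule measurable_Pair[OF 1 2])
  from measurable_compose[OF this H]
  have "(\<lambda>x. H (fst x) (snd x)) \<in> borel_measurable ?R" by (simp only: split)
  moreover have [measurable]: "Measurable.pred (N \<Otimes>\<^sub>M M) (\<lambda>x. fst x \<in> S)"
    using S by measurable
  ultimately have "(\<lambda>x. if fst x \<in> S then H (fst x) (snd x) else 0) \<in> borel_measurable (N \<Otimes>\<^sub>M M)"
    by (subst measurable_If_restrict_space_iff) (auto simp: pred_def)
  then show ?thesis by (simp add: case_prod_beta')
qed

lemma mono_grid:
  fixes \<tau> :: "nat \<Rightarrow> 'a::order"
  assumes "\<And>i. i < n \<Longrightarrow> \<tau> i \<le> \<tau> (Suc i)" and "i \<le> j" "j \<le> n"
  shows "\<tau> i \<le> \<tau> j"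
  using assms(2,3)
proof (induction j rule: dec_induct)
  case (step k)
  then show ?case using assms(1)[of k] order_trans[of "\<tau> i" "\<tau> k" "\<tau> (Suc k)"] by simp
qed simp

text \<open>Grid points may coincide, in which case the half-open cell between them is empty; a time
  in no cell at all occurs, for instance, at the left end.\<close>

lemma at_most_one_interval:
  fixes \<tau> :: "nat \<Rightarrow> real"
  assumes mono: "\<And>i. i < n \<Longrightarrow> \<tau> i \<le> \<tau> (Suc i)"
  shows "(\<forall>j<n. u \<notin> {\<tau> j<..\<tau> (Suc j)}) \<or>
    (\<exists>j<n. u \<in> {\<tau> j<..\<tau> (Suc j)} \<and> (\<forall>i<n. i \<noteq> j \<longrightarrow> u \<notin> {\<tau> i<..\<tau> (Suc i)}))"
proof (rule disjCI)
  assume "\<not> (\<exists>j<n. u \<in> {\<tau> j<..\<tau> (Suc j)} \<and> (\<forall>i<n. i \<noteq> j \<longrightarrow> u \<notin> {\<tau> i<..\<tau> (Suc i)}))"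
  moreover have mono': "\<tau> i \<le> \<tau> j" if "i \<le> j" "j \<le> n" for i j
    using mono_grid[of n \<tau> i j] mono that by blast
  have "False" if "i < n" "j < n" "i < j" "u \<in> {\<tau> i<..\<tau> (Suc i)}" "u \<in> {\<tau> j<..\<tau> (Suc j)}" for i j
    using mono'[of "Suc i" j] that by auto
  then have "i = j" if "i < n" "j < n" "u \<in> {\<tau> i<..\<tau> (Suc i)}" "u \<in> {\<tau> j<..\<tau> (Suc j)}" for i j
    using that by (cases i j rule: linorder_cases) blast+
  ultimately show "\<forall>j<n. u \<notin> {\<tau> j<..\<tau> (Suc j)}" by blast
qed

lemma sum_at_single:
  fixes f :: "nat \<Rightarrow> 'c::comm_monoid_add"
  assumes "j < n" "\<And>i. i < n \<Longrightarrow> i \<noteq> j \<Longrightarrow> f i = 0"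
  shows "(\<Sum>i<n. f i) = f j"
  using assms by (subst sum.remove[of _ j]) (auto intro!: sum.neutral)

text \<open>The half-open cells are disjoint and contained in the interval, and on cell j the step
  function is the constant x j.\<close>

lemma step_function_nn_integral:
  fixes \<tau> :: "nat \<Rightarrow> real"
  assumes mono: "\<And>i. i < n \<Longrightarrow> \<tau> i \<le> \<tau> (Suc i)"
  shows "(\<Sum>j<n. ennreal ((x j - h)\<^sup>2) * ennreal (\<tau> (Suc j) - \<tau> j)) \<le>
    (\<integral>\<^sup>+u\<in>{\<tau> 0..\<tau> n}. ennreal (((\<Sum>j<n. x j * indicator {\<tau> j<..\<tau> (Suc j)} u) - h)\<^sup>2) \<partial>lborel)"
proof -
  have "(\<Sum>j<n. ennreal ((x j - h)\<^sup>2) * ennreal (\<tau> (Suc j) - \<tau> j)) =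
      (\<Sum>j<n. \<integral>\<^sup>+u. ennreal ((x j - h)\<^sup>2) * indicator {\<tau> j<..\<tau> (Suc j)} u \<partial>lborel)"
    by (intro sum.cong refl) (use mono in \<open>auto simp: nn_integral_cmult_indicator\<close>)
  also have "\<dots> = (\<integral>\<^sup>+u. (\<Sum>j<n. ennreal ((x j - h)\<^sup>2) * indicator {\<tau> j<..\<tau> (Suc j)} u) \<partial>lborel)"
    by (rule nn_integral_sum[symmetric]) auto
  also have "\<dots> \<le> (\<integral>\<^sup>+u\<in>{\<tau> 0..\<tau> n}. ennreal (((\<Sum>j<n. x j * indicator {\<tau> j<..\<tau> (Suc j)} u) - h)\<^sup>2) \<partial>lborel)"
  proof (rule nn_integral_mono)
    fix u
    consider "\<forall>j<n. u \<notin> {\<tau> j<..\<tau> (Suc j)}"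
      | j where "j < n" "u \<in> {\<tau> j<..\<tau> (Suc j)}" "\<forall>i<n. i \<noteq> j \<longrightarrow> u \<notin> {\<tau> i<..\<tau> (Suc i)}"
      using at_most_one_interval[of n \<tau> u] mono by blast
    then show "(\<Sum>j<n. ennreal ((x j - h)\<^sup>2) * indicator {\<tau> j<..\<tau> (Suc j)} u) \<le>
      ennreal (((\<Sum>j<n. x j * indicator {\<tau> j<..\<tau> (Suc j)} u) - h)\<^sup>2) * indicator {\<tau> 0..\<tau> n} u"
    proof cases
      case 1
      then have "(\<Sum>j<n. ennreal ((x j - h)\<^sup>2) * indicator {\<tau> j<..\<tau> (Suc j)} u) = 0"
        by (intro sum.neutral) auto
      then show ?thesis by simp
    next
      case (2 j)
      have "u \<in> {\<tau> 0..\<tau> n}"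
        using mono_grid[of n \<tau> 0 j] mono_grid[of n \<tau> "Suc j" n] mono 2 by force
      moreover have "(\<Sum>j<n. ennreal ((x j - h)\<^sup>2) * indicator {\<tau> j<..\<tau> (Suc j)} u) = ennreal ((x j - h)\<^sup>2)"
        using 2 by (subst sum_at_single[of j]) auto
      moreover have "(\<Sum>j<n. x j * indicator {\<tau> j<..\<tau> (Suc j)} u) = x j"
        using 2 by (subst sum_at_single[of j]) auto
      ultimately show ?thesis by simp
    qed
  qed
  finally show ?thesis .
qed

lemma sum_squared_le:
  fixes f :: "nat \<Rightarrow> real"
  shows "(\<Sum>i<n. f i)\<^sup>2 \<le> real n * (\<Sum>i<n. (f i)\<^sup>2)"
proof -
  have "\<bar>\<Sum>i<n. f i * 1\<bar> \<le> L2_set f {..<n} * L2_set (\<lambda>_. 1) {..<n}"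
    by (rule order_trans[OF sum_abs order_trans[OF _ L2_set_mult_ineq]]) (simp add: abs_mult)
  then have "(\<Sum>i<n. f i)\<^sup>2 \<le> (L2_set f {..<n} * L2_set (\<lambda>_. 1) {..<n})\<^sup>2"
    by (intro power2_le_iff_abs_le[THEN iffD2]) (auto simp: L2_set_nonneg)
  also have "\<dots> = real n * (\<Sum>i<n. (f i)\<^sup>2)"
    by (simp add: L2_set_def power_mult_distrib sum_nonneg)
  finally show ?thesis .
qed

lemma square_le_twice: "(x::real)\<^sup>2 \<le> 2 * (x - y)\<^sup>2 + 2 * y\<^sup>2"
proof -
  have "0 \<le> (x - 2 * y)\<^sup>2" by simp
  then show ?thesis by (simp add: power2_eq_square algebra_simps)
qed

context brownian
begin

text \<open>The Ito isometry for one step: \<eta>^2 and the squared increment are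
  independent.\<close>

lemma increment_isometry:
  assumes st: "a \<le> s" "s \<le> t" "t \<le> b" and \<eta>: "\<eta> \<in> borel_measurable (F s)"
    and bd: "\<And>\<omega>. \<omega> \<in> space M \<Longrightarrow> \<bar>\<eta> \<omega>\<bar> \<le> C"
  shows "(\<integral>\<^sup>+\<omega>. ennreal ((\<eta> \<omega> * (W t \<omega> - W s \<omega>))\<^sup>2) \<partial>M) = (\<integral>\<^sup>+\<omega>. ennreal ((\<eta> \<omega>)\<^sup>2) \<partial>M) * ennreal (t - s)"
proof -
  have \<eta>M: "\<eta> \<in> borel_measurable M" by (rule measurable_F_M[OF \<eta>]) (use st in auto)
  have \<eta>2: "integrable M (\<lambda>\<omega>. (\<eta> \<omega>)\<^sup>2)"
    using square_integrable_bounded_mult[OF \<eta>M _ bd, of "\<lambda>_. 1"] by simp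
  have iv: "indep_var borel (\<lambda>\<omega>. (\<eta> \<omega>)\<^sup>2) borel (\<lambda>\<omega>. (W t \<omega> - W s \<omega>)\<^sup>2)"
    using indep_var_compose[OF indep_increment[OF st \<eta>], of "\<lambda>x. x\<^sup>2" borel "\<lambda>x. x\<^sup>2" borel]
    by (simp add: comp_def)
  note m = increment_moments[OF st(2)]
  have i: "integrable M (\<lambda>\<omega>. (\<eta> \<omega>)\<^sup>2 * (W t \<omega> - W s \<omega>)\<^sup>2)"
    by (rule indep_var_integrable[OF iv \<eta>2 m(1)])
  have "(\<integral>\<^sup>+\<omega>. ennreal ((\<eta> \<omega> * (W t \<omega> - W s \<omega>))\<^sup>2) \<partial>M) = ennreal (expectation (\<lambda>\<omega>. (\<eta> \<omega>)\<^sup>2 * (W t \<omega> - W s \<omega>)\<^sup>2))"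
    unfolding power_mult_distrib by (rule nn_integral_eq_integral[OF i]) simp
  also have "\<dots> = ennreal (expectation (\<lambda>\<omega>. (\<eta> \<omega>)\<^sup>2) * (t - s))"
    using indep_var_lebesgue_integral[OF iv \<eta>2 m(1)] m(3) by simp
  also have "\<dots> = ennreal (expectation (\<lambda>\<omega>. (\<eta> \<omega>)\<^sup>2)) * ennreal (t - s)"
    using st by (intro ennreal_mult) auto
  also have "ennreal (expectation (\<lambda>\<omega>. (\<eta> \<omega>)\<^sup>2)) = (\<integral>\<^sup>+\<omega>. ennreal ((\<eta> \<omega>)\<^sup>2) \<partial>M)"
    by (rule nn_integral_eq_integral[OF \<eta>2, symmetric]) simp
  finally show ?thesis .
qed

text \<open>As increments telescope, h (W t - W s) is the simple integral of the constant h over the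
  same partition. Hence D is the simple integral of g (\<xi> - h), to which orthogonality and the
  one-step isometry apply.\<close>

lemma simple_integral_error:
  assumes st: "a \<le> s" "t \<le> b" and si: "simple_integrand F s t n \<tau> \<xi>"
    and h: "h \<in> borel_measurable (F s)" "\<And>\<omega>. \<omega> \<in> space M \<Longrightarrow> \<bar>h \<omega>\<bar> \<le> C"
    and g: "g \<in> borel_measurable (F s)" "\<And>\<omega>. \<omega> \<in> space M \<Longrightarrow> \<bar>g \<omega>\<bar> \<le> C"
  defines "D \<equiv> \<lambda>\<omega>. g \<omega> * (simple_ito_integral W n \<tau> \<xi> \<omega> - h \<omega> * (W t \<omega> - W s \<omega>))"
  shows "mdiff s t D"
    and "(\<integral>\<^sup>+\<omega>. ennreal ((D \<omega>)\<^sup>2) \<partial>M) \<le> (\<integral>\<^sup>+\<omega>. ennreal ((g \<omega>)\<^sup>2) *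
      (\<integral>\<^sup>+u\<in>{s..t}. ennreal ((simple_process n \<tau> \<xi> u \<omega> - h \<omega>)\<^sup>2) \<partial>lborel) \<partial>M)"
proof -
  have \<tau>: "\<tau> 0 = s" "\<tau> n = t" "\<And>i. i < n \<Longrightarrow> \<tau> i \<le> \<tau> (Suc i)"
    using si unfolding simple_integrand_def by auto
  have \<tau>b: "s \<le> \<tau> i" "\<tau> i \<le> t" if "i \<le> n" for i
    using mono_grid[of n \<tau> 0 i] mono_grid[of n \<tau> i n] \<tau> that by auto
  have \<tau>r: "a \<le> \<tau> i" "\<tau> i \<le> b" if "i \<le> n" for i
    using \<tau>b[OF that] st by auto
  define \<eta> where "\<eta> j \<omega> = g \<omega> * (\<xi> j \<omega> - h \<omega>)" for j \<omega>
  define E where "E j \<omega> = \<eta> j \<omega> * (W (\<tau> (Suc j)) \<omega> - W (\<tau> j) \<omega>)" for j \<omega>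
  have \<xi>m: "\<xi> i \<in> borel_measurable (F (\<tau> i))" if "i < n" for i
    using si that unfolding simple_integrand_def by auto
  have \<eta>m: "\<eta> i \<in> borel_measurable (F (\<tau> i))" if "i < n" for i
  proof -
    have [measurable]: "\<xi> i \<in> borel_measurable (F (\<tau> i))" "h \<in> borel_measurable (F (\<tau> i))" "g \<in> borel_measurable (F (\<tau> i))"
      using \<xi>m[OF that] measurable_F_mono[OF h(1) \<tau>b(1)] measurable_F_mono[OF g(1) \<tau>b(1)] that by auto
    show ?thesis unfolding \<eta>_def by measurable
  qed
  have \<eta>b: "\<exists>K. \<forall>\<omega>\<in>space M. \<bar>\<eta> i \<omega>\<bar> \<le> K" if i: "i < n" for i
  proof -
    obtain K where K: "\<And>\<omega>. \<omega> \<in> space M \<Longrightarrow> \<bar>\<xi> i \<omega>\<bar> \<le> K"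
      using si i unfolding simple_integrand_def space_F by blast
    have "\<bar>\<eta> i \<omega>\<bar> \<le> C * (K + C)" if "\<omega> \<in> space M" for \<omega>
      unfolding \<eta>_def abs_mult
    proof (rule mult_mono)
      show "\<bar>g \<omega>\<bar> \<le> C" by (rule g(2)[OF that])
      then show "0 \<le> C" using abs_ge_zero order_trans by blast
      show "\<bar>\<xi> i \<omega> - h \<omega>\<bar> \<le> K + C" using K[OF that] h(2)[OF that] by linarith
    qed simp
    then show ?thesis by blast
  qed
  have Dm: "mdiff (\<tau> i) (\<tau> (Suc i)) (E i)" if i: "i < n" for i
  proof -
    obtain K where K: "\<And>\<omega>. \<omega> \<in> space M \<Longrightarrow> \<bar>\<eta> i \<omega>\<bar> \<le> K" using \<eta>b[OF i] by blast
    have b: "a \<le> \<tau> i" "\<tau> i \<le> \<tau> (Suc i)" "\<tau> (Suc i) \<le> b" using \<tau>r[of i] \<tau>r[of "Suc i"] \<tau>(3)[OF i] i by auto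
    show ?thesis unfolding E_def
      by (rule mdiff_scale[OF b mdiff_increment[OF b] \<eta>m[OF i] K])
  qed
  have tel: "(\<Sum>j<n. W (\<tau> (Suc j)) \<omega> - W (\<tau> j) \<omega>) = W t \<omega> - W s \<omega>" for \<omega>
    using sum_lessThan_telescope[of "\<lambda>j. W (\<tau> j) \<omega>" n] \<tau> by simp
  have DE: "D = (\<lambda>\<omega>. \<Sum>j<n. E j \<omega>)"
  proof
    fix \<omega>
    have "(\<Sum>j<n. E j \<omega>) = g \<omega> * (\<Sum>j<n. \<xi> j \<omega> * (W (\<tau> (Suc j)) \<omega> - W (\<tau> j) \<omega>)
        - h \<omega> * (W (\<tau> (Suc j)) \<omega> - W (\<tau> j) \<omega>))"
      unfolding sum_distrib_left E_def \<eta>_def by (intro sum.cong refl) (simp add: algebra_simps)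
    then show "D \<omega> = (\<Sum>j<n. E j \<omega>)"
      unfolding D_def simple_ito_integral_def tel[symmetric] by (simp only: sum_subtractf sum_distrib_left[symmetric])
  qed
  have "mdiff (\<tau> 0) (\<tau> n) (\<lambda>\<omega>. \<Sum>i<n. E i \<omega>)"
    using mdiff_sum[where D = E and T = \<tau> and n = n] Dm \<tau> st by simp
  then show "mdiff s t D" unfolding DE \<tau> .
  have "(\<integral>\<^sup>+\<omega>. ennreal ((D \<omega>)\<^sup>2) \<partial>M) = (\<Sum>j<n. \<integral>\<^sup>+\<omega>. ennreal ((E j \<omega>)\<^sup>2) \<partial>M)"
    unfolding DE using mdiff_sum_nn[where D = E and T = \<tau> and n = n] Dm \<tau> st by simp
  also have "\<dots> = (\<Sum>j<n. (\<integral>\<^sup>+\<omega>. ennreal ((\<eta> j \<omega>)\<^sup>2) \<partial>M) * ennreal (\<tau> (Suc j) - \<tau> j))"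
  proof (rule sum.cong[OF refl])
    fix j assume "j \<in> {..<n}"
    then have j: "j < n" by simp
    obtain K where K: "\<And>\<omega>. \<omega> \<in> space M \<Longrightarrow> \<bar>\<eta> j \<omega>\<bar> \<le> K" using \<eta>b[OF j] by blast
    show "(\<integral>\<^sup>+\<omega>. ennreal ((E j \<omega>)\<^sup>2) \<partial>M) = (\<integral>\<^sup>+\<omega>. ennreal ((\<eta> j \<omega>)\<^sup>2) \<partial>M) * ennreal (\<tau> (Suc j) - \<tau> j)"
      unfolding E_def
      by (rule increment_isometry[OF _ _ _ \<eta>m[OF j] K]) (use \<tau>r[of j] \<tau>r[of "Suc j"] \<tau>(3)[OF j] j in auto)
  qed
  also have "\<dots> = (\<integral>\<^sup>+\<omega>. (\<Sum>j<n. ennreal ((\<eta> j \<omega>)\<^sup>2) * ennreal (\<tau> (Suc j) - \<tau> j)) \<partial>M)"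
  proof -
    have [measurable]: "\<eta> j \<in> borel_measurable M" if "j < n" for j
      by (rule measurable_F_M[OF \<eta>m[OF that]]) (use \<tau>r[of j] that in auto)
    show ?thesis
      by (subst nn_integral_sum) (auto simp: nn_integral_multc)
  qed
  also have "\<dots> \<le> (\<integral>\<^sup>+\<omega>. ennreal ((g \<omega>)\<^sup>2) *
      (\<integral>\<^sup>+u\<in>{s..t}. ennreal ((simple_process n \<tau> \<xi> u \<omega> - h \<omega>)\<^sup>2) \<partial>lborel) \<partial>M)"
  proof (rule nn_integral_mono)
    fix \<omega>
    have "(\<Sum>j<n. ennreal ((\<eta> j \<omega>)\<^sup>2) * ennreal (\<tau> (Suc j) - \<tau> j))
       = ennreal ((g \<omega>)\<^sup>2) * (\<Sum>j<n. ennreal ((\<xi> j \<omega> - h \<omega>)\<^sup>2) * ennreal (\<tau> (Suc j) - \<tau> j))"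
      unfolding sum_distrib_left \<eta>_def
      by (intro sum.cong refl) (simp add: power_mult_distrib ennreal_mult mult_ac)
    also have "\<dots> \<le> ennreal ((g \<omega>)\<^sup>2) * (\<integral>\<^sup>+u\<in>{s..t}. ennreal ((simple_process n \<tau> \<xi> u \<omega> - h \<omega>)\<^sup>2) \<partial>lborel)"
      using step_function_nn_integral[of n \<tau> "\<lambda>j. \<xi> j \<omega>" "h \<omega>", OF \<tau>(3)]
      unfolding simple_process_def \<tau>(1,2) by (rule mult_left_mono) simp_all
    finally show "(\<Sum>j<n. ennreal ((\<eta> j \<omega>)\<^sup>2) * ennreal (\<tau> (Suc j) - \<tau> j)) \<le> ennreal ((g \<omega>)\<^sup>2) *
      (\<integral>\<^sup>+u\<in>{s..t}. ennreal ((simple_process n \<tau> \<xi> u \<omega> - h \<omega>)\<^sup>2) \<partial>lborel)" .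
  qed
  finally show "(\<integral>\<^sup>+\<omega>. ennreal ((D \<omega>)\<^sup>2) \<partial>M) \<le> (\<integral>\<^sup>+\<omega>. ennreal ((g \<omega>)\<^sup>2) *
      (\<integral>\<^sup>+u\<in>{s..t}. ennreal ((simple_process n \<tau> \<xi> u \<omega> - h \<omega>)\<^sup>2) \<partial>lborel) \<partial>M)" .
qed

end

lemma nn_integral_triangle_sq:
  fixes X Y :: "'u \<Rightarrow> real"
  assumes [measurable]: "X \<in> borel_measurable N" "Y \<in> borel_measurable N"
  shows "(\<integral>\<^sup>+x. ennreal ((X x)\<^sup>2) \<partial>N) \<le> 2 * (\<integral>\<^sup>+x. ennreal ((X x - Y x)\<^sup>2) \<partial>N) + 2 * (\<integral>\<^sup>+x. ennreal ((Y x)\<^sup>2) \<partial>N)"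
proof -
  have "(\<integral>\<^sup>+x. ennreal ((X x)\<^sup>2) \<partial>N) \<le> (\<integral>\<^sup>+x. (2 * ennreal ((X x - Y x)\<^sup>2) + 2 * ennreal ((Y x)\<^sup>2)) \<partial>N)"
  proof (rule nn_integral_mono)
    fix x
    have "ennreal ((X x)\<^sup>2) \<le> ennreal (2 * (X x - Y x)\<^sup>2 + 2 * (Y x)\<^sup>2)"
      by (rule ennreal_leI[OF square_le_twice])
    also have "\<dots> = 2 * ennreal ((X x - Y x)\<^sup>2) + 2 * ennreal ((Y x)\<^sup>2)"
      by (simp add: ennreal_plus ennreal_mult)
    finally show "ennreal ((X x)\<^sup>2) \<le> 2 * ennreal ((X x - Y x)\<^sup>2) + 2 * ennreal ((Y x)\<^sup>2)" .
  qed
  also have "\<dots> = 2 * (\<integral>\<^sup>+x. ennreal ((X x - Y x)\<^sup>2) \<partial>N) + 2 * (\<integral>\<^sup>+x. ennreal ((Y x)\<^sup>2) \<partial>N)"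
    by (simp add: nn_integral_add nn_integral_cmult)
  finally show ?thesis .
qed

context brownian
begin

lemma simple_process_joint_measurable:
  assumes "\<And>i. i < n \<Longrightarrow> \<xi> i \<in> borel_measurable M"
  shows "(\<lambda>(u, \<omega>). simple_process n \<tau> \<xi> u \<omega>) \<in> borel_measurable (lborel \<Otimes>\<^sub>M M)"
proof -
  have [measurable]: "\<xi> i \<in> borel_measurable M" if "i \<in> {..<n}" for i using assms that by auto
  show ?thesis unfolding simple_process_def by measurable
qed

text \<open>From (S - h)^2 \<le> 2 (S - H)^2 + 2 (H - h)^2. The weight g is estimated by its bound
  only in the term that will tend to 0; in the other it must be kept, because it suppresses the
  error on paths that have already left the localization interval.\<close>

lemma simple_vs_integrand:
  assumes st: "a \<le> s" "s \<le> t" "t \<le> b" and si: "simple_integrand F s t n \<tau> \<xi>"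
    and H: "(\<lambda>(u, \<omega>). H u \<omega>) \<in> borel_measurable (restrict_space borel {s..t} \<Otimes>\<^sub>M M)"
    and h: "h \<in> borel_measurable M" and g: "g \<in> borel_measurable M" "\<And>\<omega>. \<omega> \<in> space M \<Longrightarrow> \<bar>g \<omega>\<bar> \<le> C"
  shows "(\<integral>\<^sup>+\<omega>. ennreal ((g \<omega>)\<^sup>2) * (\<integral>\<^sup>+u\<in>{s..t}. ennreal ((simple_process n \<tau> \<xi> u \<omega> - h \<omega>)\<^sup>2) \<partial>lborel) \<partial>M)
    \<le> ennreal (2 * C\<^sup>2) * (\<integral>\<^sup>+\<omega>. (\<integral>\<^sup>+u\<in>{s..t}. ennreal ((simple_process n \<tau> \<xi> u \<omega> - H u \<omega>)\<^sup>2) \<partial>lborel) \<partial>M)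
      + 2 * (\<integral>\<^sup>+\<omega>. ennreal ((g \<omega>)\<^sup>2) * (\<integral>\<^sup>+u\<in>{s..t}. ennreal ((H u \<omega> - h \<omega>)\<^sup>2) \<partial>lborel) \<partial>M)"
proof -
  note [measurable] = h g(1)
  have \<tau>: "\<tau> 0 = s" "\<tau> n = t" "\<And>i. i < n \<Longrightarrow> \<tau> i \<le> \<tau> (Suc i)"
    using si unfolding simple_integrand_def by auto
  have \<tau>b: "a \<le> \<tau> i" "\<tau> i \<le> b" if "i \<le> n" for i
    using mono_grid[of n \<tau> 0 i] mono_grid[of n \<tau> i n] \<tau> that st by auto
  have \<xi>: "\<xi> i \<in> borel_measurable M" if "i < n" for i
    by (rule measurable_F_M[of _ "\<tau> i"]) (use si that \<tau>b[of i] in \<open>auto simp: simple_integrand_def\<close>)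
  let ?S = "simple_process n \<tau> \<xi>"
  define K where "K u \<omega> = (if u \<in> {s..t} then H u \<omega> else 0)" for u \<omega>
  have S[measurable]: "(\<lambda>(u, \<omega>). ?S u \<omega>) \<in> borel_measurable (lborel \<Otimes>\<^sub>M M)"
    by (rule simple_process_joint_measurable[OF \<xi>])
  have "(\<lambda>(u, \<omega>). K u \<omega>) \<in> borel_measurable (borel \<Otimes>\<^sub>M M)"
    unfolding K_def by (rule measurable_pair_restrict_extend[OF _ H]) simp
  then have K[measurable]: "(\<lambda>(u, \<omega>). K u \<omega>) \<in> borel_measurable (lborel \<Otimes>\<^sub>M M)"
    by (simp cong: measurable_cong_sets add: measurable_lborel1)
  have swap: "(\<lambda>(\<omega>, u). f u \<omega>) \<in> borel_measurable (M \<Otimes>\<^sub>M lborel)"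
    if "(\<lambda>(u, \<omega>). f u \<omega>) \<in> borel_measurable (lborel \<Otimes>\<^sub>M M)" for f :: "real \<Rightarrow> 'w \<Rightarrow> real"
    using measurable_pair_swap[OF that] by (simp add: case_prod_beta')
  have [measurable]: "(\<lambda>(\<omega>, u). ?S u \<omega>) \<in> borel_measurable (M \<Otimes>\<^sub>M lborel)"
    "(\<lambda>(\<omega>, u). K u \<omega>) \<in> borel_measurable (M \<Otimes>\<^sub>M lborel)"
    using swap[OF S] swap[OF K] by auto
  have HK: "(\<integral>\<^sup>+u\<in>{s..t}. ennreal ((\<phi> u (H u \<omega>))\<^sup>2) \<partial>lborel) = (\<integral>\<^sup>+u\<in>{s..t}. ennreal ((\<phi> u (K u \<omega>))\<^sup>2) \<partial>lborel)"
    for \<omega> and \<phi> :: "real \<Rightarrow> real \<Rightarrow> real"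
    by (rule nn_integral_cong) (auto simp: K_def indicator_def)
  have m1: "(\<lambda>\<omega>. \<integral>\<^sup>+u\<in>{s..t}. ennreal ((?S u \<omega> - K u \<omega>)\<^sup>2) \<partial>lborel) \<in> borel_measurable M"
    by measurable
  have m2: "(\<lambda>\<omega>. \<integral>\<^sup>+u\<in>{s..t}. ennreal ((K u \<omega> - h \<omega>)\<^sup>2) \<partial>lborel) \<in> borel_measurable M"
    by measurable
  have pt: "(\<integral>\<^sup>+u\<in>{s..t}. ennreal ((?S u \<omega> - h \<omega>)\<^sup>2) \<partial>lborel) \<le>
      2 * (\<integral>\<^sup>+u\<in>{s..t}. ennreal ((?S u \<omega> - K u \<omega>)\<^sup>2) \<partial>lborel) + 2 * (\<integral>\<^sup>+u\<in>{s..t}. ennreal ((K u \<omega> - h \<omega>)\<^sup>2) \<partial>lborel)"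
    if \<omega>: "\<omega> \<in> space M" for \<omega>
  proof -
    have [measurable]: "(\<lambda>u. ?S u \<omega>) \<in> borel_measurable lborel" "(\<lambda>u. K u \<omega>) \<in> borel_measurable lborel"
      using measurable_compose[OF measurable_Pair1'[OF \<omega>] S[THEN swap]]
            measurable_compose[OF measurable_Pair1'[OF \<omega>] K[THEN swap]] by (simp_all add: measurable_lborel1)
    have ind: "(\<integral>\<^sup>+u\<in>{s..t}. ennreal ((\<phi> u)\<^sup>2) \<partial>lborel) = (\<integral>\<^sup>+u. ennreal ((\<phi> u * indicator {s..t} u)\<^sup>2) \<partial>lborel)"
      for \<phi> :: "real \<Rightarrow> real"
      by (rule nn_integral_cong) (auto simp: indicator_def)
    have "(\<integral>\<^sup>+u. ennreal (((?S u \<omega> - h \<omega>) * indicator {s..t} u)\<^sup>2) \<partial>lborel) \<le>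
       2 * (\<integral>\<^sup>+u. ennreal (((?S u \<omega> - h \<omega>) * indicator {s..t} u - (K u \<omega> - h \<omega>) * indicator {s..t} u)\<^sup>2) \<partial>lborel)
       + 2 * (\<integral>\<^sup>+u. ennreal (((K u \<omega> - h \<omega>) * indicator {s..t} u)\<^sup>2) \<partial>lborel)"
      by (rule nn_integral_triangle_sq) measurable
    then show ?thesis unfolding ind by (simp add: left_diff_distrib[symmetric])
  qed
  have "(\<integral>\<^sup>+\<omega>. ennreal ((g \<omega>)\<^sup>2) * (\<integral>\<^sup>+u\<in>{s..t}. ennreal ((?S u \<omega> - h \<omega>)\<^sup>2) \<partial>lborel) \<partial>M)
    \<le> (\<integral>\<^sup>+\<omega>. ennreal (2 * C\<^sup>2) * (\<integral>\<^sup>+u\<in>{s..t}. ennreal ((?S u \<omega> - K u \<omega>)\<^sup>2) \<partial>lborel)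
        + 2 * (ennreal ((g \<omega>)\<^sup>2) * (\<integral>\<^sup>+u\<in>{s..t}. ennreal ((K u \<omega> - h \<omega>)\<^sup>2) \<partial>lborel)) \<partial>M)"
  proof (rule nn_integral_mono)
    fix \<omega> assume \<omega>: "\<omega> \<in> space M"
    let ?A = "\<integral>\<^sup>+u\<in>{s..t}. ennreal ((?S u \<omega> - K u \<omega>)\<^sup>2) \<partial>lborel"
    let ?B = "\<integral>\<^sup>+u\<in>{s..t}. ennreal ((K u \<omega> - h \<omega>)\<^sup>2) \<partial>lborel"
    have gC: "ennreal ((g \<omega>)\<^sup>2) \<le> ennreal (C\<^sup>2)"
      using g(2)[OF \<omega>] by (intro ennreal_leI) (meson abs_le_square_iff abs_ge_self order_trans)
    have "ennreal ((g \<omega>)\<^sup>2) * (\<integral>\<^sup>+u\<in>{s..t}. ennreal ((?S u \<omega> - h \<omega>)\<^sup>2) \<partial>lborel)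
        \<le> ennreal ((g \<omega>)\<^sup>2) * (2 * ?A + 2 * ?B)"
      by (rule mult_left_mono[OF pt[OF \<omega>]]) simp
    also have "\<dots> = ennreal ((g \<omega>)\<^sup>2) * (2 * ?A) + 2 * (ennreal ((g \<omega>)\<^sup>2) * ?B)"
      by (simp add: distrib_left mult_ac)
    also have "\<dots> \<le> ennreal (C\<^sup>2) * (2 * ?A) + 2 * (ennreal ((g \<omega>)\<^sup>2) * ?B)"
      by (intro add_mono mult_right_mono gC) auto
    also have "ennreal (C\<^sup>2) * (2 * ?A) = ennreal (2 * C\<^sup>2) * ?A"
      by (simp add: ennreal_mult mult_ac)
    finally show "ennreal ((g \<omega>)\<^sup>2) * (\<integral>\<^sup>+u\<in>{s..t}. ennreal ((?S u \<omega> - h \<omega>)\<^sup>2) \<partial>lborel)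
        \<le> ennreal (2 * C\<^sup>2) * ?A + 2 * (ennreal ((g \<omega>)\<^sup>2) * ?B)" .
  qed
  also have "\<dots> = ennreal (2 * C\<^sup>2) * (\<integral>\<^sup>+\<omega>. (\<integral>\<^sup>+u\<in>{s..t}. ennreal ((?S u \<omega> - K u \<omega>)\<^sup>2) \<partial>lborel) \<partial>M)
      + 2 * (\<integral>\<^sup>+\<omega>. ennreal ((g \<omega>)\<^sup>2) * (\<integral>\<^sup>+u\<in>{s..t}. ennreal ((K u \<omega> - h \<omega>)\<^sup>2) \<partial>lborel) \<partial>M)"
    using m1 m2 by (simp add: nn_integral_add nn_integral_cmult)
  finally show ?thesis
    using HK[of "\<lambda>u x. ?S u _ - x"] HK[of "\<lambda>u x. x - h _"] by simp
qed

text \<open>The errors of the simple approximations are martingale differences, so their second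
  moments add without a factor n. The final 4 is 2 times 2: one factor for replacing E by D, one for
  replacing the simple process by H.\<close>

lemma ito_integral_freezing_error:
  assumes T: "\<And>i. i < n \<Longrightarrow> T i \<le> T (Suc i)" "a \<le> T 0" "T n \<le> b"
    and I: "\<And>i. i < n \<Longrightarrow> has_ito_integral M F W (T i) (T (Suc i)) (H i) (I i)"
    and h: "\<And>i. i < n \<Longrightarrow> h i \<in> borel_measurable (F (T i))" "\<And>i \<omega>. i < n \<Longrightarrow> \<omega> \<in> space M \<Longrightarrow> \<bar>h i \<omega>\<bar> \<le> C"
    and g: "\<And>i. i < n \<Longrightarrow> g i \<in> borel_measurable (F (T i))" "\<And>i \<omega>. i < n \<Longrightarrow> \<omega> \<in> space M \<Longrightarrow> \<bar>g i \<omega>\<bar> \<le> C"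
  shows "(\<integral>\<^sup>+\<omega>. ennreal ((\<Sum>i<n. g i \<omega> * (I i \<omega> - h i \<omega> * (W (T (Suc i)) \<omega> - W (T i) \<omega>)))\<^sup>2) \<partial>M)
    \<le> 4 * (\<Sum>i<n. \<integral>\<^sup>+\<omega>. ennreal ((g i \<omega>)\<^sup>2) *
        (\<integral>\<^sup>+u\<in>{T i..T (Suc i)}. ennreal ((H i u \<omega> - h i \<omega>)\<^sup>2) \<partial>lborel) \<partial>M)"
proof -
  have Tb: "a \<le> T i" "T i \<le> b" if "i \<le> n" for i
    using mono_grid[of n T 0 i] mono_grid[of n T i n] T that by force+
  define P where "P i N \<tau> \<xi> \<longleftrightarrow>
        (\<forall>k. simple_integrand F (T i) (T (Suc i)) (N k) (\<tau> k) (\<xi> k)) \<and>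
        (\<lambda>k. \<integral>\<^sup>+\<omega>. (\<integral>\<^sup>+u\<in>{T i..T (Suc i)}. ennreal ((simple_process (N k) (\<tau> k) (\<xi> k) u \<omega> - H i u \<omega>)\<^sup>2)
              \<partial>lborel) \<partial>M) \<longlonglongrightarrow> 0 \<and>
        (\<lambda>k. \<integral>\<^sup>+\<omega>. ennreal ((simple_ito_integral W (N k) (\<tau> k) (\<xi> k) \<omega> - I i \<omega>)\<^sup>2) \<partial>M)
          \<longlonglongrightarrow> 0" for i N \<tau> \<xi>
  have "\<exists>N \<tau> \<xi>. P i N \<tau> \<xi>" if "i < n" for i
    using I[OF that] unfolding has_ito_integral_def P_def by blast
  then obtain N \<tau> \<xi> where P: "\<And>i. i < n \<Longrightarrow> P i (N i) (\<tau> i) (\<xi> i)" by metis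
  have si: "\<And>i k. i < n \<Longrightarrow> simple_integrand F (T i) (T (Suc i)) (N i k) (\<tau> i k) (\<xi> i k)"
    and c1: "\<And>i. i < n \<Longrightarrow> (\<lambda>k. \<integral>\<^sup>+\<omega>. (\<integral>\<^sup>+u\<in>{T i..T (Suc i)}. ennreal ((simple_process (N i k) (\<tau> i k) (\<xi> i k) u \<omega> - H i u \<omega>)\<^sup>2)
              \<partial>lborel) \<partial>M) \<longlonglongrightarrow> 0"
    and c2: "\<And>i. i < n \<Longrightarrow> (\<lambda>k. \<integral>\<^sup>+\<omega>. ennreal ((simple_ito_integral W (N i k) (\<tau> i k) (\<xi> i k) \<omega> - I i \<omega>)\<^sup>2) \<partial>M)
          \<longlonglongrightarrow> 0"
    using P unfolding P_def by simp_all
  define S where "S i k = simple_ito_integral W (N i k) (\<tau> i k) (\<xi> i k)" for i k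
  define D where "D k i \<omega> = g i \<omega> * (S i k \<omega> - h i \<omega> * (W (T (Suc i)) \<omega> - W (T i) \<omega>))" for k i \<omega>
  define E where "E i \<omega> = g i \<omega> * (I i \<omega> - h i \<omega> * (W (T (Suc i)) \<omega> - W (T i) \<omega>))" for i \<omega>
  define A where "A i = (\<integral>\<^sup>+\<omega>. ennreal ((g i \<omega>)\<^sup>2) *
        (\<integral>\<^sup>+u\<in>{T i..T (Suc i)}. ennreal ((H i u \<omega> - h i \<omega>)\<^sup>2) \<partial>lborel) \<partial>M)" for i
  define p where "p i k = (\<integral>\<^sup>+\<omega>. (\<integral>\<^sup>+u\<in>{T i..T (Suc i)}. ennreal ((simple_process (N i k) (\<tau> i k) (\<xi> i k) u \<omega> - H i u \<omega>)\<^sup>2)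
              \<partial>lborel) \<partial>M)" for i k
  define q where "q i k = (\<integral>\<^sup>+\<omega>. ennreal ((S i k \<omega> - I i \<omega>)\<^sup>2) \<partial>M)" for i k
  have gM: "g i \<in> borel_measurable M" if "i < n" for i
    by (rule measurable_F_M[OF g(1)[OF that]]) (use Tb[of i] that in auto)
  have hM: "h i \<in> borel_measurable M" if "i < n" for i
    by (rule measurable_F_M[OF h(1)[OF that]]) (use Tb[of i] that in auto)
  have IM: "I i \<in> borel_measurable M" if "i < n" for i
    using I[OF that] by (auto simp: has_ito_integral_def)
  have Dm: "mdiff (T i) (T (Suc i)) (D k i)" and
    D2: "(\<integral>\<^sup>+\<omega>. ennreal ((D k i \<omega>)\<^sup>2) \<partial>M) \<le> ennreal (2 * C\<^sup>2) * p i k + 2 * A i" if i: "i < n" for i k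
  proof -
    have b: "a \<le> T i" "T i \<le> T (Suc i)" "T (Suc i) \<le> b" using Tb[of i] Tb[of "Suc i"] T(1)[OF i] i by auto
    show "mdiff (T i) (T (Suc i)) (D k i)"
      unfolding D_def S_def by (rule simple_integral_error(1)[OF b(1,3) si[OF i] h(1)[OF i] h(2)[OF i] g(1)[OF i] g(2)[OF i]])
    have "(\<integral>\<^sup>+\<omega>. ennreal ((D k i \<omega>)\<^sup>2) \<partial>M) \<le> (\<integral>\<^sup>+\<omega>. ennreal ((g i \<omega>)\<^sup>2) *
      (\<integral>\<^sup>+u\<in>{T i..T (Suc i)}. ennreal ((simple_process (N i k) (\<tau> i k) (\<xi> i k) u \<omega> - h i \<omega>)\<^sup>2) \<partial>lborel) \<partial>M)"
      unfolding D_def S_def by (rule simple_integral_error(2)[OF b(1,3) si[OF i] h(1)[OF i] h(2)[OF i] g(1)[OF i] g(2)[OF i]])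
    also have "\<dots> \<le> ennreal (2 * C\<^sup>2) * p i k + 2 * A i"
      unfolding p_def A_def
      by (rule simple_vs_integrand[OF b si[OF i] _ hM[OF i] gM[OF i] g(2)[OF i]])
        (use I[OF i] in \<open>auto simp: has_ito_integral_def\<close>)
    finally show "(\<integral>\<^sup>+\<omega>. ennreal ((D k i \<omega>)\<^sup>2) \<partial>M) \<le> ennreal (2 * C\<^sup>2) * p i k + 2 * A i" .
  qed
  have DM[measurable]: "D k i \<in> borel_measurable M" if "i < n" for i k
    by (rule measurable_F_M[of _ "T (Suc i)"]) (use Dm[OF that, of k] Tb[of "Suc i"] that in \<open>auto simp: mdiff_def\<close>)
  have EM[measurable]: "E i \<in> borel_measurable M" if "i < n" for i
    unfolding E_def using gM[OF that] hM[OF that] IM[OF that] by measurable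
  have SM: "S i k \<in> borel_measurable M" if i: "i < n" for i k
  proof -
    have "\<xi> i k j \<in> borel_measurable M" if j: "j < N i k" for j
    proof (rule measurable_F_M[of _ "\<tau> i k j"])
      show "\<xi> i k j \<in> borel_measurable (F (\<tau> i k j))" using si[OF i] j by (auto simp: simple_integrand_def)
      have \<tau>: "\<tau> i k 0 = T i" "\<tau> i k (N i k) = T (Suc i)" "\<And>j. j < N i k \<Longrightarrow> \<tau> i k j \<le> \<tau> i k (Suc j)"
        using si[OF i, of k] unfolding simple_integrand_def by auto
      show "\<tau> i k j \<in> {a..b}"
        using mono_grid[of "N i k" "\<tau> i k" 0 j] mono_grid[of "N i k" "\<tau> i k" j "N i k"] \<tau> j Tb[of i] Tb[of "Suc i"] i by force
    qed
    then show ?thesis unfolding S_def simple_ito_integral_def by (intro borel_measurable_sum borel_measurable_times) auto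
  qed
  \<comment> \<open>Replacing E by D uses Cauchy-Schwarz and costs a factor n, which is harmless
    because n is fixed while \<open>q i k\<close> tends to 0 in k.\<close>
  have bound: "(\<integral>\<^sup>+\<omega>. ennreal ((\<Sum>i<n. E i \<omega>)\<^sup>2) \<partial>M)
     \<le> 2 * (ennreal (real n) * (\<Sum>i<n. ennreal (C\<^sup>2) * q i k)) + 2 * (\<Sum>i<n. ennreal (2 * C\<^sup>2) * p i k + 2 * A i)" for k
  proof -
    have "(\<integral>\<^sup>+\<omega>. ennreal ((\<Sum>i<n. E i \<omega>)\<^sup>2) \<partial>M)
      \<le> 2 * (\<integral>\<^sup>+\<omega>. ennreal (((\<Sum>i<n. E i \<omega>) - (\<Sum>i<n. D k i \<omega>))\<^sup>2) \<partial>M) + 2 * (\<integral>\<^sup>+\<omega>. ennreal ((\<Sum>i<n. D k i \<omega>)\<^sup>2) \<partial>M)"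
      by (rule nn_integral_triangle_sq) measurable
    also have "(\<integral>\<^sup>+\<omega>. ennreal (((\<Sum>i<n. E i \<omega>) - (\<Sum>i<n. D k i \<omega>))\<^sup>2) \<partial>M)
      \<le> (\<integral>\<^sup>+\<omega>. ennreal (real n) * (\<Sum>i<n. ennreal (C\<^sup>2) * ennreal ((S i k \<omega> - I i \<omega>)\<^sup>2)) \<partial>M)"
    proof (rule nn_integral_mono)
      fix \<omega> assume \<omega>: "\<omega> \<in> space M"
      have "((\<Sum>i<n. E i \<omega>) - (\<Sum>i<n. D k i \<omega>))\<^sup>2 = (\<Sum>i<n. E i \<omega> - D k i \<omega>)\<^sup>2"
        by (simp add: sum_subtractf)
      also have "\<dots> \<le> real n * (\<Sum>i<n. (E i \<omega> - D k i \<omega>)\<^sup>2)" by (rule sum_squared_le)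
      also have "\<dots> \<le> real n * (\<Sum>i<n. C\<^sup>2 * (S i k \<omega> - I i \<omega>)\<^sup>2)"
      proof (intro mult_left_mono sum_mono)
        fix i assume "i \<in> {..<n}"
        then have "\<bar>g i \<omega>\<bar> \<le> C" using g(2) \<omega> by auto
        then have "(g i \<omega>)\<^sup>2 \<le> C\<^sup>2" by (meson abs_le_square_iff abs_ge_self order_trans)
        moreover have "(E i \<omega> - D k i \<omega>)\<^sup>2 = (g i \<omega>)\<^sup>2 * (S i k \<omega> - I i \<omega>)\<^sup>2"
          unfolding E_def D_def by (simp add: power_mult_distrib[symmetric] algebra_simps power2_eq_square)
        ultimately show "(E i \<omega> - D k i \<omega>)\<^sup>2 \<le> C\<^sup>2 * (S i k \<omega> - I i \<omega>)\<^sup>2" by (simp add: mult_right_mono)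
      qed simp
      finally have "ennreal (((\<Sum>i<n. E i \<omega>) - (\<Sum>i<n. D k i \<omega>))\<^sup>2) \<le> ennreal (real n * (\<Sum>i<n. C\<^sup>2 * (S i k \<omega> - I i \<omega>)\<^sup>2))"
        by (rule ennreal_leI)
      also have "\<dots> = ennreal (real n) * (\<Sum>i<n. ennreal (C\<^sup>2) * ennreal ((S i k \<omega> - I i \<omega>)\<^sup>2))"
        by (simp add: ennreal_mult sum_nonneg sum_ennreal[symmetric])
      finally show "ennreal (((\<Sum>i<n. E i \<omega>) - (\<Sum>i<n. D k i \<omega>))\<^sup>2)
        \<le> ennreal (real n) * (\<Sum>i<n. ennreal (C\<^sup>2) * ennreal ((S i k \<omega> - I i \<omega>)\<^sup>2))" .
    qed
    also have "\<dots> = ennreal (real n) * (\<Sum>i<n. ennreal (C\<^sup>2) * q i k)"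
    proof -
      have [measurable]: "S i k \<in> borel_measurable M" "I i \<in> borel_measurable M" if "i < n" for i
        using SM IM that by auto
      have "(\<integral>\<^sup>+\<omega>. ennreal (real n) * (\<Sum>i<n. ennreal (C\<^sup>2) * ennreal ((S i k \<omega> - I i \<omega>)\<^sup>2)) \<partial>M)
          = ennreal (real n) * (\<integral>\<^sup>+\<omega>. (\<Sum>i<n. ennreal (C\<^sup>2) * ennreal ((S i k \<omega> - I i \<omega>)\<^sup>2)) \<partial>M)"
        by (rule nn_integral_cmult) measurable
      also have "(\<integral>\<^sup>+\<omega>. (\<Sum>i<n. ennreal (C\<^sup>2) * ennreal ((S i k \<omega> - I i \<omega>)\<^sup>2)) \<partial>M)
          = (\<Sum>i<n. \<integral>\<^sup>+\<omega>. ennreal (C\<^sup>2) * ennreal ((S i k \<omega> - I i \<omega>)\<^sup>2) \<partial>M)"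
        by (rule nn_integral_sum) simp
      also have "\<dots> = (\<Sum>i<n. ennreal (C\<^sup>2) * q i k)"
        unfolding q_def by (intro sum.cong refl nn_integral_cmult) simp
      finally show ?thesis .
    qed
    also have "(\<integral>\<^sup>+\<omega>. ennreal ((\<Sum>i<n. D k i \<omega>)\<^sup>2) \<partial>M) = (\<Sum>i<n. \<integral>\<^sup>+\<omega>. ennreal ((D k i \<omega>)\<^sup>2) \<partial>M)"
      using mdiff_sum_nn[where D = "D k" and T = T and n = n] Dm T by simp
    also have "\<dots> \<le> (\<Sum>i<n. ennreal (2 * C\<^sup>2) * p i k + 2 * A i)"
      by (intro sum_mono D2) auto
    finally show ?thesis by (simp add: add_mono mult_left_mono)
  qed
  have "(\<lambda>k. 2 * (ennreal (real n) * (\<Sum>i<n. ennreal (C\<^sup>2) * q i k)) + 2 * (\<Sum>i<n. ennreal (2 * C\<^sup>2) * p i k + 2 * A i))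
     \<longlonglongrightarrow> 2 * (ennreal (real n) * (\<Sum>i<n. ennreal (C\<^sup>2) * 0)) + 2 * (\<Sum>i<n. ennreal (2 * C\<^sup>2) * 0 + 2 * A i)"
  proof (intro tendsto_add tendsto_const ennreal_tendsto_cmult tendsto_sum)
    show "q i \<longlonglongrightarrow> 0" if "i \<in> {..<n}" for i
      using c2[of i] that unfolding q_def S_def by auto
    show "p i \<longlonglongrightarrow> 0" if "i \<in> {..<n}" for i
      using c1[of i] that unfolding p_def by auto
  qed auto
  then have "(\<integral>\<^sup>+\<omega>. ennreal ((\<Sum>i<n. E i \<omega>)\<^sup>2) \<partial>M) \<le>
      2 * (ennreal (real n) * (\<Sum>i<n. ennreal (C\<^sup>2) * 0)) + 2 * (\<Sum>i<n. ennreal (2 * C\<^sup>2) * 0 + 2 * A i)"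
    by (rule LIMSEQ_le_const) (use bound in auto)
  also have "\<dots> = 4 * (\<Sum>i<n. A i)"
    by (simp add: sum_distrib_left[symmetric] mult.assoc[symmetric])
  finally show ?thesis unfolding E_def A_def .
qed

end

section \<open>A pathwise product formula along partitions\<close>

lemma continuous_on_Icc_bounded:
  fixes f :: "real \<Rightarrow> real"
  assumes "continuous_on {s..t} f"
  shows "\<exists>C>0. \<forall>u\<in>{s..t}. \<bar>f u\<bar> \<le> C"
proof -
  have "bounded (f ` {s..t})" by (intro compact_imp_bounded compact_continuous_image assms) simp
  then show ?thesis by (auto simp: bounded_pos)
qed

section \<open>Uniform grids and Riemann sums\<close>

definition grid :: "real \<Rightarrow> real \<Rightarrow> nat \<Rightarrow> nat \<Rightarrow> real" where
  "grid s t m i = s + real i * ((t - s) / real m)"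

lemma grid_0 [simp]: "grid s t m 0 = s" by (simp add: grid_def)

lemma grid_end: "m > 0 \<Longrightarrow> grid s t m m = t" by (simp add: grid_def)

lemma grid_Suc: "grid s t m (Suc i) - grid s t m i = (t - s) / real m"
  by (simp add: grid_def algebra_simps add_divide_distrib diff_divide_distrib)

lemma grid_mono: "s \<le> t \<Longrightarrow> i \<le> j \<Longrightarrow> grid s t m i \<le> grid s t m j"
  unfolding grid_def by (intro add_left_mono mult_right_mono) auto

lemma grid_in: "s \<le> t \<Longrightarrow> i \<le> m \<Longrightarrow> grid s t m i \<in> {s..t}"
  using grid_mono[of s t 0 i m] grid_mono[of s t i m m] grid_end[of m s t] by (cases "m = 0") auto

lemma grid_oscillation:
  fixes f :: "real \<Rightarrow> real"
  assumes st: "s \<le> t" and f: "continuous_on {s..t} f" and e: "e > 0"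
  shows "\<forall>\<^sub>F m in sequentially. \<forall>i<m. \<forall>u\<in>{grid s t m i..grid s t m (Suc i)}. \<bar>f u - f (grid s t m i)\<bar> < e"
proof -
  have "uniformly_continuous_on {s..t} f" by (rule compact_uniformly_continuous[OF f]) simp
  then obtain d where d: "d > 0" "\<And>x y. x \<in> {s..t} \<Longrightarrow> y \<in> {s..t} \<Longrightarrow> \<bar>x - y\<bar> < d \<Longrightarrow> \<bar>f x - f y\<bar> < e"
    using e unfolding uniformly_continuous_on_def dist_real_def by meson
  have "(\<lambda>m. (t - s) / real m) \<longlonglongrightarrow> 0" by (rule lim_const_over_n)
  then have "\<forall>\<^sub>F m in sequentially. (t - s) / real m < d" using d(1) by (rule order_tendstoD)
  then show ?thesis
  proof eventually_elim
    case (elim m)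
    show ?case
    proof (intro allI impI ballI)
      fix i u assume i: "i < m" and u: "u \<in> {grid s t m i..grid s t m (Suc i)}"
      have "u \<in> {s..t}" using grid_in[OF st, of i m] grid_in[OF st, of "Suc i" m] i u by auto
      moreover have "\<bar>u - grid s t m i\<bar> < d" using grid_Suc[of s t m i] elim u by auto
      ultimately show "\<bar>f u - f (grid s t m i)\<bar> < e" using d(2) grid_in[OF st, of i m] i by auto
    qed
  qed
qed

lemma integral_grid:
  fixes f :: "real \<Rightarrow> real" and T :: "nat \<Rightarrow> real"
  assumes "\<And>i. i < n \<Longrightarrow> T i \<le> T (Suc i)" "f integrable_on {T 0..T n}"
  shows "(\<Sum>i<n. integral {T i..T (Suc i)} f) = integral {T 0..T n} f"
  using assms
proof (induction n)
  case (Suc n)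
  have m: "T 0 \<le> T n" "T n \<le> T (Suc n)" using mono_grid[of n T 0 n] Suc.prems by auto
  have "f integrable_on {T 0..T n}"
    by (rule integrable_on_subinterval[OF Suc.prems(2)]) (use m in auto)
  then have "(\<Sum>i<n. integral {T i..T (Suc i)} f) = integral {T 0..T n} f" using Suc by auto
  then show ?case
    using Henstock_Kurzweil_Integration.integral_combine[OF m Suc.prems(2)] by simp
qed simp

text \<open>Serves the drift, which enters through its exact integrals over the cells while the
  weight is frozen at the left endpoints.\<close>

lemma weighted_riemann_sum:
  fixes f g :: "real \<Rightarrow> real"
  assumes st: "s \<le> t" and f: "continuous_on {s..t} f" and g: "continuous_on {s..t} g"
  shows "(\<lambda>m. \<Sum>i<m. f (grid s t m i) * integral {grid s t m i..grid s t m (Suc i)} g)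
     \<longlonglongrightarrow> integral {s..t} (\<lambda>u. f u * g u)"
proof -
  obtain C where C: "C > 0" "\<And>u. u \<in> {s..t} \<Longrightarrow> \<bar>g u\<bar> \<le> C"
    using continuous_on_Icc_bounded[OF g] by blast
  show ?thesis
  proof (rule LIMSEQ_I)
    fix r :: real assume r: "r > 0"
    \<comment> \<open>The added 1 keeps the denominator positive when s = t.\<close>
    define e where "e = r / (2 * (C * (t - s) + 1))"
    have pos: "C * (t - s) + 1 > 0" using C st by (simp add: add_nonneg_pos)
    have e: "e > 0" using r pos by (simp add: e_def)
    have "\<forall>\<^sub>F m in sequentially. norm ((\<Sum>i<m. f (grid s t m i) * integral {grid s t m i..grid s t m (Suc i)} g)
       - integral {s..t} (\<lambda>u. f u * g u)) < r"
      using grid_oscillation[OF st f e] eventually_gt_at_top[of 0]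
    proof eventually_elim
      case (elim m)
      let ?T = "grid s t m"
      have m: "m > 0" using elim by simp
      have sub: "{?T i..?T (Suc i)} \<subseteq> {s..t}" if "i < m" for i
        using grid_in[OF st, of i m] grid_in[OF st, of "Suc i" m] that by auto
      have ig: "g integrable_on {?T i..?T (Suc i)}" if "i < m" for i
        by (intro integrable_continuous_interval continuous_on_subset[OF g sub[OF that]])
      have ifg: "(\<lambda>u. f u * g u) integrable_on {?T i..?T (Suc i)}" if "i < m" for i
        by (intro integrable_continuous_interval continuous_intros continuous_on_subset[OF g sub[OF that]]
            continuous_on_subset[OF f sub[OF that]])
      have split: "integral {s..t} (\<lambda>u. f u * g u) = (\<Sum>i<m. integral {?T i..?T (Suc i)} (\<lambda>u. f u * g u))"
        using integral_grid[of m ?T "\<lambda>u. f u * g u"] grid_mono[OF st] grid_end[OF m, of s t]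
        by (simp add: integrable_continuous_interval continuous_on_mult f g)
      have piece: "\<bar>f (?T i) * integral {?T i..?T (Suc i)} g - integral {?T i..?T (Suc i)} (\<lambda>u. f u * g u)\<bar> \<le> e * C * ((t - s) / real m)"
        if i: "i < m" for i
      proof -
        have "f (?T i) * integral {?T i..?T (Suc i)} g - integral {?T i..?T (Suc i)} (\<lambda>u. f u * g u)
            = integral {?T i..?T (Suc i)} (\<lambda>u. f (?T i) * g u - f u * g u)"
          using ig[OF i] ifg[OF i] by (simp add: integral_diff integrable_on_mult_right)
        moreover have "norm (integral {?T i..?T (Suc i)} (\<lambda>u. f (?T i) * g u - f u * g u)) \<le> (e * C) * (?T (Suc i) - ?T i)"
        proof (rule integral_bound)
          show "?T i \<le> ?T (Suc i)" by (rule grid_mono[OF st]) simp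
          show "continuous_on {?T i..?T (Suc i)} (\<lambda>u. f (?T i) * g u - f u * g u)"
            by (intro continuous_intros continuous_on_subset[OF g sub[OF i]] continuous_on_subset[OF f sub[OF i]])
          fix u assume u: "u \<in> {?T i..?T (Suc i)}"
          have "\<bar>f (?T i) * g u - f u * g u\<bar> = \<bar>f u - f (?T i)\<bar> * \<bar>g u\<bar>"
            by (simp add: abs_mult[symmetric] algebra_simps abs_minus_commute)
          also have "\<dots> \<le> e * C"
            using elim(1) i u C(2)[of u] sub[OF i] e by (intro mult_mono) (auto intro: less_imp_le)
          finally show "norm (f (?T i) * g u - f u * g u) \<le> e * C" by simp
        qed
        ultimately show ?thesis by (simp only: grid_Suc real_norm_def)
      qed
      have "\<bar>(\<Sum>i<m. f (?T i) * integral {?T i..?T (Suc i)} g) - integral {s..t} (\<lambda>u. f u * g u)\<bar>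
          \<le> (\<Sum>i<m. \<bar>f (?T i) * integral {?T i..?T (Suc i)} g - integral {?T i..?T (Suc i)} (\<lambda>u. f u * g u)\<bar>)"
        unfolding split sum_subtractf[symmetric] by (rule sum_abs)
      also have "\<dots> \<le> (\<Sum>i<m. e * C * ((t - s) / real m))" by (intro sum_mono piece) auto
      also have "\<dots> = e * (C * (t - s))" using m by simp
      also have "\<dots> \<le> e * (C * (t - s) + 1)" using e by (intro mult_left_mono) auto
      also have "\<dots> = r / 2"
      proof -
        have "r / (2 * c) * c = r / 2" if "c > 0" for c :: real using that by simp
        from this[OF pos] show ?thesis unfolding e_def .
      qed
      also have "\<dots> < r" using r by simp
      finally show ?case by simp
    qed
    then show "\<exists>no. \<forall>n\<ge>no. norm ((\<Sum>i<n. f (grid s t n i) * integral {grid s t n i..grid s t n (Suc i)} g)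
       - integral {s..t} (\<lambda>u. f u * g u)) < r"
      by (simp add: eventually_sequentially)
  qed
qed

lemma riemann_sum:
  fixes f :: "real \<Rightarrow> real"
  assumes st: "s \<le> t" and f: "continuous_on {s..t} f"
  shows "(\<lambda>m. \<Sum>i<m. f (grid s t m i) * ((t - s) / real m)) \<longlonglongrightarrow> integral {s..t} f"
proof -
  have "integral {grid s t m i..grid s t m (Suc i)} (\<lambda>_. 1) = (t - s) / real m" for m i
    using grid_Suc[of s t m i] grid_mono[OF st, of i "Suc i" m] by simp
  then show ?thesis using weighted_riemann_sum[OF st f continuous_on_const[of _ 1]] by simp
qed

section \<open>One step of Ito's formula on a fixed path\<close>

lemma exp_minus_one_bound:
  fixes x :: real
  assumes "\<bar>x\<bar> \<le> 1"
  shows "\<bar>exp (- x) - 1\<bar> \<le> 3 * \<bar>x\<bar>"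
proof -
  have d: "((\<lambda>x. exp (- x) :: real) has_real_derivative - exp (- u)) (at u within {-1..1})" for u :: real
    by (auto intro!: derivative_eq_intros)
  have "norm (exp (- x) - exp (- 0)) \<le> 3 * norm (x - 0)"
  proof (rule field_differentiable_bound[OF _ d])
    fix u :: real assume "u \<in> {-1..1}"
    then have "exp (- u) \<le> exp 1" by simp
    also have "\<dots> \<le> 3" using exp_le by simp
    finally show "norm (- exp (- u)) \<le> 3" by simp
  qed (use assms in auto)
  then show ?thesis by simp
qed

text \<open>The expansion exp (- x) (1 + x) = 1 - x^2/2 + O(x^3): the first factor comes from exp (-
  W), the second from dP = P dW. The quadratic term is the source of the Ito correction -
  P/2.\<close>

lemma exp_remainder_bound:
  fixes x :: real
  assumes "\<bar>x\<bar> \<le> 1"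
  shows "\<bar>exp (- x) * (1 + x) - 1 + x\<^sup>2 / 2\<bar> \<le> 3 * \<bar>x\<bar> * x\<^sup>2"
proof -
  define f where "f u = exp (- u) * (1 + u) - 1 + u\<^sup>2 / 2" for u :: real
  have d: "(f has_real_derivative u * (1 - exp (- u))) (at u within {- \<bar>x\<bar>..\<bar>x\<bar>})" for u
    unfolding f_def by (auto intro!: derivative_eq_intros simp: algebra_simps)
  have "norm (f x - f 0) \<le> (3 * x\<^sup>2) * norm (x - 0)"
  proof (rule field_differentiable_bound[OF _ d])
    fix u assume u: "u \<in> {- \<bar>x\<bar>..\<bar>x\<bar>}"
    have "\<bar>u * (1 - exp (- u))\<bar> = \<bar>u\<bar> * \<bar>exp (- u) - 1\<bar>" by (simp add: abs_mult abs_minus_commute)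
    also have "\<dots> \<le> \<bar>x\<bar> * (3 * \<bar>x\<bar>)"
    proof (rule mult_mono)
      show "\<bar>exp (- u) - 1\<bar> \<le> 3 * \<bar>x\<bar>"
      proof -
        have "\<bar>u\<bar> \<le> \<bar>x\<bar>" using u by auto
        then show ?thesis using exp_minus_one_bound[of u] assms by linarith
      qed
    qed (use u in auto)
    finally show "norm (u * (1 - exp (- u))) \<le> 3 * x\<^sup>2" by (simp add: power2_eq_square)
  qed auto
  then show ?thesis by (simp add: f_def mult_ac)
qed

text \<open>Ito's product rule for exp (- W) P on one path. All probability sits in the hypotheses:
  \<open>c1\<close> and \<open>c2\<close> control the errors of freezing the integrand,
  \<open>c3\<close> and \<open>c4\<close> replace squared increments by the mesh. \<open>c2\<close>
  stands next to \<open>c1\<close> because the errors also occur multiplied by exp (- x) - 1, which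
  varies from cell to cell.\<close>

lemma product_formula_along_grids:
  fixes W P B :: "real \<Rightarrow> real" and m :: "nat \<Rightarrow> nat" and T err :: "nat \<Rightarrow> nat \<Rightarrow> real"
  assumes st: "s \<le> t" and cW: "continuous_on {s..t} W" and cP: "continuous_on {s..t} P" and cB: "continuous_on {s..t} B"
    and m: "filterlim m sequentially sequentially" and mpos: "\<And>k. m k > 0"
    and Tk: "\<And>k. T k = grid s t (m k)"
    and eq: "\<And>k i. i < m k \<Longrightarrow> P (T k (Suc i)) - P (T k i) =
        integral {T k i..T k (Suc i)} B + P (T k i) * (W (T k (Suc i)) - W (T k i)) + err k i"
    and c1: "(\<lambda>k. \<Sum>i<m k. exp (- W (T k i)) * err k i) \<longlonglongrightarrow> 0"
    and c2: "(\<lambda>k. \<Sum>i<m k. (exp (- W (T k i)) * err k i)\<^sup>2) \<longlonglongrightarrow> 0"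
    and c3: "(\<lambda>k. \<Sum>i<m k. (exp (- W (T k i)) * P (T k i)) * ((W (T k (Suc i)) - W (T k i))\<^sup>2 - (t - s) / real (m k))) \<longlonglongrightarrow> 0"
    and c4: "(\<lambda>k. \<Sum>i<m k. (W (T k (Suc i)) - W (T k i))\<^sup>2 - (t - s) / real (m k)) \<longlonglongrightarrow> 0"
  shows "exp (- W t) * P t - exp (- W s) * P s = integral {s..t} (\<lambda>u. exp (- W u) * (B u - P u / 2))"
proof -
  define w where "w u = exp (- W u)" for u
  have cw: "continuous_on {s..t} w" unfolding w_def by (intro continuous_intros cW)
  define x where "x k i = W (T k (Suc i)) - W (T k i)" for k i
  define b where "b k i = integral {T k i..T k (Suc i)} B" for k i
  \<comment> \<open>\<open>R\<close> collects what is of higher order: the Taylor remainder, the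
    drift times an increment, and the freezing error times an increment.\<close>
  define R where "R k i = w (T k i) * P (T k i) * (exp (- x k i) * (1 + x k i) - 1 + (x k i)\<^sup>2 / 2)
     + w (T k i) * (exp (- x k i) - 1) * b k i + (exp (- x k i) - 1) * (w (T k i) * err k i)" for k i
  \<comment> \<open>An exact identity. The terms are the drift, the Ito correction with the mesh in
    place of the squared increment, the fluctuation of that square, the freezing error and the
    remainder.\<close>
  have step: "w (T k (Suc i)) * P (T k (Suc i)) - w (T k i) * P (T k i) =
     w (T k i) * b k i - 1 / 2 * (w (T k i) * P (T k i) * ((t - s) / real (m k)))
     - 1 / 2 * (w (T k i) * P (T k i) * ((x k i)\<^sup>2 - (t - s) / real (m k))) + w (T k i) * err k i + R k i"
    if i: "i < m k" for k i
  proof -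
    have "w (T k (Suc i)) = w (T k i) * exp (- x k i)"
      unfolding w_def x_def by (simp add: exp_add[symmetric])
    moreover have "P (T k (Suc i)) = P (T k i) + b k i + P (T k i) * x k i + err k i"
      using eq[OF i] by (simp add: b_def x_def)
    ultimately show ?thesis unfolding R_def by (simp add: algebra_simps)
  qed
  have total: "w t * P t - w s * P s =
     (\<Sum>i<m k. w (T k i) * b k i) - 1 / 2 * (\<Sum>i<m k. w (T k i) * P (T k i) * ((t - s) / real (m k)))
     - 1 / 2 * (\<Sum>i<m k. w (T k i) * P (T k i) * ((x k i)\<^sup>2 - (t - s) / real (m k)))
     + (\<Sum>i<m k. w (T k i) * err k i) + (\<Sum>i<m k. R k i)" for k
  proof -
    have "w t * P t - w s * P s = (\<Sum>i<m k. w (T k (Suc i)) * P (T k (Suc i)) - w (T k i) * P (T k i))"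
      using sum_lessThan_telescope[of "\<lambda>i. w (T k i) * P (T k i)" "m k"] grid_end[OF mpos[of k], of s t]
      unfolding Tk by simp
    also have "\<dots> = (\<Sum>i<m k. w (T k i) * b k i - 1 / 2 * (w (T k i) * P (T k i) * ((t - s) / real (m k)))
     - 1 / 2 * (w (T k i) * P (T k i) * ((x k i)\<^sup>2 - (t - s) / real (m k))) + w (T k i) * err k i + R k i)"
      by (intro sum.cong refl step) auto
    also have "\<dots> = (\<Sum>i<m k. w (T k i) * b k i) - 1 / 2 * (\<Sum>i<m k. w (T k i) * P (T k i) * ((t - s) / real (m k)))
     - 1 / 2 * (\<Sum>i<m k. w (T k i) * P (T k i) * ((x k i)\<^sup>2 - (t - s) / real (m k)))
     + (\<Sum>i<m k. w (T k i) * err k i) + (\<Sum>i<m k. R k i)"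
      by (simp only: sum.distrib sum_subtractf sum_distrib_left)
    finally show ?thesis .
  qed
  have l1: "(\<lambda>k. \<Sum>i<m k. w (T k i) * b k i) \<longlonglongrightarrow> integral {s..t} (\<lambda>u. w u * B u)"
    using filterlim_compose[OF weighted_riemann_sum[OF st cw cB] m] unfolding b_def Tk .
  have l2: "(\<lambda>k. \<Sum>i<m k. w (T k i) * P (T k i) * ((t - s) / real (m k))) \<longlonglongrightarrow> integral {s..t} (\<lambda>u. w u * P u)"
    using filterlim_compose[OF riemann_sum[OF st continuous_on_mult[OF cw cP]] m] unfolding Tk .
  have l3: "(\<lambda>k. \<Sum>i<m k. w (T k i) * P (T k i) * ((x k i)\<^sup>2 - (t - s) / real (m k))) \<longlonglongrightarrow> 0"
    using c3 unfolding w_def x_def .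
  have l4: "(\<lambda>k. \<Sum>i<m k. w (T k i) * err k i) \<longlonglongrightarrow> 0" using c1 unfolding w_def .
  obtain C where C: "C > 0" "\<And>u. u \<in> {s..t} \<Longrightarrow> \<bar>w u * P u\<bar> \<le> C" "\<And>u. u \<in> {s..t} \<Longrightarrow> \<bar>w u\<bar> \<le> C" "\<And>u. u \<in> {s..t} \<Longrightarrow> \<bar>B u\<bar> \<le> C"
  proof -
    obtain C1 where C1: "C1 > 0" "\<forall>u\<in>{s..t}. \<bar>w u * P u\<bar> \<le> C1"
      using continuous_on_Icc_bounded[OF continuous_on_mult[OF cw cP]] by blast
    obtain C2 where C2: "C2 > 0" "\<forall>u\<in>{s..t}. \<bar>w u\<bar> \<le> C2"
      using continuous_on_Icc_bounded[OF cw] by blast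
    obtain C3 where C3: "C3 > 0" "\<forall>u\<in>{s..t}. \<bar>B u\<bar> \<le> C3"
      using continuous_on_Icc_bounded[OF cB] by blast
    show ?thesis
    proof (rule that[of "C1 + C2 + C3"])
      show "0 < C1 + C2 + C3" using C1 C2 C3 by linarith
      fix u assume u: "u \<in> {s..t}"
      show "\<bar>w u * P u\<bar> \<le> C1 + C2 + C3" using C1(2)[rule_format, OF u] C2(1) C3(1) by linarith
      show "\<bar>w u\<bar> \<le> C1 + C2 + C3" using C2(2)[rule_format, OF u] C1(1) C3(1) by linarith
      show "\<bar>B u\<bar> \<le> C1 + C2 + C3" using C3(2)[rule_format, OF u] C1(1) C2(1) by linarith
    qed
  qed
  have l5: "(\<lambda>k. \<Sum>i<m k. R k i) \<longlonglongrightarrow> 0"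
  proof (rule LIMSEQ_I)
    fix r :: real assume r: "r > 0"
    \<comment> \<open>The coefficient of e in the bound derived below for the sum of the |R k i|,
      with one summand for each of the three parts of R.\<close>
    define K where "K = 3 * C * (t - s + 1) + 3 * C * C * (t - s) + 3 * (t - s + 1)"
    have K: "K > 0" using C st unfolding K_def by (intro add_nonneg_pos add_nonneg_nonneg mult_nonneg_nonneg mult_pos_pos) auto
    define e where "e = min 1 (r / (2 * K))"
    have e: "e > 0" "e \<le> 1" using r K by (auto simp: e_def)
    have e1: "\<forall>\<^sub>F k in sequentially. \<forall>i<m k. \<bar>x k i\<bar> < e"
    proof -
      have "\<forall>\<^sub>F k in sequentially. \<forall>i<m k. \<forall>u\<in>{T k i..T k (Suc i)}. \<bar>W u - W (T k i)\<bar> < e"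
        using filterlim_iff[THEN iffD1, OF m, rule_format, OF grid_oscillation[OF st cW e(1)]] unfolding Tk .
      then show ?thesis
      proof eventually_elim
        case (elim k)
        then show ?case using grid_mono[OF st, of _ "Suc _" "m k"] unfolding x_def Tk by auto
      qed
    qed
    have e2: "\<forall>\<^sub>F k in sequentially. (\<Sum>i<m k. (x k i)\<^sup>2 - (t - s) / real (m k)) < 1"
      using order_tendstoD(2)[OF c4, of 1] unfolding x_def by simp
    have e3: "\<forall>\<^sub>F k in sequentially. (\<Sum>i<m k. (w (T k i) * err k i)\<^sup>2) < e\<^sup>2"
      using order_tendstoD(2)[OF c2, of "e\<^sup>2"] e unfolding w_def by simp
    have "\<forall>\<^sub>F k in sequentially. norm ((\<Sum>i<m k. R k i) - 0) < r"
      using e1 e2 e3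
    proof eventually_elim
      case (elim k)
      have S: "(\<Sum>i<m k. (x k i)\<^sup>2) \<le> t - s + 1"
        using elim(2) mpos[of k] by (simp add: sum_subtractf)
      have Tin: "T k i \<in> {s..t}" if "i < m k" for i
        using grid_in[OF st, of i "m k"] that unfolding Tk by simp
      have Rb: "\<bar>R k i\<bar> \<le> 3 * C * e * (x k i)\<^sup>2 + 3 * C * C * e * ((t - s) / real (m k)) + 3 * (\<bar>x k i\<bar> * \<bar>w (T k i) * err k i\<bar>)"
        if i: "i < m k" for i
      proof -
        have xe: "\<bar>x k i\<bar> \<le> e" "\<bar>x k i\<bar> \<le> 1" using elim(1)[rule_format, OF i] e by linarith+
        have "\<bar>w (T k i) * P (T k i) * (exp (- x k i) * (1 + x k i) - 1 + (x k i)\<^sup>2 / 2)\<bar> \<le> C * (3 * e * (x k i)\<^sup>2)"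
          unfolding abs_mult[of "w (T k i) * P (T k i)"]
        proof (rule mult_mono)
          have "\<bar>exp (- x k i) * (1 + x k i) - 1 + (x k i)\<^sup>2 / 2\<bar> \<le> 3 * \<bar>x k i\<bar> * (x k i)\<^sup>2"
            by (rule exp_remainder_bound[OF xe(2)])
          also have "\<dots> \<le> 3 * e * (x k i)\<^sup>2" using xe by (intro mult_right_mono) auto
          finally show "\<bar>exp (- x k i) * (1 + x k i) - 1 + (x k i)\<^sup>2 / 2\<bar> \<le> 3 * e * (x k i)\<^sup>2" .
        qed (use C Tin[OF i] in auto)
        moreover have "\<bar>w (T k i) * (exp (- x k i) - 1) * b k i\<bar> \<le> C * (3 * e) * (C * ((t - s) / real (m k)))"
          unfolding abs_mult
        proof (intro mult_mono)
          show "\<bar>exp (- x k i) - 1\<bar> \<le> 3 * e" using exp_minus_one_bound[OF xe(2)] xe(1) by linarith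
          have sub: "{T k i..T k (Suc i)} \<subseteq> {s..t}"
            using grid_in[OF st, of i "m k"] grid_in[OF st, of "Suc i" "m k"] i unfolding Tk by auto
          have "norm (integral {T k i..T k (Suc i)} B) \<le> C * (T k (Suc i) - T k i)"
          proof (rule integral_bound)
            show "T k i \<le> T k (Suc i)" unfolding Tk by (rule grid_mono[OF st]) simp
            show "continuous_on {T k i..T k (Suc i)} B" by (rule continuous_on_subset[OF cB sub])
            show "norm (B u) \<le> C" if "u \<in> {T k i..T k (Suc i)}" for u
              using C(4)[of u] sub that by auto
          qed
          then show "\<bar>b k i\<bar> \<le> C * ((t - s) / real (m k))" unfolding b_def Tk grid_Suc by simp
        qed (use C Tin[OF i] e in auto)
        moreover have "\<bar>(exp (- x k i) - 1) * (w (T k i) * err k i)\<bar> \<le> (3 * \<bar>x k i\<bar>) * \<bar>w (T k i) * err k i\<bar>"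
          unfolding abs_mult[of "exp (- x k i) - 1"] by (intro mult_right_mono exp_minus_one_bound xe) auto
        ultimately show ?thesis unfolding R_def by (simp add: mult_ac)
      qed
      \<comment> \<open>Cauchy-Schwarz: the squared increments sum to at most t - s + 1 by
        \<open>c4\<close>, the squared weighted errors to less than e^2 by
        \<open>c2\<close>.\<close>
      have cs: "(\<Sum>i<m k. \<bar>x k i\<bar> * \<bar>w (T k i) * err k i\<bar>) \<le> (t - s + 1) * e"
      proof -
        have "(\<Sum>i<m k. \<bar>x k i\<bar> * \<bar>w (T k i) * err k i\<bar>) \<le> L2_set (x k) {..<m k} * L2_set (\<lambda>i. w (T k i) * err k i) {..<m k}"
          by (rule L2_set_mult_ineq)
        also have "\<dots> \<le> (t - s + 1) * e"
        proof (rule mult_mono)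
          have "L2_set (x k) {..<m k} \<le> sqrt (t - s + 1)" unfolding L2_set_def using S by simp
          also have "\<dots> \<le> t - s + 1" 
          proof (rule real_le_lsqrt)
            have "(t - s + 1) * 1 \<le> (t - s + 1) * (t - s + 1)" using st by (intro mult_left_mono) auto
            then show "t - s + 1 \<le> (t - s + 1)\<^sup>2" by (simp add: power2_eq_square)
          qed (use st in auto)
          finally show "L2_set (x k) {..<m k} \<le> t - s + 1" .
          show "L2_set (\<lambda>i. w (T k i) * err k i) {..<m k} \<le> e"
            unfolding L2_set_def using elim(3) e by (intro real_le_lsqrt) auto
        qed (use st in \<open>auto simp: L2_set_nonneg\<close>)
        finally show ?thesis .
      qed
      have "\<bar>\<Sum>i<m k. R k i\<bar> \<le> (\<Sum>i<m k. \<bar>R k i\<bar>)" by (rule sum_abs)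
      also have "\<dots> \<le> (\<Sum>i<m k. 3 * C * e * (x k i)\<^sup>2 + 3 * C * C * e * ((t - s) / real (m k)) + 3 * (\<bar>x k i\<bar> * \<bar>w (T k i) * err k i\<bar>))"
        by (intro sum_mono Rb) auto
      also have "\<dots> = 3 * C * e * (\<Sum>i<m k. (x k i)\<^sup>2) + 3 * C * C * e * (t - s) + 3 * (\<Sum>i<m k. \<bar>x k i\<bar> * \<bar>w (T k i) * err k i\<bar>)"
        using mpos[of k] by (simp add: sum.distrib sum_distrib_left)
      also have "\<dots> \<le> 3 * C * e * (t - s + 1) + 3 * C * C * e * (t - s) + 3 * ((t - s + 1) * e)"
        using S cs C e by (intro add_mono mult_left_mono) auto
      also have "\<dots> = e * K" by (simp add: K_def algebra_simps)
      also have "\<dots> \<le> r / (2 * K) * K" using K by (intro mult_right_mono) (auto simp: e_def)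
      also have "\<dots> < r" using r K by simp
      finally show ?case by simp
    qed
    then show "\<exists>no. \<forall>k\<ge>no. norm ((\<Sum>i<m k. R k i) - 0) < r" by (simp add: eventually_sequentially)
  qed
  have "(\<lambda>k. (\<Sum>i<m k. w (T k i) * b k i) - 1 / 2 * (\<Sum>i<m k. w (T k i) * P (T k i) * ((t - s) / real (m k)))
     - 1 / 2 * (\<Sum>i<m k. w (T k i) * P (T k i) * ((x k i)\<^sup>2 - (t - s) / real (m k)))
     + (\<Sum>i<m k. w (T k i) * err k i) + (\<Sum>i<m k. R k i)) \<longlonglongrightarrow>
     integral {s..t} (\<lambda>u. w u * B u) - 1 / 2 * integral {s..t} (\<lambda>u. w u * P u) - 1 / 2 * 0 + 0 + 0"
    by (intro tendsto_intros l1 l2 l3 l4 l5)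
  then have "(\<lambda>k::nat. w t * P t - w s * P s) \<longlonglongrightarrow>
     integral {s..t} (\<lambda>u. w u * B u) - 1 / 2 * integral {s..t} (\<lambda>u. w u * P u) - 1 / 2 * 0 + 0 + 0"
    by (simp only: total[symmetric])
  then have "w t * P t - w s * P s = integral {s..t} (\<lambda>u. w u * B u) - 1 / 2 * integral {s..t} (\<lambda>u. w u * P u)"
    using LIMSEQ_unique[OF _ tendsto_const] by fastforce
  also have "\<dots> = integral {s..t} (\<lambda>u. w u * B u - 1 / 2 * (w u * P u))"
    by (subst integral_diff)
      (auto intro!: integrable_continuous_interval continuous_intros cw cP cB)
  finally show ?thesis unfolding w_def by (simp add: algebra_simps)
qed

section \<open>The Riccati equation along almost every path\<close>

text \<open>The known subsequence theorem asks for integrable variables, which truncation at 1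
  provides. Where the truncated sequence tends to 0 it is eventually below 1, hence equal to the
  original one.\<close>

lemma AE_subseq_of_nn_integral_tendsto_0:
  fixes Z :: "nat \<Rightarrow> 'w \<Rightarrow> real"
  assumes fin: "finite_measure M" and Z[measurable]: "\<And>k. Z k \<in> borel_measurable M" and nn: "\<And>k \<omega>. Z k \<omega> \<ge> 0"
    and lim: "(\<lambda>k. \<integral>\<^sup>+\<omega>. ennreal (Z k \<omega>) \<partial>M) \<longlonglongrightarrow> 0"
  shows "\<exists>r::nat\<Rightarrow>nat. strict_mono r \<and> (AE \<omega> in M. (\<lambda>k. Z (r k) \<omega>) \<longlonglongrightarrow> 0)"
proof -
  interpret finite_measure M by (rule fin)
  define Y where "Y k \<omega> = min 1 (Z k \<omega>)" for k \<omega>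
  have Y[measurable]: "Y k \<in> borel_measurable M" for k unfolding Y_def by measurable
  have Yb: "0 \<le> Y k \<omega>" "Y k \<omega> \<le> 1" "Y k \<omega> \<le> Z k \<omega>" for k \<omega> using nn[of k \<omega>] by (auto simp: Y_def)
  have Yi: "integrable M (Y k)" for k
    by (rule integrable_const_bound[of _ 1]) (use Yb in auto)
  have "(\<lambda>k. ennreal (\<integral>\<omega>. norm (Y k \<omega>) \<partial>M)) \<longlonglongrightarrow> 0"
  proof (rule tendsto_sandwich[OF _ _ tendsto_const lim])
    have "ennreal (\<integral>\<omega>. norm (Y k \<omega>) \<partial>M) \<le> (\<integral>\<^sup>+\<omega>. ennreal (Z k \<omega>) \<partial>M)" for k
    proof -
      have "ennreal (\<integral>\<omega>. norm (Y k \<omega>) \<partial>M) = (\<integral>\<^sup>+\<omega>. ennreal (norm (Y k \<omega>)) \<partial>M)"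
        by (rule nn_integral_eq_integral[symmetric]) (use Yi in auto)
      also have "\<dots> \<le> (\<integral>\<^sup>+\<omega>. ennreal (Z k \<omega>) \<partial>M)"
        by (intro nn_integral_mono ennreal_leI) (use Yb in auto)
      finally show ?thesis .
    qed
    then show "\<forall>\<^sub>F k in sequentially. ennreal (\<integral>\<omega>. norm (Y k \<omega>) \<partial>M) \<le> (\<integral>\<^sup>+\<omega>. ennreal (Z k \<omega>) \<partial>M)" by simp
  qed simp
  then have "(\<lambda>k. \<integral>\<omega>. norm (Y k \<omega>) \<partial>M) \<longlonglongrightarrow> 0"
    using tendsto_ennrealD[of "\<lambda>k. \<integral>\<omega>. norm (Y k \<omega>) \<partial>M" 0 sequentially] by (simp add: ennreal_0[symmetric] del: ennreal_0)
  then obtain r where r: "strict_mono r" "AE \<omega> in M. (\<lambda>k. Y (r k) \<omega>) \<longlonglongrightarrow> 0"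
    using tendsto_L1_AE_subseq[of M Y, OF Yi] by blast
  from r(2) have "AE \<omega> in M. (\<lambda>k. Z (r k) \<omega>) \<longlonglongrightarrow> 0"
  proof eventually_elim
    case (elim \<omega>)
    have "\<forall>\<^sub>F k in sequentially. Y (r k) \<omega> < 1" using order_tendstoD(2)[OF elim, of 1] by simp
    then have "\<forall>\<^sub>F k in sequentially. Y (r k) \<omega> = Z (r k) \<omega>"
      by eventually_elim (auto simp: Y_def min_def split: if_splits)
    then show ?case using elim by (rule Lim_transform_eventually[rotated])
  qed
  then show ?thesis using r(1) by blast
qed

text \<open>Lying outside [-N, N] is an open condition, so by a one-sided limit it persists at
  nearby times, rational ones among them. After an explosion the right limit is +infinity, which
  lies outside as well. For an exit at u itself the left limit is used, so that q < u.\<close>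

lemma restarting_path_exit_rational:
  assumes rp: "restarting_path a b p" and ab: "a < b" and su: "a < s" "s < u" "u \<le> b"
    and exit: "\<exists>v\<in>{s..u}. \<not> \<bar>p v\<bar> \<le> ereal N"
  shows "\<exists>q\<in>\<rat>. s \<le> q \<and> q < u \<and> \<not> \<bar>p q\<bar> \<le> ereal N"
proof -
  have abs_iff: "\<not> \<bar>x\<bar> \<le> ereal N \<longleftrightarrow> x < ereal (- N) \<or> ereal N < x" for x :: ereal
    by (cases x) auto
  have ev: "\<forall>\<^sub>F v in F. \<not> \<bar>p v\<bar> \<le> ereal N" if "(p \<longlongrightarrow> L) F" "\<not> \<bar>L\<bar> \<le> ereal N" for F L
  proof -
    from that(2)[unfolded abs_iff] show ?thesis
    proof
      assume 1: "L < ereal (- N)"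
      from order_tendstoD(2)[OF that(1) 1] show ?thesis
        by (rule eventually_mono) (simp only: abs_iff simp_thms)
    next
      assume 2: "ereal N < L"
      from order_tendstoD(1)[OF that(1) 2] show ?thesis
        by (rule eventually_mono) (simp only: abs_iff simp_thms)
    qed
  qed
  obtain v where v: "s \<le> v" "v \<le> u" "\<not> \<bar>p v\<bar> \<le> ereal N" using exit by auto
  show ?thesis
  proof (cases "v = u")
    case True
    have "(p \<longlongrightarrow> p u) (at_left u)" using restarting_path_left[OF rp ab] su by auto
    from ev[OF this] v True have "\<forall>\<^sub>F v in at_left u. \<not> \<bar>p v\<bar> \<le> ereal N" by simp
    then obtain d where d: "d < u" "\<And>y. d < y \<Longrightarrow> y < u \<Longrightarrow> \<not> \<bar>p y\<bar> \<le> ereal N"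
      by (auto simp: eventually_at_left_field)
    obtain q where q: "q \<in> \<rat>" "max s d < q" "q < u" using Rats_dense_in_real[of "max s d" u] su d by auto
    then show ?thesis using d(2)[of q] by (intro bexI[of _ q]) auto
  next
    case False
    then have vu: "v < u" using v by simp
    have lim: "(p \<longlongrightarrow> (if v = a \<or> p v = -\<infinity> then \<infinity> else p v)) (at_right v)"
      using restarting_path_right[OF rp ab, of v] v vu su by auto
    have "\<forall>\<^sub>F y in at_right v. \<not> \<bar>p y\<bar> \<le> ereal N"
      by (rule ev[OF lim]) (use v su in auto)
    then obtain d where d: "v < d" "\<And>y. v < y \<Longrightarrow> y < d \<Longrightarrow> \<not> \<bar>p y\<bar> \<le> ereal N"
      by (auto simp: eventually_at_right_field)
    obtain q where q: "q \<in> \<rat>" "v < q" "q < min u d" using Rats_dense_in_real[of v "min u d"] vu d by auto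
    then show ?thesis using d(2)[of q] v by (intro bexI[of _ q]) auto
  qed
qed

lemma restarting_path_real_left:
  assumes rp: "restarting_path a b p" and ab: "a < b" and u: "u \<in> {a<..b}" and fin: "\<bar>p u\<bar> \<noteq> \<infinity>"
  shows "((\<lambda>v. real_of_ereal (p v)) \<longlongrightarrow> real_of_ereal (p u)) (at_left u)"
  using restarting_path_left[OF rp ab u] fin by (intro lim_real_of_ereal) (auto simp: ereal_real')

lemma restarting_path_real_continuous:
  assumes rp: "restarting_path a b p" and ab: "a < b" and st: "a < s" "s \<le> t" "t \<le> b"
    and fin: "\<And>v. v \<in> {s..t} \<Longrightarrow> p v \<noteq> -\<infinity>"
  shows "continuous_on {s..t} (\<lambda>v. real_of_ereal (p v))"
proof (cases "s = t")
  case False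
  then have st': "s < t" using st by simp
  have finite_p: "\<bar>p v\<bar> \<noteq> \<infinity>" if "v \<in> {s..t}" for v
    using fin[OF that] restarting_path_not_top[OF rp ab, of v] st that by (cases "p v") auto
  show ?thesis
    unfolding continuous_on_def
  proof
    fix v assume v: "v \<in> {s..t}"
    have l: "((\<lambda>v. real_of_ereal (p v)) \<longlongrightarrow> real_of_ereal (p v)) (at_left v)"
      by (rule restarting_path_real_left[OF rp ab _ finite_p[OF v]]) (use v st in auto)
    have r: "((\<lambda>v. real_of_ereal (p v)) \<longlongrightarrow> real_of_ereal (p v)) (at_right v)" if "v < t"
    proof -
      have "(p \<longlongrightarrow> p v) (at_right v)"
        using restarting_path_right[OF rp ab, of v] v st that fin[OF v] by auto
      then show ?thesis using finite_p[OF v] by (intro lim_real_of_ereal) (auto simp: ereal_real')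
    qed
    show "((\<lambda>v. real_of_ereal (p v)) \<longlongrightarrow> real_of_ereal (p v)) (at v within {s..t})"
      using l r unfolding tendsto_def by (auto intro!: eventually_at_within_IccI[OF st' v])
  qed
qed simp

context brownian
begin

lemma inner_integral_measurable:
  fixes H :: "real \<Rightarrow> 'w \<Rightarrow> real"
  assumes H: "(\<lambda>(u, \<omega>). H u \<omega>) \<in> borel_measurable (restrict_space borel {s..t} \<Otimes>\<^sub>M M)"
    and h[measurable]: "h \<in> borel_measurable M"
  shows "(\<lambda>\<omega>. \<integral>\<^sup>+u\<in>{s..t}. ennreal ((H u \<omega> - h \<omega>)\<^sup>2) \<partial>lborel) \<in> borel_measurable M"
    and "\<omega> \<in> space M \<Longrightarrow> (\<lambda>u. ennreal ((H u \<omega> - h \<omega>)\<^sup>2) * indicator {s..t} u) \<in> borel_measurable lborel"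
proof -
  define K where "K u \<omega> = (if u \<in> {s..t} then H u \<omega> else 0)" for u \<omega>
  have "(\<lambda>(u, \<omega>). K u \<omega>) \<in> borel_measurable (borel \<Otimes>\<^sub>M M)"
    unfolding K_def by (rule measurable_pair_restrict_extend[OF _ H]) simp
  then have "(\<lambda>(u, \<omega>). K u \<omega>) \<in> borel_measurable (lborel \<Otimes>\<^sub>M M)"
    by (simp cong: measurable_cong_sets add: measurable_lborel1)
  from measurable_pair_swap[OF this]
  have K[measurable]: "(\<lambda>(\<omega>, u). K u \<omega>) \<in> borel_measurable (M \<Otimes>\<^sub>M lborel)" by (simp add: case_prod_beta')
  have HK: "ennreal ((H u \<omega> - h \<omega>)\<^sup>2) * indicator {s..t} u = ennreal ((K u \<omega> - h \<omega>)\<^sup>2) * indicator {s..t} u" for u \<omega>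
    by (auto simp: K_def indicator_def)
  show "(\<lambda>\<omega>. \<integral>\<^sup>+u\<in>{s..t}. ennreal ((H u \<omega> - h \<omega>)\<^sup>2) \<partial>lborel) \<in> borel_measurable M"
    unfolding HK by measurable
  assume \<omega>: "\<omega> \<in> space M"
  have [measurable]: "(\<lambda>u. K u \<omega>) \<in> borel_measurable lborel"
    using measurable_compose[OF measurable_Pair1'[OF \<omega>] K] by simp
  show "(\<lambda>u. ennreal ((H u \<omega> - h \<omega>)\<^sup>2) * indicator {s..t} u) \<in> borel_measurable lborel"
    unfolding HK by measurable
qed

end

section \<open>The localized diffusion and the error of freezing it\<close>

locale riccati_diffusion = brownian M F W a b
  for M :: "'w measure" and F W a b +
  fixes P :: "real \<Rightarrow> 'w \<Rightarrow> ereal" and lam :: real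
  assumes diffusion: "restarted_ito_diffusion M F W a b (\<lambda>p. - 2 * lam - p\<^sup>2 + 1 / 2 * p) (\<lambda>p. p) P"
begin

lemma P_adapted: "t \<in> {a<..b} \<Longrightarrow> P t \<in> borel_measurable (F t)"
  using diffusion unfolding restarted_ito_diffusion_def by auto

lemma P_path: "AE \<omega> in M. restarting_path a b (\<lambda>t. P t \<omega>)"
  using diffusion unfolding restarted_ito_diffusion_def by auto

lemma W_continuous: "AE \<omega> in M. continuous_on UNIV (\<lambda>t. W t \<omega>)"
  using BM unfolding two_sided_BM_def by auto

lemma P_ito:
  assumes "a < s" "s \<le> t" "t \<le> b"
  shows "\<exists>I. has_ito_integral M F W s t (localized (\<lambda>p. p) P s N) I \<and>
             (AE \<omega> in M. (\<forall>v\<in>{s..t}. \<bar>P v \<omega>\<bar> \<le> ereal N) \<longrightarrow>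
                real_of_ereal (P t \<omega>) - real_of_ereal (P s \<omega>) =
                (LBINT u:{s..t}. - 2 * lam - (real_of_ereal (P u \<omega>))\<^sup>2 + 1 / 2 * real_of_ereal (P u \<omega>)) + I \<omega>)"
  using diffusion assms unfolding restarted_ito_diffusion_def by blast

text \<open>
  Restricting to rational times makes this an event of \<open>F u\<close>, which need not be complete; by
  \<open>restarting_path_exit_rational\<close> no exit of a restarting path is missed.
\<close>

definition stays :: "real \<Rightarrow> real \<Rightarrow> real \<Rightarrow> 'w \<Rightarrow> bool" where
  "stays N s u \<omega> \<longleftrightarrow> (\<forall>q::rat. s \<le> real_of_rat q \<and> real_of_rat q \<le> u \<longrightarrow> \<bar>P (real_of_rat q) \<omega>\<bar> \<le> ereal N)"

lemma stays_measurable: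
  assumes "a < s" "u \<le> b"
  shows "Measurable.pred (F u) (stays N s u)"
proof -
  have one: "Measurable.pred (F u) (\<lambda>\<omega>. s \<le> q \<and> q \<le> u \<longrightarrow> \<bar>P q \<omega>\<bar> \<le> ereal N)" for q
  proof (cases "s \<le> q \<and> q \<le> u")
    case True
    then have [measurable]: "P q \<in> borel_measurable (F u)"
      using measurable_F_mono[OF P_adapted[of q], of u] assms by auto
    show ?thesis by measurable
  next
    case False
    then have "(\<lambda>\<omega>. s \<le> q \<and> q \<le> u \<longrightarrow> \<bar>P q \<omega>\<bar> \<le> ereal N) = (\<lambda>_. True)" by blast
    then show ?thesis by simp
  qed
  have "Measurable.pred (F u) (\<lambda>\<omega>. \<forall>q::rat. s \<le> real_of_rat q \<and> real_of_rat q \<le> u \<longrightarrow> \<bar>P (real_of_rat q) \<omega>\<bar> \<le> ereal N)"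
    by (rule pred_intros_countable(1)[OF one])
  then show ?thesis unfolding stays_def .
qed

text \<open>This is the localized integrand at its own starting time; the cut-off provides the bound
  that the freezing estimate asks for.\<close>

definition frozen :: "real \<Rightarrow> real \<Rightarrow> 'w \<Rightarrow> real" where
  "frozen N s \<omega> = (if \<bar>P s \<omega>\<bar> \<le> ereal N then real_of_ereal (P s \<omega>) else 0)"

text \<open>The localized integrand starts afresh at every grid point and does not remember earlier
  exits; the condition \<open>stays\<close> removes the cells after an exit. The exponent uses W u -
  W a, which is adapted, and is cut off at K to keep the weight bounded.\<close>

definition weight :: "real \<Rightarrow> real \<Rightarrow> real \<Rightarrow> real \<Rightarrow> 'w \<Rightarrow> real" where
  "weight N K s u \<omega> = (if stays N s u \<omega> \<and> \<bar>W u \<omega> - W a \<omega>\<bar> \<le> K then exp (- (W u \<omega> - W a \<omega>)) else 0)"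

lemma frozen_measurable: "s \<in> {a<..b} \<Longrightarrow> frozen N s \<in> borel_measurable (F s)"
proof -
  assume "s \<in> {a<..b}"
  then have [measurable]: "P s \<in> borel_measurable (F s)" by (rule P_adapted)
  show ?thesis unfolding frozen_def by measurable
qed

lemma frozen_bound: "N \<ge> 0 \<Longrightarrow> \<bar>frozen N s \<omega>\<bar> \<le> N"
  unfolding frozen_def by (cases "P s \<omega>") auto

lemma weight_measurable:
  assumes "a < s" "s \<le> u" "u \<le> b"
  shows "weight N K s u \<in> borel_measurable (F u)"
proof -
  have [measurable]: "Measurable.pred (F u) (stays N s u)" by (rule stays_measurable) (use assms in auto)
  have [measurable]: "(\<lambda>\<omega>. W u \<omega> - W a \<omega>) \<in> borel_measurable (F u)" by (rule W_adapted) (use assms in auto)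
  show ?thesis unfolding weight_def by measurable
qed

lemma weight_bound: "0 \<le> weight N K s u \<omega>" "weight N K s u \<omega> \<le> exp K"
  unfolding weight_def by auto

lemma localized_bound: "N \<ge> 0 \<Longrightarrow> s \<le> u \<Longrightarrow> \<bar>localized (\<lambda>p. p) P s N u \<omega>\<bar> \<le> N"
  unfolding localized_def
  by (cases "P u \<omega>") (auto dest: bspec[of _ _ u])

definition freezing_error :: "real \<Rightarrow> real \<Rightarrow> real \<Rightarrow> real \<Rightarrow> nat \<Rightarrow> 'w \<Rightarrow> ennreal" where
  "freezing_error N K s t m \<omega> = (\<Sum>i<m. ennreal ((weight N K s (grid s t m i) \<omega>)\<^sup>2) *
     (\<integral>\<^sup>+u\<in>{grid s t m i..grid s t m (Suc i)}.
        ennreal ((localized (\<lambda>p. p) P (grid s t m i) N u \<omega> - frozen N (grid s t m i) \<omega>)\<^sup>2) \<partial>lborel))"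

lemma localized_joint_measurable:
  assumes "a < s" "s \<le> t" "t \<le> b"
  shows "(\<lambda>(u, \<omega>). localized (\<lambda>p. p) P s N u \<omega>) \<in> borel_measurable (restrict_space borel {s..t} \<Otimes>\<^sub>M M)"
  using P_ito[OF assms, of N] by (auto simp: has_ito_integral_def)

text \<open>If the path stays in [-N, N] up to u, the error is the variation of P between u and the
  grid point before it, which vanishes in the limit by left continuity. Otherwise there is a
  rational exit time q < u, and grid points beyond q have weight 0.\<close>

lemma freezing_error_pointwise:
  assumes st: "a < s" "s \<le> t" "t \<le> b" and N: "N \<ge> 0"
    and rp: "restarting_path a b (\<lambda>t. P t \<omega>)" and u: "u \<in> {s<..t}"
  shows "(\<lambda>m. \<Sum>i<m. (weight N K s (grid s t m i) \<omega>)\<^sup>2 *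
     (localized (\<lambda>p. p) P (grid s t m i) N u \<omega> - frozen N (grid s t m i) \<omega>)\<^sup>2
      * indicator {grid s t m i<..grid s t m (Suc i)} u) \<longlonglongrightarrow> 0" (is "(\<lambda>m. \<Sum>i<m. ?f m i) \<longlonglongrightarrow> 0")
proof -
  have single: "(\<Sum>i<m. ?f m i) = 0 \<or> (\<exists>j<m. u \<in> {grid s t m j<..grid s t m (Suc j)} \<and> (\<Sum>i<m. ?f m i) = ?f m j)" for m
  proof -
    have "(\<forall>j<m. u \<notin> {grid s t m j<..grid s t m (Suc j)}) \<or>
        (\<exists>j<m. u \<in> {grid s t m j<..grid s t m (Suc j)} \<and> (\<forall>i<m. i \<noteq> j \<longrightarrow> u \<notin> {grid s t m i<..grid s t m (Suc i)}))"
      by (rule at_most_one_interval) (rule grid_mono[OF st(2)], simp)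
    then show ?thesis
    proof
      assume "\<forall>j<m. u \<notin> {grid s t m j<..grid s t m (Suc j)}"
      then have "(\<Sum>i<m. ?f m i) = 0" by (intro sum.neutral) auto
      then show ?thesis ..
    next
      assume "\<exists>j<m. u \<in> {grid s t m j<..grid s t m (Suc j)} \<and> (\<forall>i<m. i \<noteq> j \<longrightarrow> u \<notin> {grid s t m i<..grid s t m (Suc i)})"
      then obtain j where j: "j < m" "u \<in> {grid s t m j<..grid s t m (Suc j)}"
        "\<And>i. i < m \<Longrightarrow> i \<noteq> j \<Longrightarrow> u \<notin> {grid s t m i<..grid s t m (Suc i)}" by blast
      have "(\<Sum>i<m. ?f m i) = ?f m j"
        by (rule sum_at_single[OF j(1)]) (use j(3) in simp)
      then show ?thesis using j by blast
    qed
  qed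
  have mesh: "\<forall>\<^sub>F m in sequentially. (t - s) / real m < d" if "d > 0" for d
    using order_tendstoD(2)[OF lim_const_over_n[of "t - s"] that] .
  show ?thesis
  proof (cases "\<forall>v\<in>{s..u}. \<bar>P v \<omega>\<bar> \<le> ereal N")
    case True
    have Pu: "\<bar>P u \<omega>\<bar> \<le> ereal N" using True u by auto
    then have fin: "\<bar>P u \<omega>\<bar> \<noteq> \<infinity>" by auto
    have lim: "((\<lambda>v. real_of_ereal (P v \<omega>)) \<longlongrightarrow> real_of_ereal (P u \<omega>)) (at_left u)"
      by (rule restarting_path_real_left[OF rp ab _ fin]) (use u st in auto)
    show ?thesis
    proof (rule LIMSEQ_I)
      fix r :: real assume r: "r > 0"
      \<comment> \<open>Chosen so that the square of \<open>exp K * e\<close> is r / 2, where exp K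
        bounds the weight.\<close>
      define e where "e = sqrt (r / 2) / exp K"
      have e: "e > 0" "(exp K * e)\<^sup>2 < r" using r by (auto simp: e_def)
      have "\<forall>\<^sub>F v in at_left u. dist (real_of_ereal (P v \<omega>)) (real_of_ereal (P u \<omega>)) < e"
        by (rule tendstoD[OF lim e(1)])
      then obtain d where d: "d < u" "\<And>v. d < v \<Longrightarrow> v < u \<Longrightarrow> \<bar>real_of_ereal (P v \<omega>) - real_of_ereal (P u \<omega>)\<bar> < e"
        by (auto simp: eventually_at_left_field dist_real_def)
      have mesh': "\<forall>\<^sub>F m in sequentially. (t - s) / real m < u - d" using mesh[of "u - d"] d(1) by simp
      have "\<forall>\<^sub>F m in sequentially. norm ((\<Sum>i<m. ?f m i) - 0) < r"
        using mesh'
      proof eventually_elim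
        case (elim m)
        from single[of m] show ?case
        proof (elim disjE exE conjE)
          fix j assume j: "j < m" "u \<in> {grid s t m j<..grid s t m (Suc j)}" and eq: "(\<Sum>i<m. ?f m i) = ?f m j"
          have gj: "grid s t m j \<in> {s..t}" using grid_in[OF st(2), of j m] j by simp
          have "\<bar>real_of_ereal (P (grid s t m j) \<omega>) - real_of_ereal (P u \<omega>)\<bar> < e"
            by (rule d(2)) (use j grid_Suc[of s t m j] elim in auto)
          moreover have "localized (\<lambda>p. p) P (grid s t m j) N u \<omega> = real_of_ereal (P u \<omega>)"
            unfolding localized_def using True gj by auto
          moreover have "frozen N (grid s t m j) \<omega> = real_of_ereal (P (grid s t m j) \<omega>)"
            unfolding frozen_def using True gj j by auto
          ultimately have "\<bar>weight N K s (grid s t m j) \<omega> * (localized (\<lambda>p. p) P (grid s t m j) N u \<omega> - frozen N (grid s t m j) \<omega>)\<bar> \<le> exp K * e"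
            unfolding abs_mult using weight_bound[of N K s "grid s t m j" \<omega>]
            by (intro mult_mono) (auto simp: abs_minus_commute)
          then have "(weight N K s (grid s t m j) \<omega> * (localized (\<lambda>p. p) P (grid s t m j) N u \<omega> - frozen N (grid s t m j) \<omega>))\<^sup>2 \<le> (exp K * e)\<^sup>2"
            by (meson abs_le_square_iff abs_ge_self order_trans)
          then show ?thesis using eq e j(2) by (simp add: power_mult_distrib)
        qed (use r in simp)
      qed
      then show "\<exists>no. \<forall>m\<ge>no. norm ((\<Sum>i<m. ?f m i) - 0) < r" by (simp add: eventually_sequentially)
    qed
  next
    case False
    then have "\<exists>v\<in>{s..u}. \<not> \<bar>P v \<omega>\<bar> \<le> ereal N" by blast
    then have "\<exists>q\<in>\<rat>. s \<le> q \<and> q < u \<and> \<not> \<bar>P q \<omega>\<bar> \<le> ereal N"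
      by (intro restarting_path_exit_rational[OF rp ab]) (use st u in auto)
    then obtain q where q: "q \<in> \<rat>" "s \<le> q" "q < u" "\<not> \<bar>P q \<omega>\<bar> \<le> ereal N" by blast
    have mesh': "\<forall>\<^sub>F m in sequentially. (t - s) / real m < u - q" using mesh[of "u - q"] q(3) by simp
    have "\<forall>\<^sub>F m in sequentially. (\<Sum>i<m. ?f m i) = 0"
      using mesh'
    proof eventually_elim
      case (elim m)
      from single[of m] show ?case
      proof (elim disjE exE conjE)
        fix j assume j: "j < m" "u \<in> {grid s t m j<..grid s t m (Suc j)}" and eq: "(\<Sum>i<m. ?f m i) = ?f m j"
        \<comment> \<open>The mesh is smaller than u - q and u lies in cell j, so the left endpoint
          of that cell is past q.\<close>
        have qj: "q \<le> grid s t m j" using j grid_Suc[of s t m j] elim by auto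
        have "\<not> stays N s (grid s t m j) \<omega>"
        proof -
          obtain q' where "q = real_of_rat q'" using q(1) by (rule Rats_cases)
          then show "\<not> stays N s (grid s t m j) \<omega>" unfolding stays_def using q qj by auto
        qed
        then show ?thesis using eq by (simp add: weight_def)
      qed
    qed
    then show ?thesis by (simp add: tendsto_eventually)
  qed
qed

lemma grid_bounds:
  assumes "a < s" "s \<le> t" "t \<le> b" "i \<le> m"
  shows "a < grid s t m i" "grid s t m i \<le> b" "s \<le> grid s t m i" "grid s t m i \<le> t"
  using grid_in[OF assms(2,4)] assms by auto

lemma freezing_integrand_measurable:
  assumes st: "a < s" "s \<le> t" "t \<le> b" and i: "i < m"
  shows "(\<lambda>\<omega>. \<integral>\<^sup>+u\<in>{grid s t m i..grid s t m (Suc i)}.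
        ennreal ((localized (\<lambda>p. p) P (grid s t m i) N u \<omega> - frozen N (grid s t m i) \<omega>)\<^sup>2) \<partial>lborel) \<in> borel_measurable M"
    and "\<omega> \<in> space M \<Longrightarrow> (\<lambda>u. ennreal ((localized (\<lambda>p. p) P (grid s t m i) N u \<omega> - frozen N (grid s t m i) \<omega>)\<^sup>2)
        * indicator {grid s t m i..grid s t m (Suc i)} u) \<in> borel_measurable lborel"
proof -
  have g: "a < grid s t m i" "grid s t m i \<le> grid s t m (Suc i)" "grid s t m (Suc i) \<le> b"
    using grid_bounds[OF st, of i m] grid_bounds[OF st, of "Suc i" m] grid_mono[OF st(2), of i "Suc i" m] i by auto
  have h: "frozen N (grid s t m i) \<in> borel_measurable M"
    by (rule measurable_F_M[OF frozen_measurable]) (use g in auto)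
  note m = inner_integral_measurable[OF localized_joint_measurable[OF g] h]
  show "(\<lambda>\<omega>. \<integral>\<^sup>+u\<in>{grid s t m i..grid s t m (Suc i)}.
        ennreal ((localized (\<lambda>p. p) P (grid s t m i) N u \<omega> - frozen N (grid s t m i) \<omega>)\<^sup>2) \<partial>lborel) \<in> borel_measurable M"
    by (rule m(1))
  show "\<omega> \<in> space M \<Longrightarrow> (\<lambda>u. ennreal ((localized (\<lambda>p. p) P (grid s t m i) N u \<omega> - frozen N (grid s t m i) \<omega>)\<^sup>2)
        * indicator {grid s t m i..grid s t m (Suc i)} u) \<in> borel_measurable lborel"
    by (rule m(2))
qed

text \<open>Closed and half-open cells differ by null sets. With half-open cells the error becomes
  one integral of a sum with at most one nonzero term, ready for dominated convergence.\<close>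

lemma freezing_error_eq:
  assumes st: "a < s" "s \<le> t" "t \<le> b" and \<omega>: "\<omega> \<in> space M"
  shows "freezing_error N K s t m \<omega> = (\<integral>\<^sup>+u. ennreal (\<Sum>i<m. (weight N K s (grid s t m i) \<omega>)\<^sup>2 *
     (localized (\<lambda>p. p) P (grid s t m i) N u \<omega> - frozen N (grid s t m i) \<omega>)\<^sup>2
      * indicator {grid s t m i<..grid s t m (Suc i)} u) \<partial>lborel)" (is "_ = (\<integral>\<^sup>+u. ennreal (\<Sum>i<m. ?f i u) \<partial>lborel)")
  and "(\<lambda>u. ennreal (\<Sum>i<m. (weight N K s (grid s t m i) \<omega>)\<^sup>2 *
     (localized (\<lambda>p. p) P (grid s t m i) N u \<omega> - frozen N (grid s t m i) \<omega>)\<^sup>2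
      * indicator {grid s t m i<..grid s t m (Suc i)} u)) \<in> borel_measurable lborel"
proof -
  let ?g = "\<lambda>i u. ennreal ((localized (\<lambda>p. p) P (grid s t m i) N u \<omega> - frozen N (grid s t m i) \<omega>)\<^sup>2)
        * indicator {grid s t m i..grid s t m (Suc i)} u"
  have gm: "?g i \<in> borel_measurable lborel" if "i < m" for i
    by (rule freezing_integrand_measurable(2)[OF st that \<omega>])
  have fg: "ennreal (?f i u) = ennreal ((weight N K s (grid s t m i) \<omega>)\<^sup>2) * (?g i u * indicator (UNIV - {grid s t m i}) u)" for i u
    by (auto simp: indicator_def ennreal_mult)
  have fm: "(\<lambda>u. ennreal (?f i u)) \<in> borel_measurable lborel" if "i < m" for i
    unfolding fg using gm[OF that] by measurable
  have sum: "ennreal (\<Sum>i<m. ?f i u) = (\<Sum>i<m. ennreal (?f i u))" for u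
    by (simp add: sum_ennreal)
  show "(\<lambda>u. ennreal (\<Sum>i<m. ?f i u)) \<in> borel_measurable lborel"
    unfolding sum using fm by (intro borel_measurable_sum) auto
  have "(\<integral>\<^sup>+u. ennreal (\<Sum>i<m. ?f i u) \<partial>lborel) = (\<Sum>i<m. \<integral>\<^sup>+u. ennreal (?f i u) \<partial>lborel)"
    unfolding sum by (rule nn_integral_sum) (use fm in auto)
  also have "\<dots> = (\<Sum>i<m. ennreal ((weight N K s (grid s t m i) \<omega>)\<^sup>2) * (\<integral>\<^sup>+u. ?g i u \<partial>lborel))"
  proof (rule sum.cong[OF refl])
    fix i assume "i \<in> {..<m}"
    then have i: "i < m" by simp
    have "(\<integral>\<^sup>+u. ennreal (?f i u) \<partial>lborel) = (\<integral>\<^sup>+u. ennreal ((weight N K s (grid s t m i) \<omega>)\<^sup>2) * ?g i u \<partial>lborel)"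
    proof (rule nn_integral_cong_AE)
      show "AE u in lborel. ennreal (?f i u) = ennreal ((weight N K s (grid s t m i) \<omega>)\<^sup>2) * ?g i u"
        using AE_lborel_singleton[of "grid s t m i"] by eventually_elim (simp add: fg)
    qed
    also have "\<dots> = ennreal ((weight N K s (grid s t m i) \<omega>)\<^sup>2) * (\<integral>\<^sup>+u. ?g i u \<partial>lborel)"
      by (rule nn_integral_cmult[OF gm[OF i]])
    finally show "(\<integral>\<^sup>+u. ennreal (?f i u) \<partial>lborel) = ennreal ((weight N K s (grid s t m i) \<omega>)\<^sup>2) * (\<integral>\<^sup>+u. ?g i u \<partial>lborel)" .
  qed
  finally show "freezing_error N K s t m \<omega> = (\<integral>\<^sup>+u. ennreal (\<Sum>i<m. ?f i u) \<partial>lborel)"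
    unfolding freezing_error_def by simp
qed

text \<open>At most one summand is nonzero, so the bound does not depend on m.\<close>

lemma freezing_integrand_bound:
  assumes st: "s \<le> t" and N: "N \<ge> 0"
  shows "(\<Sum>i<m. (weight N K s (grid s t m i) \<omega>)\<^sup>2 *
     (localized (\<lambda>p. p) P (grid s t m i) N u \<omega> - frozen N (grid s t m i) \<omega>)\<^sup>2
      * indicator {grid s t m i<..grid s t m (Suc i)} u) \<le> (exp K)\<^sup>2 * (2 * N)\<^sup>2 * indicator {s..t} u"
    (is "(\<Sum>i<m. ?f i) \<le> _")
proof -
  have "(\<forall>j<m. u \<notin> {grid s t m j<..grid s t m (Suc j)}) \<or>
        (\<exists>j<m. u \<in> {grid s t m j<..grid s t m (Suc j)} \<and> (\<forall>i<m. i \<noteq> j \<longrightarrow> u \<notin> {grid s t m i<..grid s t m (Suc i)}))"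
    by (rule at_most_one_interval) (rule grid_mono[OF st], simp)
  then show ?thesis
  proof
    assume "\<forall>j<m. u \<notin> {grid s t m j<..grid s t m (Suc j)}"
    then have "(\<Sum>i<m. ?f i) = 0" by (intro sum.neutral) auto
    then show ?thesis by simp
  next
    assume "\<exists>j<m. u \<in> {grid s t m j<..grid s t m (Suc j)} \<and> (\<forall>i<m. i \<noteq> j \<longrightarrow> u \<notin> {grid s t m i<..grid s t m (Suc i)})"
    then obtain j where j: "j < m" "u \<in> {grid s t m j<..grid s t m (Suc j)}"
      "\<And>i. i < m \<Longrightarrow> i \<noteq> j \<Longrightarrow> u \<notin> {grid s t m i<..grid s t m (Suc i)}" by blast
    have eq: "(\<Sum>i<m. ?f i) = ?f j"
      by (rule sum_at_single[OF j(1)]) (use j(3) in simp)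
    have uin: "u \<in> {s..t}" using grid_in[OF st, of j m] grid_in[OF st, of "Suc j" m] j(1,2) by auto
    have "(weight N K s (grid s t m j) \<omega>)\<^sup>2 * (localized (\<lambda>p. p) P (grid s t m j) N u \<omega> - frozen N (grid s t m j) \<omega>)\<^sup>2
       \<le> (exp K)\<^sup>2 * (2 * N)\<^sup>2"
    proof (rule mult_mono)
      show "(weight N K s (grid s t m j) \<omega>)\<^sup>2 \<le> (exp K)\<^sup>2" by (intro power_mono weight_bound)
      have "\<bar>localized (\<lambda>p. p) P (grid s t m j) N u \<omega> - frozen N (grid s t m j) \<omega>\<bar> \<le> 2 * N"
        using localized_bound[OF N, of "grid s t m j" u \<omega>] frozen_bound[OF N, of "grid s t m j" \<omega>] j(2) by auto
      then show "(localized (\<lambda>p. p) P (grid s t m j) N u \<omega> - frozen N (grid s t m j) \<omega>)\<^sup>2 \<le> (2 * N)\<^sup>2"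
        by (intro abs_le_square_iff[THEN iffD1]) (use N in auto)
    qed auto
    then show ?thesis unfolding eq using uin j(2) by simp
  qed
qed

lemma freezing_error_expectation:
  assumes st: "a < s" "s \<le> t" "t \<le> b" and N: "N \<ge> 0"
  shows "(\<lambda>m. \<integral>\<^sup>+\<omega>. freezing_error N K s t m \<omega> \<partial>M) \<longlonglongrightarrow> 0"
    and "freezing_error N K s t m \<in> borel_measurable M"
proof -
  let ?C = "(exp K)\<^sup>2 * (2 * N)\<^sup>2"
  have wi: "(\<integral>\<^sup>+u. ennreal (?C * indicator {s..t} u) \<partial>lborel) = ennreal (?C * (t - s))"
  proof -
    have "(\<integral>\<^sup>+u. ennreal (?C * indicator {s..t} u) \<partial>lborel) = (\<integral>\<^sup>+u. ennreal ?C * indicator {s..t} u \<partial>lborel)"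
      by (intro nn_integral_cong) (auto simp: indicator_def)
    also have "\<dots> = ennreal ?C * ennreal (t - s)"
      using st by (simp add: nn_integral_cmult_indicator)
    finally show ?thesis using st by (simp add: ennreal_mult)
  qed
  have meas: "freezing_error N K s t m \<in> borel_measurable M" for m
  proof -
    have w: "weight N K s (grid s t m i) \<in> borel_measurable M" if "i < m" for i
      by (rule measurable_F_M[OF weight_measurable, of _ "grid s t m i"]) (use grid_bounds[OF st, of i m] that st in auto)
    show ?thesis unfolding freezing_error_def[abs_def]
      using w freezing_integrand_measurable(1)[OF st] by (intro borel_measurable_sum borel_measurable_times_ennreal) auto
  qed
  then show "freezing_error N K s t m \<in> borel_measurable M" .
  have le: "freezing_error N K s t m \<omega> \<le> ennreal (?C * (t - s))" if "\<omega> \<in> space M" for m \<omega>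
    unfolding freezing_error_eq(1)[OF st that] wi[symmetric]
    by (intro nn_integral_mono ennreal_leI freezing_integrand_bound st N)
  have pt: "(\<lambda>m. freezing_error N K s t m \<omega>) \<longlonglongrightarrow> 0"
    if \<omega>: "\<omega> \<in> space M" and rp: "restarting_path a b (\<lambda>t. P t \<omega>)" for \<omega>
  proof -
    let ?f = "\<lambda>m u. (\<Sum>i<m. (weight N K s (grid s t m i) \<omega>)\<^sup>2 *
     (localized (\<lambda>p. p) P (grid s t m i) N u \<omega> - frozen N (grid s t m i) \<omega>)\<^sup>2
      * indicator {grid s t m i<..grid s t m (Suc i)} u)"
    have fle: "?f m u \<le> ?C * indicator {s..t} u" for m u by (rule freezing_integrand_bound[OF st(2) N])
    have fnn: "0 \<le> ?f m u" for m u by (intro sum_nonneg) auto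
    have "(\<lambda>m. \<integral>\<^sup>+u. ennreal (?f m u) \<partial>lborel) \<longlonglongrightarrow> (\<integral>\<^sup>+u. 0 \<partial>(lborel :: real measure))"
    proof (rule nn_integral_dominated_convergence[where w = "\<lambda>u. ennreal (?C * indicator {s..t} u)"])
      show "(\<lambda>u. ennreal (?f m u)) \<in> borel_measurable lborel" for m by (rule freezing_error_eq(2)[OF st \<omega>])
      show "AE u in lborel. ennreal (?f m u) \<le> ennreal (?C * indicator {s..t} u)" for m
        by (intro AE_I2 ennreal_leI fle)
      show "(\<integral>\<^sup>+u. ennreal (?C * indicator {s..t} u) \<partial>lborel) < \<infinity>" unfolding wi by simp
      show "AE u in lborel. (\<lambda>m. ennreal (?f m u)) \<longlonglongrightarrow> 0"
        using AE_lborel_singleton[of s]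
      proof eventually_elim
        case (elim u)
        have "(\<lambda>m. ?f m u) \<longlonglongrightarrow> 0"
        proof (cases "u \<in> {s<..t}")
          case True
          then show ?thesis by (rule freezing_error_pointwise[OF st N rp])
        next
          case False
          then have "indicator {s..t} u = (0::real)" using elim by (auto simp: indicator_def)
          then have "?f m u = 0" for m using fle[of m u] fnn[of m u] by simp
          then show ?thesis by simp
        qed
        then show ?case using tendsto_ennrealI by fastforce
      qed
    qed auto
    then show ?thesis unfolding freezing_error_eq(1)[OF st \<omega>] by simp
  qed
  have "(\<lambda>m. \<integral>\<^sup>+\<omega>. freezing_error N K s t m \<omega> \<partial>M) \<longlonglongrightarrow> (\<integral>\<^sup>+\<omega>. 0 \<partial>M)"
  proof (rule nn_integral_dominated_convergence[where w = "\<lambda>_. ennreal (?C * (t - s))"])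
    show "AE \<omega> in M. freezing_error N K s t m \<omega> \<le> ennreal (?C * (t - s))" for m
      by (intro AE_I2 le)
    show "AE \<omega> in M. (\<lambda>m. freezing_error N K s t m \<omega>) \<longlonglongrightarrow> 0"
      using P_path AE_space by eventually_elim (rule pt)
    show "(\<integral>\<^sup>+\<omega>. ennreal (?C * (t - s)) \<partial>M) < \<infinity>"
      by (simp add: emeasure_space_1)
  qed (use meas in auto)
  then show "(\<lambda>m. \<integral>\<^sup>+\<omega>. freezing_error N K s t m \<omega> \<partial>M) \<longlonglongrightarrow> 0" by simp
qed

text \<open>Each of the m terms has second moment at most 2 C^2 ((t - s) / m)^2, and orthogonality
  adds them without further factors, which leaves order 1/m.\<close>

lemma quadratic_variation_L2:
  assumes st: "a < s" "s \<le> t" "t \<le> b" and m: "m > 0"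
    and g: "\<And>i. i < m \<Longrightarrow> g i \<in> borel_measurable (F (grid s t m i))"
    and gb: "\<And>i \<omega>. i < m \<Longrightarrow> \<omega> \<in> space M \<Longrightarrow> \<bar>g i \<omega>\<bar> \<le> C"
  shows "(\<integral>\<^sup>+\<omega>. ennreal ((\<Sum>i<m. g i \<omega> * ((W (grid s t m (Suc i)) \<omega> - W (grid s t m i) \<omega>)\<^sup>2 - (t - s) / real m))\<^sup>2) \<partial>M)
     \<le> ennreal (2 * C\<^sup>2 * (t - s)\<^sup>2 / real m)"
proof -
  let ?T = "grid s t m"
  let ?q = "\<lambda>i \<omega>. (W (?T (Suc i)) \<omega> - W (?T i) \<omega>)\<^sup>2 - (t - s) / real m"
  have b: "a \<le> ?T i" "?T i \<le> ?T (Suc i)" "?T (Suc i) \<le> b" if "i < m" for i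
    using grid_bounds[OF st, of i m] grid_bounds[OF st, of "Suc i" m] grid_mono[OF st(2), of i "Suc i" m] that by auto
  have q: "mdiff (?T i) (?T (Suc i)) (?q i)" "expectation (\<lambda>\<omega>. (?q i \<omega>)\<^sup>2) = 2 * ((t - s) / real m)\<^sup>2" if "i < m" for i
    using mdiff_quadratic[OF b[OF that]] unfolding grid_Suc .
  have D: "mdiff (?T i) (?T (Suc i)) (\<lambda>\<omega>. g i \<omega> * ?q i \<omega>)" if "i < m" for i
    by (rule mdiff_scale[OF b[OF that] q(1)[OF that] g[OF that] gb[OF that]])
  have "(\<integral>\<^sup>+\<omega>. ennreal ((\<Sum>i<m. g i \<omega> * ?q i \<omega>)\<^sup>2) \<partial>M) = (\<Sum>i<m. \<integral>\<^sup>+\<omega>. ennreal ((g i \<omega> * ?q i \<omega>)\<^sup>2) \<partial>M)"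
    by (rule mdiff_sum_nn[where T = ?T]) (use b D st grid_end[OF m, of s t] in auto)
  also have "\<dots> \<le> (\<Sum>i<m. ennreal (C\<^sup>2 * (2 * ((t - s) / real m)\<^sup>2)))"
  proof (rule sum_mono)
    fix i assume "i \<in> {..<m}"
    then have i: "i < m" by simp
    have qi: "integrable M (\<lambda>\<omega>. (?q i \<omega>)\<^sup>2)" using q(1)[OF i] by (auto simp: mdiff_def)
    have "(\<integral>\<^sup>+\<omega>. ennreal ((g i \<omega> * ?q i \<omega>)\<^sup>2) \<partial>M) \<le> (\<integral>\<^sup>+\<omega>. ennreal (C\<^sup>2 * (?q i \<omega>)\<^sup>2) \<partial>M)"
    proof (intro nn_integral_mono ennreal_leI)
      fix \<omega> assume "\<omega> \<in> space M"
      then have "(g i \<omega>)\<^sup>2 \<le> C\<^sup>2" using gb[OF i] by (meson abs_le_square_iff abs_ge_self order_trans)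
      then show "(g i \<omega> * ?q i \<omega>)\<^sup>2 \<le> C\<^sup>2 * (?q i \<omega>)\<^sup>2" by (simp add: power_mult_distrib mult_right_mono)
    qed
    also have "\<dots> = ennreal (expectation (\<lambda>\<omega>. C\<^sup>2 * (?q i \<omega>)\<^sup>2))"
      by (rule nn_integral_eq_integral) (use qi in auto)
    also have "expectation (\<lambda>\<omega>. C\<^sup>2 * (?q i \<omega>)\<^sup>2) = C\<^sup>2 * (2 * ((t - s) / real m)\<^sup>2)"
      using q(2)[OF i] by simp
    finally show "(\<integral>\<^sup>+\<omega>. ennreal ((g i \<omega> * ?q i \<omega>)\<^sup>2) \<partial>M) \<le> ennreal (C\<^sup>2 * (2 * ((t - s) / real m)\<^sup>2))" .
  qed
  also have "\<dots> = ennreal (\<Sum>i<m. C\<^sup>2 * (2 * ((t - s) / real m)\<^sup>2))"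
    by (rule sum_ennreal) auto
  also have "(\<Sum>i<m. C\<^sup>2 * (2 * ((t - s) / real m)\<^sup>2)) = 2 * C\<^sup>2 * (t - s)\<^sup>2 / real m"
    using m by (simp add: power2_eq_square field_simps)
  finally show ?thesis .
qed

text \<open>Ito's formula on the event where P and W - W a are bounded by N and K. The drift term
  P/2 cancels against the Ito correction, so neither a stochastic integral nor a linear term is left
  on the right.\<close>

lemma product_identity:
  assumes st: "a < s" "s \<le> t" "t \<le> b" and N: "N \<ge> 0"
  shows "AE \<omega> in M. (\<forall>v\<in>{s..t}. \<bar>P v \<omega>\<bar> \<le> ereal N) \<longrightarrow> (\<forall>v\<in>{s..t}. \<bar>W v \<omega> - W a \<omega>\<bar> \<le> K) \<longrightarrow>
    exp (- (W t \<omega> - W a \<omega>)) * real_of_ereal (P t \<omega>) - exp (- (W s \<omega> - W a \<omega>)) * real_of_ereal (P s \<omega>)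
     = integral {s..t} (\<lambda>u. exp (- (W u \<omega> - W a \<omega>)) * (- 2 * lam - (real_of_ereal (P u \<omega>))\<^sup>2))"
proof -
  let ?\<beta> = "\<lambda>\<omega> u. - 2 * lam - (real_of_ereal (P u \<omega>))\<^sup>2 + 1 / 2 * real_of_ereal (P u \<omega>)"
  define Q where "Q m i I \<longleftrightarrow> has_ito_integral M F W (grid s t m i) (grid s t m (Suc i)) (localized (\<lambda>p. p) P (grid s t m i) N) I \<and>
     (AE \<omega> in M. (\<forall>v\<in>{grid s t m i..grid s t m (Suc i)}. \<bar>P v \<omega>\<bar> \<le> ereal N) \<longrightarrow>
        real_of_ereal (P (grid s t m (Suc i)) \<omega>) - real_of_ereal (P (grid s t m i) \<omega>) =
        (LBINT u:{grid s t m i..grid s t m (Suc i)}. ?\<beta> \<omega> u) + I \<omega>)" for m i I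
  have b: "a < grid s t m i" "grid s t m i \<le> grid s t m (Suc i)" "grid s t m (Suc i) \<le> b" "grid s t m i \<in> {a<..b}"
      "s \<le> grid s t m i" "grid s t m i \<le> b" if "i < m" for m i
    using grid_bounds[OF st, of i m] grid_bounds[OF st, of "Suc i" m] grid_mono[OF st(2), of i "Suc i" m] that by auto
  have "\<exists>I. Q m i I" if "i < m" for m i
    unfolding Q_def by (rule P_ito[OF b(1-3)[OF that]])
  moreover define I where "I m i = (SOME J. Q m i J)" for m i
  ultimately have I: "Q m i (I m i)" if "i < m" for m i
    using that by (metis someI_ex)
  \<comment> \<open>A common bound for weights and frozen values, since the freezing estimate takes
    a single constant.\<close>
  define C where "C = exp K + N"
  have C: "exp K \<le> C" "N \<le> C" "C \<ge> 0" using N by (auto simp: C_def intro: add_nonneg_nonneg)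
  define dW where "dW m i \<omega> = W (grid s t m (Suc i)) \<omega> - W (grid s t m i) \<omega>" for m i \<omega>
  define wt where "wt m i = weight N K s (grid s t m i)" for m i
  define fr where "fr m i = frozen N (grid s t m i)" for m i
  define er where "er m i \<omega> = I m i \<omega> - fr m i \<omega> * dW m i \<omega>" for m i \<omega>
  have wtF: "wt m i \<in> borel_measurable (F (grid s t m i))" if "i < m" for m i
    unfolding wt_def by (rule weight_measurable) (use b[OF that] st in auto)
  have frF: "fr m i \<in> borel_measurable (F (grid s t m i))" if "i < m" for m i
    unfolding fr_def by (rule frozen_measurable) (use b[OF that] in auto)
  have wtM: "wt m i \<in> borel_measurable M" and frM: "fr m i \<in> borel_measurable M" if "i < m" for m i
    using measurable_F_M[OF wtF[OF that]] measurable_F_M[OF frF[OF that]] b[OF that] by auto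
  have wtC: "\<bar>wt m i \<omega>\<bar> \<le> C" for m i \<omega>
    unfolding wt_def using weight_bound[of N K s "grid s t m i" \<omega>] C(1) by linarith
  have frC: "\<bar>fr m i \<omega>\<bar> \<le> C" for m i \<omega>
    unfolding fr_def using frozen_bound[OF N, of "grid s t m i" \<omega>] C(2) by linarith
  have ito: "has_ito_integral M F W (grid s t m i) (grid s t m (Suc i)) (localized (\<lambda>p. p) P (grid s t m i) N) (I m i)"
    if "i < m" for m i using I[OF that] by (simp add: Q_def)
  have IM: "I m i \<in> borel_measurable M" if "i < m" for m i
    using ito[OF that] by (simp add: has_ito_integral_def)
  have erM: "er m i \<in> borel_measurable M" if "i < m" for m i
    unfolding er_def dW_def using IM[OF that] frM[OF that] by measurable
  \<comment> \<open>\<open>X1\<close> to \<open>X4\<close> are the four sums that the hypotheses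
    \<open>c1\<close> to \<open>c4\<close> of the pathwise formula require to vanish in the
    limit.\<close>
  define X1 where "X1 m \<omega> = (\<Sum>i<m. wt m i \<omega> * er m i \<omega>)" for m \<omega>
  define X2 where "X2 m \<omega> = (\<Sum>i<m. (wt m i \<omega> * er m i \<omega>)\<^sup>2)" for m \<omega>
  define X3 where "X3 m \<omega> = (\<Sum>i<m. (wt m i \<omega> * fr m i \<omega>) * ((dW m i \<omega>)\<^sup>2 - (t - s) / real m))" for m \<omega>
  define X4 where "X4 m \<omega> = (\<Sum>i<m. 1 * ((dW m i \<omega>)\<^sup>2 - (t - s) / real m))" for m \<omega>
  have XM: "X1 m \<in> borel_measurable M" "X2 m \<in> borel_measurable M" "X3 m \<in> borel_measurable M" "X4 m \<in> borel_measurable M" for m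
    unfolding X1_def[abs_def] X2_def[abs_def] X3_def[abs_def] X4_def[abs_def] dW_def
    using erM wtM frM
    by (auto intro!: borel_measurable_sum borel_measurable_times borel_measurable_diff borel_measurable_power W_measurable)
  define piece where "piece m i = (\<integral>\<^sup>+\<omega>. ennreal ((wt m i \<omega>)\<^sup>2) *
        (\<integral>\<^sup>+u\<in>{grid s t m i..grid s t m (Suc i)}. ennreal ((localized (\<lambda>p. p) P (grid s t m i) N u \<omega> - fr m i \<omega>)\<^sup>2) \<partial>lborel) \<partial>M)" for m i
  have piece: "(\<Sum>i<m. piece m i) = (\<integral>\<^sup>+\<omega>. freezing_error N K s t m \<omega> \<partial>M)" for m
    unfolding freezing_error_def piece_def wt_def fr_def
    using wtM freezing_integrand_measurable(1)[OF st]
    by (subst nn_integral_sum) (auto simp: wt_def intro!: borel_measurable_times_ennreal)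
  have E1: "(\<integral>\<^sup>+\<omega>. ennreal ((X1 m \<omega>)\<^sup>2) \<partial>M) \<le> 4 * (\<Sum>i<m. piece m i)" if "m > 0" for m
    unfolding X1_def er_def dW_def piece_def
    by (rule ito_integral_freezing_error[where C = C])
      (use b st grid_end[OF that, of s t] ito frF wtF frC wtC in auto)
  have E2: "(\<integral>\<^sup>+\<omega>. ennreal (X2 m \<omega>) \<partial>M) \<le> 4 * (\<Sum>i<m. piece m i)" for m
  proof -
    have "(\<integral>\<^sup>+\<omega>. ennreal (X2 m \<omega>) \<partial>M) = (\<integral>\<^sup>+\<omega>. (\<Sum>i<m. ennreal ((wt m i \<omega> * er m i \<omega>)\<^sup>2)) \<partial>M)"
      unfolding X2_def by (intro nn_integral_cong) (simp add: sum_ennreal)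
    also have "\<dots> = (\<Sum>i<m. \<integral>\<^sup>+\<omega>. ennreal ((wt m i \<omega> * er m i \<omega>)\<^sup>2) \<partial>M)"
      by (rule nn_integral_sum) (use wtM erM in auto)
    \<comment> \<open>For each cell the freezing estimate is applied to a sum with the single index
      j = 0.\<close>
    also have "\<dots> \<le> (\<Sum>i<m. 4 * piece m i)"
    proof (rule sum_mono)
      fix i assume "i \<in> {..<m}"
      then have i: "i < m" by simp
      have "(\<integral>\<^sup>+\<omega>. ennreal ((\<Sum>j<1. wt m (i + j) \<omega> * (I m (i + j) \<omega> - fr m (i + j) \<omega> *
          (W (grid s t m (i + Suc j)) \<omega> - W (grid s t m (i + j)) \<omega>)))\<^sup>2) \<partial>M)
         \<le> 4 * (\<Sum>j<1. \<integral>\<^sup>+\<omega>. ennreal ((wt m (i + j) \<omega>)\<^sup>2) *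
        (\<integral>\<^sup>+u\<in>{grid s t m (i + j)..grid s t m (i + Suc j)}. ennreal ((localized (\<lambda>p. p) P (grid s t m (i + j)) N u \<omega> - fr m (i + j) \<omega>)\<^sup>2) \<partial>lborel) \<partial>M)"
        by (rule ito_integral_freezing_error[where C = C and T = "\<lambda>j. grid s t m (i + j)" and I = "\<lambda>j. I m (i + j)"
              and H = "\<lambda>j. localized (\<lambda>p. p) P (grid s t m (i + j)) N"])
          (use b[OF i] ito[OF i] frF[OF i] wtF[OF i] frC wtC in auto)
      then show "(\<integral>\<^sup>+\<omega>. ennreal ((wt m i \<omega> * er m i \<omega>)\<^sup>2) \<partial>M) \<le> 4 * piece m i"
        unfolding er_def dW_def piece_def by simp
    qed
    finally show ?thesis by (simp add: sum_distrib_left)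
  qed
  have E3: "(\<integral>\<^sup>+\<omega>. ennreal ((X3 m \<omega>)\<^sup>2) \<partial>M) \<le> ennreal (2 * (C * C)\<^sup>2 * (t - s)\<^sup>2 / real m)" if "m > 0" for m
    unfolding X3_def dW_def
  proof (rule quadratic_variation_L2[OF st that])
    fix i assume i: "i < m"
    show "(\<lambda>\<omega>. wt m i \<omega> * fr m i \<omega>) \<in> borel_measurable (F (grid s t m i))"
      using wtF[OF i] frF[OF i] by measurable
    show "\<bar>wt m i \<omega> * fr m i \<omega>\<bar> \<le> C * C" for \<omega>
      unfolding abs_mult by (intro mult_mono wtC frC C(3)) auto
  qed
  have E4: "(\<integral>\<^sup>+\<omega>. ennreal ((X4 m \<omega>)\<^sup>2) \<partial>M) \<le> ennreal (2 * 1\<^sup>2 * (t - s)\<^sup>2 / real m)" if "m > 0" for m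
    unfolding X4_def dW_def by (rule quadratic_variation_L2[OF st that]) auto
  \<comment> \<open>One nonnegative sequence controls all four sums, so a single subsequence serves
    them all. The shift to Suc k keeps the number of cells positive.\<close>
  define Z where "Z k \<omega> = (X1 (Suc k) \<omega>)\<^sup>2 + X2 (Suc k) \<omega> + (X3 (Suc k) \<omega>)\<^sup>2 + (X4 (Suc k) \<omega>)\<^sup>2" for k \<omega>
  have X2nn: "X2 m \<omega> \<ge> 0" for m \<omega> unfolding X2_def by (intro sum_nonneg) simp
  have Zb: "(\<integral>\<^sup>+\<omega>. ennreal (Z k \<omega>) \<partial>M) \<le> 8 * (\<integral>\<^sup>+\<omega>. freezing_error N K s t (Suc k) \<omega> \<partial>M)
      + ennreal ((2 * (C * C)\<^sup>2 * (t - s)\<^sup>2 + 2 * (t - s)\<^sup>2) / real (Suc k))" for k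
  proof -
    note [measurable] = XM
    have "(\<integral>\<^sup>+\<omega>. ennreal (Z k \<omega>) \<partial>M) = (\<integral>\<^sup>+\<omega>. ennreal ((X1 (Suc k) \<omega>)\<^sup>2) + ennreal (X2 (Suc k) \<omega>)
        + ennreal ((X3 (Suc k) \<omega>)\<^sup>2) + ennreal ((X4 (Suc k) \<omega>)\<^sup>2) \<partial>M)"
      unfolding Z_def using X2nn by (intro nn_integral_cong) (simp add: ennreal_plus)
    also have "\<dots> = (\<integral>\<^sup>+\<omega>. ennreal ((X1 (Suc k) \<omega>)\<^sup>2) \<partial>M) + (\<integral>\<^sup>+\<omega>. ennreal (X2 (Suc k) \<omega>) \<partial>M)
        + (\<integral>\<^sup>+\<omega>. ennreal ((X3 (Suc k) \<omega>)\<^sup>2) \<partial>M) + (\<integral>\<^sup>+\<omega>. ennreal ((X4 (Suc k) \<omega>)\<^sup>2) \<partial>M)"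
      by (simp add: nn_integral_add)
    also have "\<dots> \<le> 4 * (\<Sum>i<Suc k. piece (Suc k) i) + 4 * (\<Sum>i<Suc k. piece (Suc k) i)
        + ennreal (2 * (C * C)\<^sup>2 * (t - s)\<^sup>2 / real (Suc k)) + ennreal (2 * 1\<^sup>2 * (t - s)\<^sup>2 / real (Suc k))"
      by (intro add_mono E1 E2 E3 E4) auto
    also have "4 * (\<Sum>i<Suc k. piece (Suc k) i) + 4 * (\<Sum>i<Suc k. piece (Suc k) i) = 8 * (\<integral>\<^sup>+\<omega>. freezing_error N K s t (Suc k) \<omega> \<partial>M)"
      unfolding piece distrib_right[symmetric] by simp
    finally show ?thesis
      by (simp add: add.assoc ennreal_plus[symmetric] add_divide_distrib del: ennreal_plus of_nat_Suc)
  qed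
  have "(\<lambda>k. \<integral>\<^sup>+\<omega>. ennreal (Z k \<omega>) \<partial>M) \<longlonglongrightarrow> 0"
  proof (rule tendsto_sandwich[OF _ _ tendsto_const])
    show "\<forall>\<^sub>F k in sequentially. (\<integral>\<^sup>+\<omega>. ennreal (Z k \<omega>) \<partial>M) \<le> 8 * (\<integral>\<^sup>+\<omega>. freezing_error N K s t (Suc k) \<omega> \<partial>M)
      + ennreal ((2 * (C * C)\<^sup>2 * (t - s)\<^sup>2 + 2 * (t - s)\<^sup>2) / real (Suc k))"
      using Zb by simp
    have l1: "(\<lambda>k. \<integral>\<^sup>+\<omega>. freezing_error N K s t (Suc k) \<omega> \<partial>M) \<longlonglongrightarrow> 0"
      by (rule LIMSEQ_Suc[OF freezing_error_expectation(1)[OF st N]])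
    have l2: "(\<lambda>k. ennreal ((2 * (C * C)\<^sup>2 * (t - s)\<^sup>2 + 2 * (t - s)\<^sup>2) / real (Suc k))) \<longlonglongrightarrow> ennreal 0"
      by (intro tendsto_ennrealI LIMSEQ_Suc[OF lim_const_over_n])
    have "(\<lambda>k. 8 * (\<integral>\<^sup>+\<omega>. freezing_error N K s t (Suc k) \<omega> \<partial>M)
      + ennreal ((2 * (C * C)\<^sup>2 * (t - s)\<^sup>2 + 2 * (t - s)\<^sup>2) / real (Suc k))) \<longlonglongrightarrow> 8 * 0 + ennreal 0"
      by (intro tendsto_add ennreal_tendsto_cmult l1 l2) simp
    then show "(\<lambda>k. 8 * (\<integral>\<^sup>+\<omega>. freezing_error N K s t (Suc k) \<omega> \<partial>M)
      + ennreal ((2 * (C * C)\<^sup>2 * (t - s)\<^sup>2 + 2 * (t - s)\<^sup>2) / real (Suc k))) \<longlonglongrightarrow> 0" by simp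
  qed simp
  moreover have "Z k \<in> borel_measurable M" for k unfolding Z_def[abs_def] using XM by measurable
  moreover have "Z k \<omega> \<ge> 0" for k \<omega> unfolding Z_def using X2nn by (intro add_nonneg_nonneg) auto
  ultimately obtain r :: "nat \<Rightarrow> nat" where r: "strict_mono r" and Zlim: "AE \<omega> in M. (\<lambda>k. Z (r k) \<omega>) \<longlonglongrightarrow> 0"
    using AE_subseq_of_nn_integral_tendsto_0[OF finite_measure_axioms, of Z] by blast
  \<comment> \<open>Only countably many grid cells occur, so their exceptional null sets can be
    united before a path is fixed.\<close>
  have AEeq: "AE \<omega> in M. \<forall>m i. i < m \<longrightarrow> (\<forall>v\<in>{grid s t m i..grid s t m (Suc i)}. \<bar>P v \<omega>\<bar> \<le> ereal N) \<longrightarrow>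
        real_of_ereal (P (grid s t m (Suc i)) \<omega>) - real_of_ereal (P (grid s t m i) \<omega>) =
        (LBINT u:{grid s t m i..grid s t m (Suc i)}. ?\<beta> \<omega> u) + I m i \<omega>"
    unfolding AE_all_countable using I by (auto simp: Q_def)
  from P_path W_continuous Zlim AEeq show ?thesis
  proof eventually_elim
    case (elim \<omega>)
    note rp = elim(1)
    show ?case
    proof (intro impI)
      assume PN: "\<forall>v\<in>{s..t}. \<bar>P v \<omega>\<bar> \<le> ereal N" and WK: "\<forall>v\<in>{s..t}. \<bar>W v \<omega> - W a \<omega>\<bar> \<le> K"
      define p where "p u = real_of_ereal (P u \<omega>)" for u
      define w where "w u = W u \<omega> - W a \<omega>" for u
      have cp: "continuous_on {s..t} p"
        unfolding p_def by (rule restarting_path_real_continuous[OF rp ab st]) (use PN in fastforce)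
      have cw: "continuous_on {s..t} w"
        unfolding w_def by (intro continuous_intros continuous_on_subset[OF elim(2)]) auto
      have cB: "continuous_on {s..t} (\<lambda>u. - 2 * lam - (p u)\<^sup>2 + 1 / 2 * p u)"
        by (intro continuous_intros cp)
      have gin: "grid s t m i \<in> {s..t}" if "i \<le> m" for m i by (rule grid_in[OF st(2) that])
      have fr: "fr m i \<omega> = p (grid s t m i)" if "i \<le> m" for m i
        using PN gin[OF that] by (simp add: fr_def frozen_def p_def)
      have wt: "wt m i \<omega> = exp (- w (grid s t m i))" if "i \<le> m" for m i
      proof -
        have "stays N s (grid s t m i) \<omega>" unfolding stays_def using PN gin[OF that] by auto
        then show ?thesis using WK gin[OF that] by (simp add: wt_def weight_def w_def)
      qed
      have dw: "dW m i \<omega> = w (grid s t m (Suc i)) - w (grid s t m i)" for m i by (simp add: dW_def w_def)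
      define mm where "mm k = Suc (r k)" for k
      have Xlim: "(\<lambda>k. X1 (mm k) \<omega>) \<longlonglongrightarrow> 0" "(\<lambda>k. X2 (mm k) \<omega>) \<longlonglongrightarrow> 0" "(\<lambda>k. X3 (mm k) \<omega>) \<longlonglongrightarrow> 0" "(\<lambda>k. X4 (mm k) \<omega>) \<longlonglongrightarrow> 0"
      proof -
        have sq: "Y \<longlonglongrightarrow> 0" if "\<And>k. (Y k)\<^sup>2 \<le> Z (r k) \<omega>" for Y :: "nat \<Rightarrow> real"
        proof -
          have "(\<lambda>k. (Y k)\<^sup>2) \<longlonglongrightarrow> 0"
            by (rule tendsto_sandwich[OF _ _ tendsto_const elim(3)]) (use that in auto)
          then have "(\<lambda>k. sqrt ((Y k)\<^sup>2)) \<longlonglongrightarrow> sqrt 0" by (rule tendsto_real_sqrt)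
          then show ?thesis by (simp add: tendsto_rabs_zero_iff)
        qed
        show "(\<lambda>k. X1 (mm k) \<omega>) \<longlonglongrightarrow> 0" by (rule sq) (use X2nn in \<open>auto simp: Z_def mm_def intro!: add_nonneg_nonneg\<close>)
        show "(\<lambda>k. X3 (mm k) \<omega>) \<longlonglongrightarrow> 0" by (rule sq) (use X2nn in \<open>auto simp: Z_def mm_def intro!: add_nonneg_nonneg\<close>)
        show "(\<lambda>k. X4 (mm k) \<omega>) \<longlonglongrightarrow> 0" by (rule sq) (use X2nn in \<open>auto simp: Z_def mm_def intro!: add_nonneg_nonneg\<close>)
        show "(\<lambda>k. X2 (mm k) \<omega>) \<longlonglongrightarrow> 0"
          by (rule tendsto_sandwich[OF _ _ tendsto_const elim(3)]) (use X2nn in \<open>auto simp: Z_def mm_def\<close>)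
      qed
      have "exp (- w t) * p t - exp (- w s) * p s = integral {s..t} (\<lambda>u. exp (- w u) * ((- 2 * lam - (p u)\<^sup>2 + 1 / 2 * p u) - p u / 2))"
      proof (rule product_formula_along_grids[OF st(2) cw cp cB, where m = mm and T = "\<lambda>k. grid s t (mm k)" and err = "\<lambda>k i. er (mm k) i \<omega>"])
        show "filterlim mm sequentially sequentially"
          unfolding mm_def by (intro filterlim_compose[OF filterlim_Suc] filterlim_subseq r)
        show "mm k > 0" for k by (simp add: mm_def)
        show "p (grid s t (mm k) (Suc i)) - p (grid s t (mm k) i) =
          integral {grid s t (mm k) i..grid s t (mm k) (Suc i)} (\<lambda>u. - 2 * lam - (p u)\<^sup>2 + 1 / 2 * p u) +
          p (grid s t (mm k) i) * (w (grid s t (mm k) (Suc i)) - w (grid s t (mm k) i)) + er (mm k) i \<omega>"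
          if i: "i < mm k" for k i
        proof -
          let ?J = "{grid s t (mm k) i..grid s t (mm k) (Suc i)}"
          have sub: "?J \<subseteq> {s..t}" using gin[of i "mm k"] gin[of "Suc i" "mm k"] i by auto
          have "p (grid s t (mm k) (Suc i)) - p (grid s t (mm k) i) = (LBINT u:?J. - 2 * lam - (p u)\<^sup>2 + 1 / 2 * p u) + I (mm k) i \<omega>"
          proof -
            have all: "\<forall>v\<in>?J. \<bar>P v \<omega>\<bar> \<le> ereal N" using PN sub by blast
            show ?thesis
              using elim(4)[THEN spec, THEN spec, THEN mp, OF i, THEN mp, OF all] unfolding p_def .
          qed
          also have "(LBINT u:?J. - 2 * lam - (p u)\<^sup>2 + 1 / 2 * p u) = integral ?J (\<lambda>u. - 2 * lam - (p u)\<^sup>2 + 1 / 2 * p u)"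
            by (rule set_borel_integral_eq_integral(2)[OF borel_integrable_atLeastAtMost'[OF continuous_on_subset[OF cB sub]]])
          also have "I (mm k) i \<omega> = p (grid s t (mm k) i) * (w (grid s t (mm k) (Suc i)) - w (grid s t (mm k) i)) + er (mm k) i \<omega>"
            using fr[of i "mm k"] i by (simp add: er_def dw)
          finally show ?thesis by simp
        qed
        show "(\<lambda>k. \<Sum>i<mm k. exp (- w (grid s t (mm k) i)) * er (mm k) i \<omega>) \<longlonglongrightarrow> 0"
        proof -
          have "X1 (mm k) \<omega> = (\<Sum>i<mm k. exp (- w (grid s t (mm k) i)) * er (mm k) i \<omega>)" for k
            unfolding X1_def by (intro sum.cong refl) (simp add: wt fr dw)
          then show ?thesis using Xlim(1) by simp
        qed
        show "(\<lambda>k. \<Sum>i<mm k. (exp (- w (grid s t (mm k) i)) * er (mm k) i \<omega>)\<^sup>2) \<longlonglongrightarrow> 0"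
        proof -
          have "X2 (mm k) \<omega> = (\<Sum>i<mm k. (exp (- w (grid s t (mm k) i)) * er (mm k) i \<omega>)\<^sup>2)" for k
            unfolding X2_def by (intro sum.cong refl) (simp add: wt fr dw)
          then show ?thesis using Xlim(2) by simp
        qed
        show "(\<lambda>k. \<Sum>i<mm k. exp (- w (grid s t (mm k) i)) * p (grid s t (mm k) i) *
          ((w (grid s t (mm k) (Suc i)) - w (grid s t (mm k) i))\<^sup>2 - (t - s) / real (mm k))) \<longlonglongrightarrow> 0"
        proof -
          have "X3 (mm k) \<omega> = (\<Sum>i<mm k. exp (- w (grid s t (mm k) i)) * p (grid s t (mm k) i) *
          ((w (grid s t (mm k) (Suc i)) - w (grid s t (mm k) i))\<^sup>2 - (t - s) / real (mm k)))" for k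
            unfolding X3_def by (intro sum.cong refl) (simp add: wt fr dw)
          then show ?thesis using Xlim(3) by simp
        qed
        show "(\<lambda>k. \<Sum>i<mm k. (w (grid s t (mm k) (Suc i)) - w (grid s t (mm k) i))\<^sup>2 - (t - s) / real (mm k)) \<longlonglongrightarrow> 0"
          using Xlim(4) unfolding X4_def by (simp add: dw cong: sum.cong)
      qed auto
      then show "exp (- (W t \<omega> - W a \<omega>)) * real_of_ereal (P t \<omega>) - exp (- (W s \<omega> - W a \<omega>)) * real_of_ereal (P s \<omega>)
        = integral {s..t} (\<lambda>u. exp (- (W u \<omega> - W a \<omega>)) * (- 2 * lam - (real_of_ereal (P u \<omega>))\<^sup>2))"
        unfolding p_def w_def by simp
    qed
  qed
qed

end

section \<open>From the integral identity to the differential equation\<close>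

lemma continuous_eq_on_rationals:
  fixes f g :: "real \<Rightarrow> real"
  assumes st: "s < t" and f: "continuous_on {s..t} f" and g: "continuous_on {s..t} g"
    and eq: "\<And>q. q \<in> \<rat> \<Longrightarrow> s < q \<Longrightarrow> q < t \<Longrightarrow> f q = g q" and u: "u \<in> {s..t}"
  shows "f u = g u"
proof (rule ccontr)
  assume ne: "f u \<noteq> g u"
  have "continuous_on {s..t} (\<lambda>v. f v - g v)" by (intro continuous_intros f g)
  then obtain d where d: "d > 0" "\<And>v. v \<in> {s..t} \<Longrightarrow> \<bar>v - u\<bar> < d \<Longrightarrow> \<bar>(f v - g v) - (f u - g u)\<bar> < \<bar>f u - g u\<bar>"
    using ne u unfolding continuous_on_iff dist_real_def by (metis right_minus_eq zero_less_abs_iff)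
  have "max s (u - d) < min t (u + d)" using d st u by auto
  then obtain q where q: "q \<in> \<rat>" "max s (u - d) < q" "q < min t (u + d)"
    using Rats_dense_in_real by blast
  then have "\<bar>(f q - g q) - (f u - g u)\<bar> < \<bar>f u - g u\<bar>" by (intro d(2)) auto
  then show False using eq[of q] q by auto
qed

context riccati_diffusion
begin

text \<open>Almost surely the identity holds for all rational times and natural bounds at once.
  Around a time without explosion the path is continuous, hence bounded by some N, and W - W a by
  some K; continuity extends the identity to all times there, and its continuous integrand allows
  differentiation.\<close>

lemma riccati_ode:
  "AE \<omega> in M. \<forall>t\<in>{a<..<b}. P t \<omega> \<noteq> -\<infinity> \<longrightarrow>
      ((\<lambda>t. exp (- W t \<omega>) * real_of_ereal (P t \<omega>)) has_real_derivative
        - (2 * lam * exp (- W t \<omega>)) - exp (W t \<omega>) * (exp (- W t \<omega>) * real_of_ereal (P t \<omega>))\<^sup>2) (at t)"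
proof -
  let ?id = "\<lambda>\<omega> s t. exp (- (W t \<omega> - W a \<omega>)) * real_of_ereal (P t \<omega>) - exp (- (W s \<omega> - W a \<omega>)) * real_of_ereal (P s \<omega>)
     = integral {s..t} (\<lambda>u. exp (- (W u \<omega> - W a \<omega>)) * (- 2 * lam - (real_of_ereal (P u \<omega>))\<^sup>2))"
  have "AE \<omega> in M. \<forall>s t :: rat. \<forall>N K :: nat. a < of_rat s \<longrightarrow> (of_rat s :: real) \<le> of_rat t \<longrightarrow> of_rat t \<le> b \<longrightarrow>
    (\<forall>v\<in>{of_rat s..of_rat t}. \<bar>P v \<omega>\<bar> \<le> ereal (real N)) \<longrightarrow> (\<forall>v\<in>{of_rat s..of_rat t}. \<bar>W v \<omega> - W a \<omega>\<bar> \<le> real K) \<longrightarrow>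
    ?id \<omega> (of_rat s) (of_rat t)"
    unfolding AE_all_countable
  proof (intro allI)
    fix s t :: rat and N K :: nat
    show "AE \<omega> in M. a < of_rat s \<longrightarrow> (of_rat s :: real) \<le> of_rat t \<longrightarrow> of_rat t \<le> b \<longrightarrow>
    (\<forall>v\<in>{of_rat s..of_rat t}. \<bar>P v \<omega>\<bar> \<le> ereal (real N)) \<longrightarrow> (\<forall>v\<in>{of_rat s..of_rat t}. \<bar>W v \<omega> - W a \<omega>\<bar> \<le> real K) \<longrightarrow>
    ?id \<omega> (of_rat s) (of_rat t)"
    proof (cases "a < of_rat s \<and> (of_rat s :: real) \<le> of_rat t \<and> of_rat t \<le> b")
      case True
      then show ?thesis
        using product_identity[of "of_rat s" "of_rat t" "real N" "real K"] by (auto elim: eventually_mono)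
    next
      case False
      then show ?thesis by auto
    qed
  qed
  from P_path W_continuous this show ?thesis
  proof eventually_elim
    case (elim \<omega>)
    note rp = elim(1)
    show ?case
    proof (intro ballI impI)
      fix t assume t: "t \<in> {a<..<b}" and Pt: "P t \<omega> \<noteq> -\<infinity>"
      define p where "p u = real_of_ereal (P u \<omega>)" for u
      define w where "w u = W u \<omega>" for u
      have "\<forall>\<^sub>F s in at t. P s \<omega> \<noteq> -\<infinity>"
        using explosions_isolated[OF rp ab, of t] t by (simp add: at_within_Icc_interior)
      then have "\<forall>\<^sub>F s in nhds t. P s \<omega> \<noteq> -\<infinity>" using Pt by (simp add: eventually_nhds_conv_at)
      then obtain d where d: "d > 0" "\<And>s. \<bar>s - t\<bar> < d \<Longrightarrow> P s \<omega> \<noteq> -\<infinity>"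
        unfolding eventually_nhds_metric dist_real_def by blast
      obtain s0 where s0: "s0 \<in> \<rat>" "max a (t - d) < s0" "s0 < t" using Rats_dense_in_real[of "max a (t - d)" t] t d by auto
      obtain t1 where t1: "t1 \<in> \<rat>" "t < t1" "t1 < min b (t + d)" using Rats_dense_in_real[of t "min b (t + d)"] t d by auto
      have st: "a < s0" "s0 \<le> t1" "t1 \<le> b" using s0 t1 by auto
      have fin: "P v \<omega> \<noteq> -\<infinity>" if "v \<in> {s0..t1}" for v
      proof (rule d(2))
        show "\<bar>v - t\<bar> < d" using that s0 t1 by auto
      qed
      have cp: "continuous_on {s0..t1} p"
        unfolding p_def by (rule restarting_path_real_continuous[OF rp ab st fin])
      have cw: "continuous_on {s0..t1} w" unfolding w_def by (rule continuous_on_subset[OF elim(2)]) simp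
      define f where "f u = exp (- w u) * (- 2 * lam - (p u)\<^sup>2)" for u
      define q where "q u = exp (- w u) * p u" for u
      have cf: "continuous_on {s0..t1} f" unfolding f_def by (intro continuous_intros cw cp)
      have cq: "continuous_on {s0..t1} q" unfolding q_def by (intro continuous_intros cw cp)
      obtain C1 where C1: "\<forall>u\<in>{s0..t1}. \<bar>p u\<bar> \<le> C1" using continuous_on_Icc_bounded[OF cp] by blast
      obtain C2 where C2: "\<forall>u\<in>{s0..t1}. \<bar>w u - w a\<bar> \<le> C2"
        using continuous_on_Icc_bounded[OF continuous_on_diff[OF cw continuous_on_const], of "w a"] by blast
      obtain N :: nat where N: "C1 \<le> real N" using real_arch_simple by blast
      obtain K :: nat where K: "C2 \<le> real K" using real_arch_simple by blast
      have PN: "\<bar>P v \<omega>\<bar> \<le> ereal (real N)" if v: "v \<in> {s0..t1}" for v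
      proof -
        have "\<bar>p v\<bar> \<le> real N" using C1 N v by force
        then show ?thesis using fin[OF v] restarting_path_not_top[OF rp ab, of v] v st
          unfolding p_def by (cases "P v \<omega>") auto
      qed
      have WK: "\<bar>W v \<omega> - W a \<omega>\<bar> \<le> real K" if v: "v \<in> {s0..t1}" for v
        using C2 K v unfolding w_def by force
      have rat: "q r - q s0 = integral {s0..r} f" if r: "r \<in> \<rat>" "s0 < r" "r < t1" for r
      proof -
        obtain s0' where s0': "s0 = of_rat s0'" using s0(1) by (rule Rats_cases)
        obtain r' where r': "r = of_rat r'" using r(1) by (rule Rats_cases)
        have "?id \<omega> s0 r"
          using elim(3)[rule_format, of s0' r' N K] PN WK r st unfolding s0'[symmetric] r'[symmetric] by auto
        \<comment> \<open>Passing from W - W a back to W multiplies both sides by the constant exp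
          (W a), which cancels.\<close>
        moreover have "exp (- (W u \<omega> - W a \<omega>)) = exp (w a) * exp (- w u)" for u
          unfolding w_def by (simp add: exp_add[symmetric])
        ultimately have "exp (w a) * q r - exp (w a) * q s0 = integral {s0..r} (\<lambda>u. exp (w a) * f u)"
          unfolding q_def f_def p_def by (simp only: mult.assoc)
        then have "exp (w a) * (q r - q s0) = exp (w a) * integral {s0..r} f"
          by (simp only: right_diff_distrib integral_mult_right)
        then show ?thesis by simp
      qed
      have all: "q u - q s0 = integral {s0..u} f" if u: "u \<in> {s0..t1}" for u
      proof (rule continuous_eq_on_rationals[OF _ _ _ rat u])
        show "s0 < t1" using s0 t1 by auto
        show "continuous_on {s0..t1} (\<lambda>u. q u - q s0)" by (intro continuous_intros cq)
        show "continuous_on {s0..t1} (\<lambda>u. integral {s0..u} f)"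
          by (rule indefinite_integral_continuous_1[OF integrable_continuous_interval[OF cf]])
      qed
      have tin: "t \<in> {s0..t1}" using s0 t1 by auto
      have "((\<lambda>u. q s0 + integral {s0..u} f) has_real_derivative f t) (at t within {s0..t1})"
        by (auto intro!: derivative_eq_intros integral_has_real_derivative[OF cf tin])
      then have "(q has_real_derivative f t) (at t within {s0..t1})"
      proof (rule has_field_derivative_transform_within[of _ _ _ _ 1])
        show "q s0 + integral {s0..u} f = q u" if "u \<in> {s0..t1}" for u using all[OF that] by linarith
      qed (use tin in auto)
      then have "(q has_real_derivative f t) (at t)" using s0 t1 by (simp add: at_within_Icc_interior)
      moreover have "f t = - (2 * lam * exp (- w t)) - exp (w t) * (exp (- w t) * p t)\<^sup>2"
      proof -
        have "exp (w t) * (exp (- w t) * p t)\<^sup>2 = (exp (w t) * exp (- w t)) * exp (- w t) * (p t)\<^sup>2"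
          by (simp only: power2_eq_square mult_ac)
        then show ?thesis unfolding f_def by (simp add: exp_minus_inverse algebra_simps)
      qed
      ultimately show "((\<lambda>t. exp (- W t \<omega>) * real_of_ereal (P t \<omega>)) has_real_derivative
        - (2 * lam * exp (- W t \<omega>)) - exp (W t \<omega>) * (exp (- W t \<omega>) * real_of_ereal (P t \<omega>))\<^sup>2) (at t)"
        unfolding q_def[abs_def] p_def w_def by simp
    qed
  qed
qed

end

section \<open>The path before an explosion at the right endpoint\<close>

lemma abs_ln_diff_le:
  fixes x y :: real
  assumes c: "c > 0" "x \<ge> c" "y \<ge> c"
  shows "\<bar>ln x - ln y\<bar> \<le> \<bar>x - y\<bar> / c"
proof -
  have p: "x > 0" "y > 0" using c by auto
  have d: "\<bar>x - y\<bar> / z \<le> \<bar>x - y\<bar> / c" if "z \<ge> c" for z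
    using that c by (intro divide_left_mono) auto
  have "ln x - ln y \<le> (x - y) / y" by (rule ln_diff_le[OF p])
  also have "\<dots> \<le> \<bar>x - y\<bar> / y" using p by (intro divide_right_mono) auto
  finally have 1: "ln x - ln y \<le> \<bar>x - y\<bar> / c" using d[OF c(3)] by linarith
  have "ln y - ln x \<le> (y - x) / x" by (rule ln_diff_le[OF p(2,1)])
  also have "\<dots> \<le> \<bar>x - y\<bar> / x" using p by (intro divide_right_mono) auto
  finally have 2: "ln y - ln x \<le> \<bar>x - y\<bar> / c" using d[OF c(2)] by linarith
  show ?thesis using 1 2 by linarith
qed

text \<open>
  The reciprocal \<open>R\<close> of the Riccati variable satisfies \<open>R' = e\<^sup>w + 2 \<lambda> e\<^sup>-\<^sup>w R\<^sup>2\<close> and vanishes at \<open>b\<close>, so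
  \<open>- R s\<close> is \<open>\<integral>\<^sub>s\<^sup>b e\<^sup>w\<close> up to \<open>O((b - s)\<^sup>3)\<close>.  Moving the lower limit from \<open>s = b - e - e\<^sup>3\<close> to \<open>b - e\<close>
  costs another \<open>O(e\<^sup>3)\<close>, and taking logarithms turns this into a relative error \<open>O(e\<^sup>2)\<close>.
\<close>

lemma explosion_asymptotics:
  assumes rp: "restarting_path a b p" and ab: "a < b" and cw: "continuous_on {a..b} w"
    and riccati: "\<And>t. t \<in> {a<..<b} \<Longrightarrow> p t \<noteq> -\<infinity> \<Longrightarrow>
      ((\<lambda>t. exp (- w t) * real_of_ereal (p t)) has_real_derivative
        - (2 * lam * exp (- w t)) - exp (w t) * (exp (- w t) * real_of_ereal (p t))\<^sup>2) (at t)"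
    and pb: "p b = -\<infinity>"
  shows "\<exists>C>0. \<exists>e0>0. \<forall>e. 0 < e \<and> e < e0 \<longrightarrow>
    \<bar>(w (b - e) - w (b - e - e ^ 3)) + ln (- real_of_ereal (p (b - e - e ^ 3)))
      + ln (integral {b - e..b} (\<lambda>u. exp (w u - w (b - e))))\<bar> \<le> C * e\<^sup>2"
proof -
  interpret continuous_potential w a b by unfold_locales (use ab cw in auto)
  obtain B0 where B0: "B0 > 0" "\<And>t. t \<in> {a..b} \<Longrightarrow> exp (w t) \<le> B0" "\<And>t. t \<in> {a..b} \<Longrightarrow> exp (- w t) \<le> B0"
    using exp_w_bound by blast
  define B where "B = max B0 1"
  have B: "B \<ge> 1" "\<And>t. t \<in> {a..b} \<Longrightarrow> exp (w t) \<le> B" "\<And>t. t \<in> {a..b} \<Longrightarrow> exp (- w t) \<le> B"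
    unfolding B_def using B0(2,3) by (simp_all add: le_max_iff_disj)
  have plim: "(p \<longlongrightarrow> -\<infinity>) (at_left b)" using restarting_path_left[OF rp ab, of b] pb ab by simp
  have "\<forall>\<^sub>F u in at_left b. p u < ereal (-1)" using plim unfolding tendsto_MInfty by blast
  moreover have "\<forall>\<^sub>F u in at_left b. p u \<noteq> -\<infinity>"
    using explosions_isolated[OF rp ab, of b] ab by (simp add: at_within_Icc_at_left)
  ultimately have "\<forall>\<^sub>F u in at_left b. p u < ereal (-1) \<and> p u \<noteq> -\<infinity>" by (rule eventually_conj)
  then obtain c0 where c0: "c0 < b" "\<And>u. c0 < u \<Longrightarrow> u < b \<Longrightarrow> p u < ereal (-1) \<and> p u \<noteq> -\<infinity>"
    unfolding eventually_at_left_field by blast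
  \<comment> \<open>Strictly between b and both a and \<open>c0\<close>. From c on the path lies
    below -1 until b, so its reciprocal is bounded.\<close>
  define c where "c = max (a / 2 + b / 2) (c0 / 2 + b / 2)"
  have c: "a < c" "c0 < c" "c < b" using ab c0(1) by (auto simp: c_def)
  define r where "r u = real_of_ereal (p u)" for u
  have r: "r u < -1" and pf: "p u \<noteq> -\<infinity>" if "c \<le> u" "u < b" for u
    using c0(2)[of u] c that unfolding r_def by (cases "p u"; auto)+
  have r_bot: "filterlim r at_bot (at_left b)"
    unfolding filterlim_at_bot_dense
  proof
    fix z :: real
    have "\<forall>\<^sub>F u in at_left b. p u < ereal z" using plim unfolding tendsto_MInfty by blast
    moreover have "\<forall>\<^sub>F u in at_left b. c < u \<and> u < b"
      using eventually_at_left_real[OF c(3)] by eventually_elim auto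
    ultimately show "\<forall>\<^sub>F u in at_left b. r u < z"
    proof eventually_elim
      case (elim u)
      then show ?case using pf[of u] unfolding r_def by (cases "p u") auto
    qed
  qed
  \<comment> \<open>The Riccati variable tends to -infinity at b, so its reciprocal extends
    continuously by 0, and the reciprocal equation has no singularity there.\<close>
  define R where "R u = (if u = b then 0 else exp (w u) / r u)" for u
  have Rneg: "R u \<le> 0" "\<bar>R u\<bar> \<le> B" if "u \<in> {c..b}" for u
  proof -
    show "R u \<le> 0" using r[of u] that by (auto simp: R_def divide_le_0_iff)
    show "\<bar>R u\<bar> \<le> B"
    proof (cases "u = b")
      case False
      then have ru: "r u < -1" using r[of u] that by auto
      have "\<bar>R u\<bar> = exp (w u) / \<bar>r u\<bar>" using False by (simp add: R_def)
      also have "\<dots> \<le> exp (w u) / 1" using ru by (intro divide_left_mono) auto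
      also have "\<dots> \<le> B" using B(2)[of u] that c by auto
      finally show ?thesis .
    qed (use B in \<open>auto simp: R_def\<close>)
  qed
  define R' where "R' u = 2 * lam * exp (- w u) * (R u)\<^sup>2 + exp (w u)" for u
  have dR: "(R has_real_derivative R' u) (at u)" if u: "c < u" "u < b" for u
  proof -
    have uab: "u \<in> {a<..<b}" using u c by auto
    have ru: "r u \<noteq> 0" using r[of u] u by auto
    have q0: "exp (- w u) * r u \<noteq> 0" using ru by simp
    have dq: "((\<lambda>t. exp (- w t) * r t) has_real_derivative
        - (2 * lam * exp (- w u)) - exp (w u) * (exp (- w u) * r u)\<^sup>2) (at u)"
      using riccati[OF uab] pf[of u] u unfolding r_def by auto
    have "((\<lambda>t. inverse (exp (- w t) * r t)) has_real_derivative
        - (inverse (exp (- w u) * r u) * (- (2 * lam * exp (- w u)) - exp (w u) * (exp (- w u) * r u)\<^sup>2) * inverse (exp (- w u) * r u))) (at u)"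
      by (rule DERIV_inverse'[OF dq q0])
    moreover have inv: "inverse (exp (- w t) * r t) = R t" if "t \<noteq> b" for t
      using that by (simp add: R_def exp_minus field_simps)
    moreover have "- (inverse (exp (- w u) * r u) * (- (2 * lam * exp (- w u)) - exp (w u) * (exp (- w u) * r u)\<^sup>2) * inverse (exp (- w u) * r u)) = R' u"
    proof -
      have iq: "R u * (exp (- w u) * r u) = 1" using inv[of u] u q0 by (metis left_inverse less_irrefl)
      have "- (R u * (- (2 * lam * exp (- w u)) - exp (w u) * (exp (- w u) * r u)\<^sup>2) * R u)
         = 2 * lam * exp (- w u) * (R u)\<^sup>2 + exp (w u) * (R u * (exp (- w u) * r u))\<^sup>2"
        by (simp add: power2_eq_square algebra_simps)
      then show ?thesis using inv[of u] u unfolding iq R'_def by simp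
    qed
    ultimately have "((\<lambda>t. inverse (exp (- w t) * r t)) has_real_derivative R' u) (at u)" by simp
    then show ?thesis
      by (rule has_field_derivative_transform_within_open[of _ _ _ "{..<b}"]) (use u inv in auto)
  qed
  define h where "h = (b - c) / 2"
  have h: "h > 0" "c < b - h" "b - h < b" using c by (auto simp: h_def field_simps)
  have wl: "(w \<longlongrightarrow> w b) (at_left b)"
  proof -
    have "(w \<longlongrightarrow> w b) (at b within {a..b})" using cw ab by (auto simp: continuous_on_def)
    then show ?thesis using ab by (simp add: at_within_Icc_at_left)
  qed
  have Rl: "(R \<longlongrightarrow> 0) (at_left b)"
  proof -
    have "((\<lambda>u. inverse (r u)) \<longlongrightarrow> 0) (at_left b)"
      by (rule filterlim_compose[OF tendsto_inverse_0])
        (use r_bot at_bot_le_at_infinity filterlim_mono in blast)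
    then have "((\<lambda>u. exp (w u) * inverse (r u)) \<longlongrightarrow> exp (w b) * 0) (at_left b)"
      by (intro tendsto_intros wl)
    moreover have "\<forall>\<^sub>F u in at_left b. exp (w u) * inverse (r u) = R u"
      using eventually_at_left_real[OF c(3)] by eventually_elim (auto simp: R_def divide_inverse)
    ultimately show ?thesis by (auto intro: Lim_transform_eventually)
  qed
  have cR: "continuous_on {b - h..b} R"
    unfolding continuous_on_def
  proof
    fix u assume u: "u \<in> {b - h..b}"
    show "(R \<longlongrightarrow> R u) (at u within {b - h..b})"
    proof (cases "u = b")
      case True
      then show ?thesis using Rl h by (simp add: at_within_Icc_at_left R_def)
    next
      case False
      then have "isCont R u" using dR[of u] u h by (intro DERIV_isCont) auto
      then show ?thesis unfolding isCont_def by (rule tendsto_within_subset) simp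
    qed
  qed
  have uab: "u \<in> {a..b}" "u \<in> {c..b}" if "u \<in> {b - h..b}" for u using that h c by auto
  define C1 where "C1 = 2 * \<bar>lam\<bar> * B * B\<^sup>2 + B"
  have C1: "C1 \<ge> 0" using B(1) by (simp add: C1_def)
  have m: "\<bar>2 * lam * exp (- w u)\<bar> \<le> 2 * \<bar>lam\<bar> * B" if "u \<in> {b - h..b}" for u
    unfolding abs_mult using B(3)[OF uab(1)[OF that]] by (intro mult_mono) auto
  have R'b: "R' u \<le> C1" if u: "u \<in> {b - h..b}" for u
  proof -
    have "(R u)\<^sup>2 \<le> B\<^sup>2" using Rneg(2)[OF uab(2)[OF u]] by (meson abs_le_square_iff abs_ge_self order_trans)
    then have "\<bar>2 * lam * exp (- w u)\<bar> * (R u)\<^sup>2 \<le> 2 * \<bar>lam\<bar> * B * B\<^sup>2"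
      using B(1) by (intro mult_mono m[OF u]) auto
    then have "2 * lam * exp (- w u) * (R u)\<^sup>2 \<le> 2 * \<bar>lam\<bar> * B * B\<^sup>2"
      by (meson abs_ge_self dual_order.trans mult_right_mono zero_le_power2)
    then show ?thesis using B(2)[OF uab(1)[OF u]] by (simp add: R'_def C1_def)
  qed
  \<comment> \<open>A first, linear bound. Inserted into the equation it makes the term quadratic in
    R of order (b - s)^2, so that after integration R differs from the integral of exp w by a cubic
    error.\<close>
  have Rlin: "\<bar>R u\<bar> \<le> C1 * (b - u)" if u: "u \<in> {b - h..b}" for u
  proof -
    have "R b - C1 * b \<le> R u - C1 * u"
    proof (rule decreasing_on_Icc_finite_exceptions[of "{}" u b "\<lambda>u. R u - C1 * u" "\<lambda>u. R' u - C1"])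
      show "continuous_on {u..b} (\<lambda>u. R u - C1 * u)"
        by (intro continuous_intros continuous_on_subset[OF cR]) (use u in auto)
      fix v assume "v \<in> {u<..<b} - {}"
      then have v: "c < v" "v < b" "v \<in> {b - h..b}" using u h by auto
      show "((\<lambda>u. R u - C1 * u) has_real_derivative R' v - C1) (at v)"
        by (auto intro!: derivative_eq_intros dR v)
      show "R' v - C1 \<le> 0" using R'b[OF v(3)] by simp
    qed (use u in auto)
    then show ?thesis using Rneg(1)[OF uab(2)[OF u]] by (simp add: R_def algebra_simps abs_if)
  qed
  have ce: "continuous_on {b - h..b} (\<lambda>u. exp (w u))"
    by (intro continuous_intros continuous_on_subset[OF cw]) (use uab in auto)
  have ie: "(\<lambda>u. exp (w u)) integrable_on {x..y}" if "b - h \<le> x" "y \<le> b" for x y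
    by (intro integrable_continuous_interval continuous_on_subset[OF ce]) (use that in auto)
  define D where "D u = R u - integral {b - h..u} (\<lambda>u. exp (w u))" for u
  have cD: "continuous_on {b - h..b} D"
    unfolding D_def by (intro continuous_intros cR indefinite_integral_continuous_1 ie) auto
  have dD: "(D has_real_derivative 2 * lam * exp (- w u) * (R u)\<^sup>2) (at u)" if u: "b - h < u" "u < b" for u
  proof -
    have "((\<lambda>u. integral {b - h..u} (\<lambda>u. exp (w u))) has_real_derivative exp (w u)) (at u within {b - h..b})"
      by (rule integral_has_real_derivative[OF ce]) (use u in auto)
    then have "((\<lambda>u. integral {b - h..u} (\<lambda>u. exp (w u))) has_real_derivative exp (w u)) (at u)"
      using u by (simp add: at_within_Icc_interior)
    moreover have "(R has_real_derivative R' u) (at u)" by (rule dR) (use u h in auto)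
    ultimately have "(D has_real_derivative R' u - exp (w u)) (at u)"
      unfolding D_def by (intro DERIV_diff)
    then show ?thesis by (simp add: R'_def)
  qed
  define C2 where "C2 = 2 * \<bar>lam\<bar> * B * C1\<^sup>2"
  have C2: "C2 \<ge> 0" using B(1) by (simp add: C2_def)
  have Dcub: "\<bar>- R s - integral {s..b} (\<lambda>u. exp (w u))\<bar> \<le> C2 * (b - s) ^ 3" if s: "b - h \<le> s" "s \<le> b" for s
  proof -
    define K where "K = C2 * (b - s)\<^sup>2"
    have D': "\<bar>2 * lam * exp (- w u) * (R u)\<^sup>2\<bar> \<le> K" if u: "s < u" "u < b" for u
    proof -
      have u': "u \<in> {b - h..b}" using u s by auto
      have "\<bar>R u\<bar> \<le> C1 * (b - s)"
        using Rlin[OF u'] mult_left_mono[of "b - u" "b - s" C1] C1 u by linarith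
      then have "(R u)\<^sup>2 \<le> (C1 * (b - s))\<^sup>2" by (meson abs_le_square_iff abs_ge_self order_trans)
      then have "\<bar>2 * lam * exp (- w u)\<bar> * (R u)\<^sup>2 \<le> (2 * \<bar>lam\<bar> * B) * (C1 * (b - s))\<^sup>2"
        using B(1) by (intro mult_mono m[OF u']) auto
      then show ?thesis by (simp add: K_def C2_def abs_mult power_mult_distrib mult_ac)
    qed
    have cDs: "continuous_on {s..b} D" by (rule continuous_on_subset[OF cD]) (use s in auto)
    have "D b - K * b \<le> D s - K * s"
    proof (rule decreasing_on_Icc_finite_exceptions[of "{}" s b "\<lambda>u. D u - K * u" "\<lambda>u. 2 * lam * exp (- w u) * (R u)\<^sup>2 - K"])
      fix u assume "u \<in> {s<..<b} - {}"
      then have u: "s < u" "u < b" "b - h < u" using s by auto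
      show "((\<lambda>u. D u - K * u) has_real_derivative 2 * lam * exp (- w u) * (R u)\<^sup>2 - K) (at u)"
        by (rule derivative_eq_intros dD u refl)+ simp
      show "2 * lam * exp (- w u) * (R u)\<^sup>2 - K \<le> 0" using D'[OF u(1,2)] by linarith
    qed (use s in \<open>auto intro!: continuous_intros cDs\<close>)
    moreover have "- D b - K * b \<le> - D s - K * s"
    proof (rule decreasing_on_Icc_finite_exceptions[of "{}" s b "\<lambda>u. - D u - K * u" "\<lambda>u. - (2 * lam * exp (- w u) * (R u)\<^sup>2) - K"])
      fix u assume "u \<in> {s<..<b} - {}"
      then have u: "s < u" "u < b" "b - h < u" using s by auto
      show "((\<lambda>u. - D u - K * u) has_real_derivative - (2 * lam * exp (- w u) * (R u)\<^sup>2) - K) (at u)"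
        by (rule derivative_eq_intros dD u refl)+ simp
      show "- (2 * lam * exp (- w u) * (R u)\<^sup>2) - K \<le> 0" using D'[OF u(1,2)] by linarith
    qed (use s in \<open>auto intro!: continuous_intros cDs\<close>)
    ultimately have "\<bar>D b - D s\<bar> \<le> K * (b - s)" by (simp add: algebra_simps abs_le_iff)
    moreover have "D b - D s = - R s - integral {s..b} (\<lambda>u. exp (w u))"
      using Henstock_Kurzweil_Integration.integral_combine[OF s ie] by (simp add: D_def R_def)
    ultimately show ?thesis by (simp add: K_def power3_eq_cube power2_eq_square mult_ac)
  qed
  \<comment> \<open>The part 8 C2 comes from (b - s)^3 \<le> (2 e)^3, the part B from the integral
    over the window of length e^3.\<close>
  define C3 where "C3 = 8 * C2 + B"
  have C3: "C3 > 0" using C2 B(1) by (simp add: C3_def)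
  \<comment> \<open>The three bounds on e give in turn e^3 \<le> e, room for s inside the interval,
    and C3 e^3 \<le> e / (2 B). The last keeps x above half of the lower bound e / B of y, so that
    logarithms can be compared.\<close>
  define e0 where "e0 = min (min 1 (h / 2)) (1 / (2 * B * C3))"
  have e0: "e0 > 0" using h C3 B(1) by (simp add: e0_def)
  have main: "\<bar>(w (b - e) - w (b - e - e ^ 3)) + ln (- r (b - e - e ^ 3))
      + ln (integral {b - e..b} (\<lambda>u. exp (w u - w (b - e))))\<bar> \<le> (2 * B * C3) * e\<^sup>2" if e: "0 < e" "e < e0" for e
  proof -
    define s' s where "s' = b - e" and "s = b - e - e ^ 3"
    have e1: "e < 1" "e < h / 2" "e < 1 / (2 * B * C3)" using e by (auto simp: e0_def)
    have e3: "0 < e ^ 3" "e ^ 3 \<le> e" using e e1 power_decreasing[of 1 3 e] by auto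
    have ss: "b - h \<le> s" "s < s'" "s' < b" "b - h \<le> s'" "b - s \<le> 2 * e" using e e1 e3 by (auto simp: s_def s'_def)
    define x y where "x = - R s" and "y = integral {s'..b} (\<lambda>u. exp (w u))"
    have Rs: "R s = exp (w s) / r s" using ss by (simp add: R_def)
    have rs: "r s < -1" using r[of s] ss h by auto
    have split: "integral {s..b} (\<lambda>u. exp (w u)) = integral {s..s'} (\<lambda>u. exp (w u)) + y"
      unfolding y_def using Henstock_Kurzweil_Integration.integral_combine[of s s' b "\<lambda>u. exp (w u)"] ie ss by simp
    have small: "0 \<le> integral {s..s'} (\<lambda>u. exp (w u))" "integral {s..s'} (\<lambda>u. exp (w u)) \<le> B * e ^ 3"
    proof -
      show "0 \<le> integral {s..s'} (\<lambda>u. exp (w u))" by (rule integral_nonneg[OF ie]) (use ss in auto)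
      have "integral {s..s'} (\<lambda>u. exp (w u)) \<le> integral {s..s'} (\<lambda>u. B)"
        by (rule integral_le[OF ie]) (use ss B(2) uab in auto)
      then show "integral {s..s'} (\<lambda>u. exp (w u)) \<le> B * e ^ 3" using ss by (simp add: s_def s'_def mult_ac)
    qed
    have "\<bar>x - integral {s..b} (\<lambda>u. exp (w u))\<bar> \<le> C2 * (2 * e) ^ 3"
    proof -
      have "C2 * (b - s) ^ 3 \<le> C2 * (2 * e) ^ 3" using ss C2 by (intro mult_left_mono power_mono) auto
      then show ?thesis using Dcub[of s] ss unfolding x_def by linarith
    qed
    then have xy: "\<bar>x - y\<bar> \<le> C3 * e ^ 3"
      using small split unfolding C3_def by (simp add: power_mult_distrib algebra_simps abs_le_iff)
    have ylow: "y \<ge> e / B"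
    proof -
      have "integral {s'..b} (\<lambda>u. 1 / B) \<le> y"
        unfolding y_def
      proof (rule integral_le[OF _ ie])
        fix u assume u: "u \<in> {s'..b}"
        then have "exp (- w u) \<le> B" using B(3) uab(1) ss by auto
        then have "1 / B \<le> 1 / exp (- w u)" using B(1) by (intro divide_left_mono) auto
        then show "1 / B \<le> exp (w u)" by (simp add: exp_minus field_simps)
      qed (use ss in auto)
      then show ?thesis using ss e by (simp add: s'_def)
    qed
    have "C3 * e ^ 3 \<le> e / (2 * B)"
    proof -
      have "C3 * e * (2 * B) \<le> 1" using e1(3) C3 B(1) by (simp add: field_simps)
      then have "(C3 * e * (2 * B)) * e\<^sup>2 \<le> 1 * e\<^sup>2" by (rule mult_right_mono) simp
      also have "\<dots> \<le> e" using e e1 by (simp add: power2_eq_square mult_le_one)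
      finally show ?thesis using B(1) by (simp add: power3_eq_cube power2_eq_square field_simps)
    qed
    moreover have eB: "e / B = e / (2 * B) + e / (2 * B)" by simp
    ultimately have xlow: "x \<ge> e / (2 * B)" using xy ylow by linarith
    have ylow': "y \<ge> e / (2 * B)" using ylow eB e B(1) by (smt (verit) divide_nonneg_nonneg)
    have "\<bar>ln x - ln y\<bar> \<le> \<bar>x - y\<bar> / (e / (2 * B))"
      by (rule abs_ln_diff_le[OF _ xlow ylow']) (use e B(1) in auto)
    also have "\<dots> \<le> (C3 * e ^ 3) / (e / (2 * B))" using xy e B(1) by (intro divide_right_mono) auto
    also have "\<dots> = (2 * B * C3) * e\<^sup>2" using e B(1) by (simp add: power3_eq_cube power2_eq_square field_simps)
    finally have lnxy: "\<bar>ln x - ln y\<bar> \<le> (2 * B * C3) * e\<^sup>2" .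
    have "ln x = w s - ln (- r s)"
    proof -
      have "x = exp (w s) / (- r s)" unfolding x_def Rs by simp
      also have "ln \<dots> = ln (exp (w s)) - ln (- r s)" using ln_divide_pos[of "exp (w s)" "- r s"] rs by simp
      finally show ?thesis by simp
    qed
    moreover have "ln y = w s' + ln (integral {s'..b} (\<lambda>u. exp (w u - w s')))"
    proof -
      have "y = integral {s'..b} (\<lambda>u. exp (w s') * exp (w u - w s'))"
        unfolding y_def by (simp add: exp_add[symmetric])
      then have yJ: "y = exp (w s') * integral {s'..b} (\<lambda>u. exp (w u - w s'))" by simp
      have "0 < e / B" using e B(1) by simp
      then have "y > 0" using ylow by linarith
      then have "integral {s'..b} (\<lambda>u. exp (w u - w s')) > 0" unfolding yJ by (simp add: zero_less_mult_iff)
      then show ?thesis unfolding yJ by (simp add: ln_mult)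
    qed
    ultimately show ?thesis using lnxy unfolding s_def s'_def by (simp add: abs_le_iff algebra_simps)
  qed
  show ?thesis
    using main e0 C3 B(1) unfolding r_def by (intro exI[of _ "2 * B * C3"] conjI exI[of _ e0]) auto
qed

section \<open>No explosion at the right endpoint\<close>

context brownian
begin

text \<open>X is measurable for a filtration that may be larger than that of W, so joint
  independence is derived from the filtration: the last increment is peeled off, all earlier
  variables being measurable at its starting time.\<close>

lemma indep_initial_and_increments:
  fixes X :: "'w \<Rightarrow> real" and T :: "nat \<Rightarrow> real"
  assumes X: "X \<in> borel_measurable (F (T 0))"
    and T: "\<And>i. i < n \<Longrightarrow> T i \<le> T (Suc i)" "a \<le> T 0" "T n \<le> b"
  defines "Z \<equiv> \<lambda>i \<omega>. case i of 0 \<Rightarrow> X \<omega> | Suc j \<Rightarrow> W (T (Suc j)) \<omega> - W (T j) \<omega>"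
  shows "indep_vars (\<lambda>_. borel) Z {..n}"
proof -
  have Tb: "a \<le> T i" "T i \<le> b" if "i \<le> n" for i
    using mono_grid[of n T 0 i] mono_grid[of n T i n] T that by force+
  have ZF: "Z i \<in> borel_measurable (F (T i))" if "i \<le> n" for i
  proof (cases i)
    case (Suc j)
    then show ?thesis using increment_measurable_F[of "T j" "T i"] Tb[of j] Tb[of i] T(1)[of j] that
      by (simp add: Z_def)
  qed (use X in \<open>simp add: Z_def\<close>)
  have ZM: "Z i \<in> borel_measurable M" if "i \<le> n" for i
    by (rule measurable_F_M[OF ZF[OF that]]) (use Tb[OF that] in auto)
  have key: "(\<Inter>i\<le>m. Z i -` A i \<inter> space M) \<in> sets (F (T m)) \<and>
      prob (\<Inter>i\<le>m. Z i -` A i \<inter> space M) = (\<Prod>i\<le>m. prob (Z i -` A i \<inter> space M))"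
    if "m \<le> n" "\<And>i. A i \<in> sets borel" for m and A :: "nat \<Rightarrow> real set"
    using that(1)
  proof (induction m)
    case 0
    then show ?case using measurable_sets[OF ZF[of 0] that(2)[of 0]] by simp
  next
    case (Suc m)
    let ?E = "\<Inter>i\<le>m. Z i -` A i \<inter> space M" and ?B = "Z (Suc m) -` A (Suc m) \<inter> space M"
    have IH: "?E \<in> sets (F (T m))" "prob ?E = (\<Prod>i\<le>m. prob (Z i -` A i \<inter> space M))" using Suc by auto
    have eq: "(\<Inter>i\<le>Suc m. Z i -` A i \<inter> space M) = ?E \<inter> ?B" by (simp add: atMost_Suc Int_commute)
    have le: "T m \<le> T (Suc m)" using T(1)[of m] Suc.prems by simp
    have E2: "?E \<in> sets (F (T (Suc m)))" using IH(1) sets_F_mono[OF le] by blast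
    have B: "?B \<in> sets (F (T (Suc m)))" using measurable_sets[OF ZF[OF Suc.prems] that(2)[of "Suc m"]] by simp
    have Bin: "?B \<in> {(\<lambda>\<omega>. W (T (Suc m)) \<omega> - W (T m) \<omega>) -` A \<inter> space M | A. A \<in> sets borel}"
      unfolding Z_def using that(2)[of "Suc m"] by auto
    have "indep_set (sets (F (T m))) {(\<lambda>\<omega>. W (T (Suc m)) \<omega> - W (T m) \<omega>) -` A \<inter> space M | A. A \<in> sets borel}"
      by (rule increment_indep_set) (use Tb[of m] Tb[of "Suc m"] le Suc.prems in auto)
    then have "prob (?E \<inter> ?B) = prob ?E * prob ?B" using IH(1) Bin by (rule indep_setD)
    then show ?case unfolding eq using E2 B IH(2) by (simp add: atMost_Suc mult.commute sets.Int)
  qed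
  have "indep_sets (\<lambda>i. {Z i -` A \<inter> space M |A. A \<in> sets borel}) {..n}"
  proof (subst indep_sets_finite)
    show "{Z i -` A \<inter> space M |A. A \<in> sets borel} \<subseteq> events" if "i \<in> {..n}" for i
      using measurable_sets[OF ZM[of i]] that by auto
    show "space M \<in> {Z i -` A \<inter> space M |A. A \<in> sets borel}" for i
      by (intro CollectI exI[of _ UNIV]) auto
    show "\<forall>B\<in>Pi {..n} (\<lambda>i. {Z i -` A \<inter> space M |A. A \<in> sets borel}). prob (\<Inter> (B ` {..n})) = (\<Prod>j\<le>n. prob (B j))"
    proof
      fix B assume B: "B \<in> Pi {..n} (\<lambda>i. {Z i -` A \<inter> space M |A. A \<in> sets borel})"
      have "\<forall>i. \<exists>A. A \<in> sets borel \<and> (i \<le> n \<longrightarrow> B i = Z i -` A \<inter> space M)"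
      proof
        fix i show "\<exists>A. A \<in> sets borel \<and> (i \<le> n \<longrightarrow> B i = Z i -` A \<inter> space M)"
        proof (cases "i \<le> n")
          case True
          then have "B i \<in> {Z i -` A \<inter> space M |A. A \<in> sets borel}" using B by auto
          then show ?thesis by auto
        qed auto
      qed
      then obtain A where A: "\<And>i. A i \<in> sets borel" "\<And>i. i \<le> n \<Longrightarrow> B i = Z i -` A i \<inter> space M" by metis
      have "\<Inter> (B ` {..n}) = (\<Inter>i\<le>n. Z i -` A i \<inter> space M)" using A(2) by (intro INF_cong) auto
      moreover have "(\<Prod>j\<le>n. prob (B j)) = (\<Prod>i\<le>n. prob (Z i -` A i \<inter> space M))" using A(2) by (intro prod.cong) auto
      ultimately show "prob (\<Inter> (B ` {..n})) = (\<Prod>j\<le>n. prob (B j))" using key[of n A] A(1) by simp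
    qed
  qed auto
  then show ?thesis unfolding indep_vars_def2 using ZM by auto
qed

text \<open>Given V, the Gaussian increment has to fall into an interval of length 2 \<eta>, and its
  density is at most 1 / sqrt (2 pi (t - s)). Independence allows integration over V by
  Fubini.\<close>

lemma increment_anti_concentration:
  assumes st: "s < t" and iv: "indep_var borel (\<lambda>\<omega>. W t \<omega> - W s \<omega>) borel V" and \<eta>: "\<eta> \<ge> 0"
  shows "prob {\<omega> \<in> space M. \<bar>(W t \<omega> - W s \<omega>) + V \<omega>\<bar> \<le> \<eta>} \<le> 2 * \<eta> / sqrt (2 * pi * (t - s))"
proof -
  define G where "G \<omega> = W t \<omega> - W s \<omega>" for \<omega>
  define \<sigma> where "\<sigma> = sqrt (t - s)"
  define c where "c = 1 / sqrt (2 * pi * (t - s))"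
  have c: "c \<ge> 0" using st by (simp add: c_def)
  have [measurable]: "G \<in> borel_measurable M" unfolding G_def by measurable
  have iv: "indep_var borel G borel V" using iv unfolding G_def .
  have [measurable]: "V \<in> borel_measurable M" using indep_var_rv2[OF iv] .
  interpret D1: prob_space "distr M borel G" by (rule prob_space_distr) simp
  interpret D2: prob_space "distr M borel V" by (rule prob_space_distr) simp
  interpret pair_sigma_finite "distr M borel G" "distr M borel V" ..
  let ?S = "{x :: real \<times> real. \<bar>fst x + snd x\<bar> \<le> \<eta>}"
  have S0: "?S \<in> sets (borel \<Otimes>\<^sub>M borel)"
  proof -
    have "{x \<in> space (borel \<Otimes>\<^sub>M borel). \<bar>fst x + snd x\<bar> \<le> \<eta>} \<in> sets (borel \<Otimes>\<^sub>M (borel :: real measure) :: (real \<times> real) measure)"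
      by measurable
    then show ?thesis by (simp add: space_pair_measure)
  qed
  have S: "?S \<in> sets (distr M borel G \<Otimes>\<^sub>M distr M borel V)"
    using S0 by (simp cong: sets_pair_measure_cong)
  have D: "distributed M lborel G (normal_density 0 \<sigma>)"
    using increment_distributed[OF st] by (simp add: G_def[abs_def] \<sigma>_def)
  have slice: "emeasure (distr M borel G) ((\<lambda>g. (g, v)) -` ?S) \<le> ennreal (2 * \<eta> * c)" for v
  proof -
    have eq: "(\<lambda>g. (g, v)) -` ?S = {- \<eta> - v..\<eta> - v}" by (auto simp: abs_le_iff)
    have "emeasure (distr M borel G) {- \<eta> - v..\<eta> - v} = emeasure M (G -` {- \<eta> - v..\<eta> - v} \<inter> space M)"
      by (rule emeasure_distr) auto
    also have "\<dots> = (\<integral>\<^sup>+x. ennreal (normal_density 0 \<sigma> x) * indicator {- \<eta> - v..\<eta> - v} x \<partial>lborel)"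
      by (rule distributed_emeasure[OF D]) simp
    also have "\<dots> \<le> (\<integral>\<^sup>+x. ennreal c * indicator {- \<eta> - v..\<eta> - v} x \<partial>lborel)"
    proof (intro nn_integral_mono mult_right_mono ennreal_leI)
      fix x :: real
      have "normal_density 0 \<sigma> x \<le> c * 1"
        unfolding normal_density_def c_def \<sigma>_def using st by (intro mult_mono) auto
      then show "normal_density 0 \<sigma> x \<le> c" by simp
    qed simp
    also have "\<dots> = ennreal c * ennreal (2 * \<eta>)"
      using \<eta> by (subst nn_integral_cmult_indicator) auto
    also have "\<dots> = ennreal (2 * \<eta> * c)" using c \<eta> by (simp add: ennreal_mult mult_ac)
    finally show ?thesis unfolding eq .
  qed
  have "emeasure M {\<omega> \<in> space M. \<bar>G \<omega> + V \<omega>\<bar> \<le> \<eta>} = emeasure (distr M (borel \<Otimes>\<^sub>M borel) (\<lambda>\<omega>. (G \<omega>, V \<omega>))) ?S"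
    by (subst emeasure_distr[OF _ S0]) (auto intro!: arg_cong[where f = "emeasure M"])
  also have "\<dots> = emeasure (distr M borel G \<Otimes>\<^sub>M distr M borel V) ?S"
    using iv unfolding indep_var_distribution_eq by simp
  also have "\<dots> = (\<integral>\<^sup>+v. emeasure (distr M borel G) ((\<lambda>g. (g, v)) -` ?S) \<partial>distr M borel V)"
    by (rule emeasure_pair_measure_alt2[OF S])
  also have "\<dots> \<le> (\<integral>\<^sup>+v. ennreal (2 * \<eta> * c) \<partial>distr M borel V)" by (intro nn_integral_mono slice)
  also have "\<dots> = ennreal (2 * \<eta> * c)" using D2.emeasure_space_1 by simp
  finally have "prob {\<omega> \<in> space M. \<bar>G \<omega> + V \<omega>\<bar> \<le> \<eta>} \<le> 2 * \<eta> * c"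
    using c \<eta> by (simp add: emeasure_eq_measure)
  then show ?thesis unfolding G_def c_def by simp
qed

text \<open>X belongs to the past of s and Y to the future of s'. The integral of exp (W u - W s')
  over [s', b] is represented by a Riemann sum, so that finitely many increments enter and
  independence of a finite family suffices.\<close>

lemma anti_concentration_with_future:
  fixes X :: "'w \<Rightarrow> real"
  assumes s: "a \<le> s" "s < s'" "s' < b" and X: "X \<in> borel_measurable (F s)" and \<eta>: "\<eta> \<ge> 0" and k: "k > 0"
  defines "Y \<equiv> \<lambda>\<omega>. ln (\<Sum>i<k. exp (W (grid s' b k i) \<omega> - W s' \<omega>) * ((b - s') / real k))"
  shows "{\<omega> \<in> space M. \<bar>(W s' \<omega> - W s \<omega>) + (X \<omega> + Y \<omega>)\<bar> \<le> \<eta>} \<in> sets M"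
    and "prob {\<omega> \<in> space M. \<bar>(W s' \<omega> - W s \<omega>) + (X \<omega> + Y \<omega>)\<bar> \<le> \<eta>} \<le> 2 * \<eta> / sqrt (2 * pi * (s' - s))"
proof -
  have [measurable]: "X \<in> borel_measurable M" by (rule measurable_F_M[OF X]) (use s in auto)
  show "{\<omega> \<in> space M. \<bar>(W s' \<omega> - W s \<omega>) + (X \<omega> + Y \<omega>)\<bar> \<le> \<eta>} \<in> sets M"
    unfolding Y_def by measurable
  \<comment> \<open>In the family \<open>Z\<close>, index 0 carries X, index 1 the increment over
    [s, s'], and the later ones the increments on the grid of [s', b]. The set \<open>I\<close>
    below leaves out index 1 alone.\<close>
  define T where "T i = (case i of 0 \<Rightarrow> s | Suc j \<Rightarrow> grid s' b k j)" for i
  define Z where "Z i \<omega> = (case i of 0 \<Rightarrow> X \<omega> | Suc j \<Rightarrow> W (T (Suc j)) \<omega> - W (T j) \<omega>)" for i \<omega>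
  have Tm: "T i \<le> T (Suc i)" if "i < Suc k" for i
    using grid_mono[of s' b "i - 1" i k] s by (cases i) (auto simp: T_def)
  have ind: "indep_vars (\<lambda>_. borel) Z {..Suc k}"
    unfolding Z_def[abs_def]
  proof (rule indep_initial_and_increments)
    show "X \<in> borel_measurable (F (T 0))" using X by (simp add: T_def)
    show "T (Suc k) \<le> b" using grid_end[OF k, of s' b] by (simp add: T_def)
  qed (use Tm s in \<open>auto simp: T_def\<close>)
  define I where "I = {..Suc k} - {1}"
  define \<psi> where "\<psi> x = x 0 + ln (\<Sum>i<k. exp (\<Sum>j<i. x (Suc (Suc j))) * ((b - s') / real k))" for x :: "nat \<Rightarrow> real"
  have iv: "indep_var (PiM {1} (\<lambda>_. borel)) (\<lambda>\<omega>. restrict (\<lambda>i. Z i \<omega>) {1}) (PiM I (\<lambda>_. borel)) (\<lambda>\<omega>. restrict (\<lambda>i. Z i \<omega>) I)"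
    by (rule indep_var_restrict[OF ind]) (auto simp: I_def)
  have \<psi>m: "\<psi> \<in> borel_measurable (PiM I (\<lambda>_. borel))"
  proof -
    have 0: "(\<lambda>x. x i) \<in> borel_measurable (PiM I (\<lambda>_. borel :: real measure))" if "i \<in> I" for i
      by (rule measurable_component_singleton[OF that])
    have [measurable]: "(\<lambda>x. \<Sum>j<i. x (Suc (Suc j))) \<in> borel_measurable (PiM I (\<lambda>_. borel :: real measure))" if "i \<in> {..<k}" for i
      by (intro borel_measurable_sum 0) (use that in \<open>auto simp: I_def\<close>)
    have [measurable]: "(\<lambda>x. x 0) \<in> borel_measurable (PiM I (\<lambda>_. borel :: real measure))"
      by (rule 0) (auto simp: I_def)
    show ?thesis unfolding \<psi>_def[abs_def] by measurable
  qed
  have "indep_var borel ((\<lambda>x. x 1) \<circ> (\<lambda>\<omega>. restrict (\<lambda>i. Z i \<omega>) {1})) borel (\<psi> \<circ> (\<lambda>\<omega>. restrict (\<lambda>i. Z i \<omega>) I))"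
    by (rule indep_var_compose[OF iv _ \<psi>m]) (rule measurable_component_singleton, simp)
  moreover have "(\<lambda>x. x 1) \<circ> (\<lambda>\<omega>. restrict (\<lambda>i. Z i \<omega>) {1}) = (\<lambda>\<omega>. W s' \<omega> - W s \<omega>)"
    by (auto simp: Z_def T_def)
  moreover have "\<psi> \<circ> (\<lambda>\<omega>. restrict (\<lambda>i. Z i \<omega>) I) = (\<lambda>\<omega>. X \<omega> + Y \<omega>)"
  proof
    fix \<omega>
    have tel: "(\<Sum>j<i. restrict (\<lambda>i. Z i \<omega>) I (Suc (Suc j))) = W (grid s' b k i) \<omega> - W s' \<omega>" if "i < k" for i
    proof -
      have "(\<Sum>j<i. restrict (\<lambda>i. Z i \<omega>) I (Suc (Suc j))) = (\<Sum>j<i. W (grid s' b k (Suc j)) \<omega> - W (grid s' b k j) \<omega>)"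
        by (intro sum.cong refl) (use that in \<open>auto simp: I_def Z_def T_def\<close>)
      then show ?thesis using sum_lessThan_telescope[of "\<lambda>j. W (grid s' b k j) \<omega>" i] by simp
    qed
    have "restrict (\<lambda>i. Z i \<omega>) I 0 = X \<omega>" by (simp add: I_def Z_def)
    moreover have "(\<Sum>i<k. exp (\<Sum>j<i. restrict (\<lambda>i. Z i \<omega>) I (Suc (Suc j))) * ((b - s') / real k))
        = (\<Sum>i<k. exp (W (grid s' b k i) \<omega> - W s' \<omega>) * ((b - s') / real k))"
      by (intro sum.cong refl) (simp only: tel lessThan_iff)
    ultimately show "(\<psi> \<circ> (\<lambda>\<omega>. restrict (\<lambda>i. Z i \<omega>) I)) \<omega> = X \<omega> + Y \<omega>"
      unfolding comp_def \<psi>_def Y_def by simp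
  qed
  ultimately have "indep_var borel (\<lambda>\<omega>. W s' \<omega> - W s \<omega>) borel (\<lambda>\<omega>. X \<omega> + Y \<omega>)" by simp
  then show "prob {\<omega> \<in> space M. \<bar>(W s' \<omega> - W s \<omega>) + (X \<omega> + Y \<omega>)\<bar> \<le> \<eta>} \<le> 2 * \<eta> / sqrt (2 * pi * (s' - s))"
    by (rule increment_anti_concentration[OF s(2) _ \<eta>])
qed

end

context riccati_diffusion
begin

text \<open>An explosion at b would, for all large n, pin the increment over [s n, s' n], of
  variance e^3, to within order e^2 of a value fixed by independent data. This has probability of
  order e^2 / e^(3/2) = sqrt e, which tends to 0.\<close>

lemma no_explosion_at_endpoint: "AE \<omega> in M. P b \<omega> \<noteq> -\<infinity>"
proof -
  define e :: "nat \<Rightarrow> real" where "e n = 1 / real (Suc n)" for n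
  have e: "e n > 0" "e n \<le> 1" for n by (auto simp: e_def)
  have e_lim: "e \<longlonglongrightarrow> 0" unfolding e_def using LIMSEQ_inverse_real_of_nat by (simp add: inverse_eq_divide)
  define s' s where "s' n = b - e n" and "s n = b - e n - e n ^ 3" for n
  have ss: "s n < s' n" "s' n < b" "s' n - s n = e n ^ 3" "b - s' n = e n" for n
    using e[of n] by (auto simp: s_def s'_def)
  have "(\<lambda>n. b - e n - e n ^ 3) \<longlonglongrightarrow> b - 0 - 0 ^ 3" by (intro tendsto_intros e_lim)
  then have s_lim: "s \<longlonglongrightarrow> b" unfolding s_def by simp
  obtain n1 where n1: "\<And>n. n \<ge> n1 \<Longrightarrow> a < s n"
    using order_tendstoD(1)[OF s_lim ab] unfolding eventually_sequentially by blast
  define X where "X n \<omega> = ln (- real_of_ereal (P (s n) \<omega>))" for n \<omega>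
  define G where "G n \<omega> = W (s' n) \<omega> - W (s n) \<omega>" for n \<omega>
  define Y where "Y n k \<omega> = ln (\<Sum>i<k. exp (W (grid (s' n) b k i) \<omega> - W (s' n) \<omega>) * ((b - s' n) / real k))" for n k \<omega>
  \<comment> \<open>Natural C and Riemann sums with Suc k cells make the family of events countable.
    The factor 2 is slack: if the limit in k is at most C e^2, the sums are eventually below 2 C
    e^2.\<close>
  define A where "A C n k = {\<omega> \<in> space M. \<bar>G n \<omega> + (X n \<omega> + Y n (Suc k) \<omega>)\<bar> \<le> 2 * real C * (e n)\<^sup>2}" for C n k
  define bd where "bd C n = 4 * real C * sqrt (e n) / sqrt (2 * pi)" for C n
  have XF: "X n \<in> borel_measurable (F (s n))" if "n \<ge> n1" for n
  proof -
    have [measurable]: "P (s n) \<in> borel_measurable (F (s n))" by (rule P_adapted) (use n1[OF that] ss[of n] in auto)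
    show ?thesis unfolding X_def[abs_def] by measurable
  qed
  have Am: "A C n k \<in> sets M" and Ap: "prob (A C n k) \<le> bd C n" if n: "n \<ge> n1" for C n k
  proof -
    have sn: "a \<le> s n" using n1[OF n] by simp
    have nn: "0 \<le> 2 * real C * (e n)\<^sup>2" by simp
    note ac = anti_concentration_with_future[OF sn ss(1,2) XF[OF n] nn, of "Suc k"]
    show "A C n k \<in> sets M" unfolding A_def G_def Y_def by (rule ac(1)) simp
    have "prob (A C n k) \<le> 2 * (2 * real C * (e n)\<^sup>2) / sqrt (2 * pi * (s' n - s n))"
      unfolding A_def G_def Y_def by (rule ac(2)) simp
    also have "\<dots> = bd C n"
    proof -
      have "sqrt (2 * pi * (s' n - s n)) = sqrt (2 * pi) * (e n * sqrt (e n))"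
        unfolding ss(3) power3_eq_cube using e[of n] by (simp add: real_sqrt_mult)
      moreover have "2 * (2 * real C * (e n)\<^sup>2) = (4 * real C * sqrt (e n)) * (e n * sqrt (e n))"
        using e[of n] by (simp add: power2_eq_square)
      moreover have "(x * (e n * sqrt (e n))) / (y * (e n * sqrt (e n))) = x / y" for x y :: real
        using e(1)[of n] by simp
      ultimately have "2 * (2 * real C * (e n)\<^sup>2) / sqrt (2 * pi * (s' n - s n)) = bd C n"
        unfolding bd_def by (simp only:)
      then show ?thesis .
    qed
    finally show "prob (A C n k) \<le> bd C n" .
  qed
  \<comment> \<open>Pinning of the integral implies pinning for all sufficiently fine sums. The
    union over K is increasing, so the bound \<open>bd C n\<close> passes to it.\<close>
  define L where "L C n = (\<Union>K. \<Inter>k\<in>{K..}. A C n k)" for C n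
  have Lm: "L C n \<in> sets M" and Lp: "prob (L C n) \<le> bd C n" if n: "n \<ge> n1" for C n
  proof -
    have m: "(\<Inter>k\<in>{K..}. A C n k) \<in> sets M" for K using Am[OF n] by (intro sets.countable_INT') auto
    then show "L C n \<in> sets M" unfolding L_def by auto
    have "(\<lambda>K. prob (\<Inter>k\<in>{K..}. A C n k)) \<longlonglongrightarrow> prob (L C n)"
      unfolding L_def by (rule finite_Lim_measure_incseq) (use m in \<open>auto simp: incseq_def\<close>)
    moreover have "prob (\<Inter>k\<in>{K..}. A C n k) \<le> bd C n" for K
      by (rule order_trans[OF finite_measure_mono Ap[OF n, of C K]]) (use Am[OF n] in auto)
    ultimately show "prob (L C n) \<le> bd C n" by (intro LIMSEQ_le_const2) auto
  qed
  \<comment> \<open>Contained in \<open>L C n\<close> for every large n, hence of probability at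
    most the limit 0 of \<open>bd C n\<close>. Starting at \<open>n1\<close> keeps
    \<open>s n\<close> to the right of a.\<close>
  define Bad where "Bad C n0 = (\<Inter>n\<in>{max n0 n1..}. L C n)" for C n0
  have Badm: "Bad C n0 \<in> sets M" for C n0 unfolding Bad_def using Lm by (intro sets.countable_INT') auto
  have Badp: "prob (Bad C n0) = 0" for C n0
  proof -
    have "bd C \<longlonglongrightarrow> 4 * real C * sqrt 0 / sqrt (2 * pi)"
      unfolding bd_def by (intro tendsto_intros e_lim) simp
    then have lim: "bd C \<longlonglongrightarrow> 0" by simp
    have "prob (Bad C n0) \<le> 0"
    proof (rule LIMSEQ_le_const[OF lim], intro exI[of _ "max n0 n1"] allI impI)
      fix n assume n: "max n0 n1 \<le> n"
      have "prob (Bad C n0) \<le> prob (L C n)"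
        by (rule finite_measure_mono) (use n Lm[of n C] in \<open>auto simp: Bad_def\<close>)
      then show "prob (Bad C n0) \<le> bd C n" using Lp[of n C] n by auto
    qed
    then show ?thesis using measure_nonneg[of M "Bad C n0"] by linarith
  qed
  have notBad: "AE \<omega> in M. \<forall>C n0. \<omega> \<notin> Bad C n0"
    unfolding AE_all_countable using Badm Badp by (auto intro!: AE_not_in simp: null_sets_def emeasure_eq_measure)
  from P_path W_continuous riccati_ode notBad AE_space show ?thesis
  proof eventually_elim
    case (elim \<omega>)
    note rp = elim(1)
    have cW: "continuous_on S (\<lambda>t. W t \<omega>)" for S by (rule continuous_on_subset[OF elim(2)]) simp
    show ?case
    proof
      assume Pb: "P b \<omega> = -\<infinity>"
      have "\<exists>C>0. \<exists>e0>0. \<forall>e. 0 < e \<and> e < e0 \<longrightarrow>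
        \<bar>(W (b - e) \<omega> - W (b - e - e ^ 3) \<omega>) + ln (- real_of_ereal (P (b - e - e ^ 3) \<omega>))
          + ln (integral {b - e..b} (\<lambda>u. exp (W u \<omega> - W (b - e) \<omega>)))\<bar> \<le> C * e\<^sup>2"
        by (rule explosion_asymptotics[OF rp ab cW _ Pb]) (use elim(3) in blast)
      then obtain C0 e0 where C0: "C0 > 0" "e0 > 0" and asym: "\<And>e. 0 < e \<Longrightarrow> e < e0 \<Longrightarrow>
        \<bar>(W (b - e) \<omega> - W (b - e - e ^ 3) \<omega>) + ln (- real_of_ereal (P (b - e - e ^ 3) \<omega>))
          + ln (integral {b - e..b} (\<lambda>u. exp (W u \<omega> - W (b - e) \<omega>)))\<bar> \<le> C0 * e\<^sup>2" by blast
      obtain C :: nat where C: "C0 \<le> real C" using real_arch_simple by blast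
      obtain n0 where n0: "\<And>n. n \<ge> n0 \<Longrightarrow> e n < e0"
        using order_tendstoD(2)[OF e_lim C0(2)] unfolding eventually_sequentially by blast
      have "\<omega> \<in> L C n" if n: "n \<ge> max n0 n1" for n
      proof -
        define J where "J = integral {s' n..b} (\<lambda>u. exp (W u \<omega> - W (s' n) \<omega>))"
        have le: "s' n \<le> b" using ss(2)[of n] by simp
        have cE: "continuous_on {s' n..b} (\<lambda>u. exp (W u \<omega> - W (s' n) \<omega>))"
          by (intro continuous_intros cW)
        \<comment> \<open>Positivity of the limit of the Riemann sums makes the logarithm continuous
          there.\<close>
        have Jpos: "J > 0"
        proof -
          obtain u0 where u0: "u0 \<in> {s' n..b}" "\<And>u. u \<in> {s' n..b} \<Longrightarrow> exp (W u0 \<omega> - W (s' n) \<omega>) \<le> exp (W u \<omega> - W (s' n) \<omega>)"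
            using continuous_attains_inf[OF compact_Icc _ cE] le by auto
          have "integral {s' n..b} (\<lambda>u. exp (W u0 \<omega> - W (s' n) \<omega>)) \<le> J"
            unfolding J_def by (rule integral_le) (use u0 cE in \<open>auto intro: integrable_continuous_interval\<close>)
          then have "exp (W u0 \<omega> - W (s' n) \<omega>) * (b - s' n) \<le> J" using le by (simp add: mult.commute)
          moreover have "exp (W u0 \<omega> - W (s' n) \<omega>) * (b - s' n) > 0" using ss(2)[of n] by simp
          ultimately show ?thesis by linarith
        qed
        have "(\<lambda>k. \<Sum>i<k. exp (W (grid (s' n) b k i) \<omega> - W (s' n) \<omega>) * ((b - s' n) / real k)) \<longlonglongrightarrow> J"
          unfolding J_def by (rule riemann_sum[OF le cE])
        then have "(\<lambda>k. Y n k \<omega>) \<longlonglongrightarrow> ln J" unfolding Y_def using Jpos by (intro tendsto_ln) auto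
        then have "(\<lambda>k. Y n (Suc k) \<omega>) \<longlonglongrightarrow> ln J" by (rule LIMSEQ_Suc)
        then have lim: "(\<lambda>k. \<bar>G n \<omega> + (X n \<omega> + Y n (Suc k) \<omega>)\<bar>) \<longlonglongrightarrow> \<bar>G n \<omega> + (X n \<omega> + ln J)\<bar>"
          by (intro tendsto_intros)
        have "\<bar>G n \<omega> + (X n \<omega> + ln J)\<bar> \<le> C0 * (e n)\<^sup>2"
          using asym[of "e n"] e[of n] n0[of n] n unfolding G_def X_def J_def s_def s'_def by (simp add: add.assoc)
        also have "\<dots> \<le> real C * (e n)\<^sup>2" using C by (intro mult_right_mono) auto
        also have "\<dots> < 2 * real C * (e n)\<^sup>2" using C C0 e[of n] by simp
        finally have "\<forall>\<^sub>F k in sequentially. \<bar>G n \<omega> + (X n \<omega> + Y n (Suc k) \<omega>)\<bar> < 2 * real C * (e n)\<^sup>2"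
          using order_tendstoD(2)[OF lim] by blast
        then obtain K where "\<And>k. k \<ge> K \<Longrightarrow> \<bar>G n \<omega> + (X n \<omega> + Y n (Suc k) \<omega>)\<bar> < 2 * real C * (e n)\<^sup>2"
          unfolding eventually_sequentially by blast
        then have "\<omega> \<in> (\<Inter>k\<in>{K..}. A C n k)" using elim(5) by (auto simp: A_def intro: less_imp_le)
        then show ?thesis unfolding L_def by blast
      qed
      then have "\<omega> \<in> Bad C n0" unfolding Bad_def by auto
      then show False using elim(4) by blast
    qed
  qed
qed

end

theorem theorem16:
  fixes M :: "'w measure" and F :: "real \<Rightarrow> 'w measure"
    and W :: "real \<Rightarrow> 'w \<Rightarrow> real" and P :: "real \<Rightarrow> 'w \<Rightarrow> ereal"
    and a b lam :: real
  assumes "a < b"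
    and "two_sided_BM M W"
    and "BM_filtration M F W a b"
    and "restarted_ito_diffusion M F W a b (\<lambda>p. - 2 * lam - p\<^sup>2 + 1 / 2 * p) (\<lambda>p. p) P"
  shows "AE \<omega> in M.
           finite {\<mu>. L_eigenvalue (\<lambda>x. W x \<omega>) a b \<mu> \<and> \<mu> < lam} \<and>
           finite (explosion_times a b (\<lambda>t. P t \<omega>)) \<and>
           card {\<mu>. L_eigenvalue (\<lambda>x. W x \<omega>) a b \<mu> \<and> \<mu> < lam} =
             card (explosion_times a b (\<lambda>t. P t \<omega>))"
proof -
  have "prob_space M" using assms(2) by (simp add: two_sided_BM_def)
  then interpret riccati_diffusion M F W a b P lam
    using assms by (intro riccati_diffusion.intro brownian.intro brownian_axioms.intro riccati_diffusion_axioms.intro)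
  from P_path W_continuous riccati_ode no_explosion_at_endpoint show ?thesis
  proof eventually_elim
    case (elim \<omega>)
    interpret continuous_potential "\<lambda>x. W x \<omega>" a b
      by unfold_locales (use ab elim(2) in \<open>auto intro: continuous_on_subset\<close>)
    note count = eigenvalue_count[OF elim(1) _ elim(4), of lam]
    show ?case using count elim(3) finite_explosion_times[OF elim(1) ab] by blast
  qed
qed

end
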